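(* (i) If $N\ge 3$ and $2^\ast=\frac{2N}{N-2}$, there exists a constant $C>0$ such that for every $u\in H^1(\mathbb{R}^N;m_N)$ $$\int_{\mathbb{R}^N}|\nabla u|^2\,dm_N\ \ge\ C\int_0^{+\infty}u^\ast(t)^2\,t^{\frac{2}{2^\ast}-1}\,dt,$$ that is, $H^1(\mathbb{R}^N;m_N)$ is continuously embedded in the Lorentz space $L^{2^\ast,2}(\mathbb{R}^N;m_N)$. (ii) If $N=2$, there exists a constant $C>0$ such that for every $u\in H^1(\mathbb{R}^2;m_2)$ $$\int_{\mathbb{R}^2}|\nabla u|^2\,dm_2\ \ge\ C\int_0^{+\infty}\frac{u^\ast(t)^2}{t\,\max\{1,\log(1/t)\}^2}\,dt.$$
   Context: The measure $m_N$ on $\mathbb{R}^N$ is $dm_N=e^{|x|^2/2}\,dx$, and $H^1(\mathbb{R}^N;m_N)$ is the weighted Sobolev space of functions $u\in L^2(\mathbb{R}^N;m_N)$ with weak gradient in $L^2(\mathbb{R}^N;m_N)$, with norm $\left(\|u\|^2_{L^2(\mathbb{R}^N;m_N)}+\|\nabla u\|^2_{L^2(\mathbb{R}^N;m_N)}\right)^{1/2}$. For a measurable function $u$ on $\mathbb{R}^N$, its decreasing rearrangement with respect to $m_N$ is $u^\ast(s)=\sup\{t\ge0:\ m_N(\{x\in\mathbb{R}^N:|u(x)|>t\})>s\}$ for $s\in(0,+\infty)$ (with $\sup\emptyset=0$). The Lorentz space $L^{p,q}(\mathbb{R}^N;m_N)$ is the set of measurable $u$ with $\|u\|_{p,q}=\left(\int_0^{+\infty}\left(t^{1/p}u^\ast(t)\right)^q\frac{dt}{t}\right)^{1/q}<+\infty$.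 *)

theory Defs
  imports "HOL-Analysis.Analysis"
begin

section \<open>The weighted measure\<close>

text \<open>The density is taken over the complete measure \<^term>\<open>lebesgue\<close>, so that ``measurable''
  means Lebesgue measurable.\<close>

definition mN :: "(real^'n) measure"
  where "mN = density lebesgue (\<lambda>x. ennreal (exp ((norm x)\<^sup>2 / 2)))"

definition L2_mN :: "(real^'n \<Rightarrow> 'b::real_normed_vector) set"
  where "L2_mN = {f. f \<in> borel_measurable lebesgue \<and> (\<integral>\<^sup>+x. ennreal ((norm (f x))\<^sup>2) \<partial>mN) < \<infinity>}"


section \<open>Weak gradients and the weighted Sobolev space\<close>

definition partial_derivative :: "'n::finite \<Rightarrow> (real^'n \<Rightarrow> real) \<Rightarrow> real^'n \<Rightarrow> real"
  where "partial_derivative i f x = frechet_derivative f (at x) (axis i 1)"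

primrec C_k :: "nat \<Rightarrow> (real^'n::finite \<Rightarrow> real) \<Rightarrow> bool" where
  "C_k 0 f \<longleftrightarrow> continuous_on UNIV f"
| "C_k (Suc k) f \<longleftrightarrow> (\<forall>x. f differentiable (at x)) \<and> (\<forall>i. C_k k (partial_derivative i f))"

definition test_function :: "(real^'n::finite \<Rightarrow> real) \<Rightarrow> bool"
  where "test_function \<phi> \<longleftrightarrow> (\<forall>k. C_k k \<phi>) \<and> compact (closure {x. \<phi> x \<noteq> 0})"

definition locally_integrable :: "(real^'n \<Rightarrow> 'b::euclidean_space) \<Rightarrow> bool"
  where "locally_integrable f \<longleftrightarrow>
    f \<in> borel_measurable lebesgue \<and> (\<forall>K. compact K \<longrightarrow> f absolutely_integrable_on K)"

text \<open>Integration by parts is with respect to Lebesgue measure, not the weighted measure.\<close>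

definition has_weak_gradient :: "(real^'n::finite \<Rightarrow> real) \<Rightarrow> (real^'n \<Rightarrow> real^'n) \<Rightarrow> bool"
  where "has_weak_gradient u g \<longleftrightarrow> locally_integrable u \<and> locally_integrable g \<and>
    (\<forall>\<phi> i. test_function \<phi> \<longrightarrow>
      (\<integral>x. u x * partial_derivative i \<phi> x \<partial>lebesgue) = - (\<integral>x. g x $ i * \<phi> x \<partial>lebesgue))"

text \<open>A weak gradient is unique up to null sets; a representative is chosen.\<close>

definition weak_gradient :: "(real^'n::finite \<Rightarrow> real) \<Rightarrow> real^'n \<Rightarrow> real^'n"
  where "weak_gradient u = (SOME g. has_weak_gradient u g)"

definition H1_mN :: "(real^'n::finite \<Rightarrow> real) set"
  where "H1_mN = {u. u \<in> L2_mN \<and> (\<exists>g. has_weak_gradient u g \<and> g \<in> L2_mN)}"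

text \<open>Real powers of extended nonnegative reals, for positive exponents only.\<close>

definition ennpowr :: "ennreal \<Rightarrow> real \<Rightarrow> ennreal"
  where "ennpowr x a = (if x = \<infinity> then \<infinity> else ennreal (enn2real x powr a))"

definition H1_norm :: "(real^'n::finite \<Rightarrow> real) \<Rightarrow> ennreal"
  where "H1_norm u = ennpowr
    ((\<integral>\<^sup>+x. ennreal ((u x)\<^sup>2) \<partial>mN) + (\<integral>\<^sup>+x. ennreal ((norm (weak_gradient u x))\<^sup>2) \<partial>mN)) (1/2)"


section \<open>Decreasing rearrangement and Lorentz spaces\<close>

text \<open>The supremum is taken in \<^typ>\<open>ennreal\<close>, where the empty set has supremum 0.\<close>

definition rearr :: "(real^'n \<Rightarrow> real) \<Rightarrow> real \<Rightarrow> ennreal"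
  where "rearr u s = Sup {ennreal t | t. t \<ge> 0 \<and> emeasure mN {x. \<bar>u x\<bar> > t} > ennreal s}"

definition lorentz_norm :: "real \<Rightarrow> real \<Rightarrow> (real^'n \<Rightarrow> real) \<Rightarrow> ennreal"
  where "lorentz_norm p q u = ennpowr
    (\<integral>\<^sup>+t\<in>{0<..}. ennpowr (ennreal (t powr (1/p)) * rearr u t) q / ennreal t \<partial>lborel) (1/q)"

definition lorentz_space :: "real \<Rightarrow> real \<Rightarrow> (real^'n \<Rightarrow> real) set"
  where "lorentz_space p q = {u. u \<in> borel_measurable lebesgue \<and> lorentz_norm p q u < \<infinity>}"

definition sobolev_exponent :: "nat \<Rightarrow> real"
  where "sobolev_exponent N = 2 * real N / (real N - 2)"

end

theory Submission
  imports Defs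
begin

text \<open>The constants are not sharp, so no isoperimetric inequality for \<^term>\<open>mN\<close> is needed.
  Write \<open>W x = exp (|x|\<^sup>2 / 2)\<close>. The weak gradient gives, on almost every line parallel to a
  coordinate axis, a continuous representative of \<open>u\<close> that tends to 0 along a sequence.
  Moving along that line away from the coordinate hyperplane \<open>W\<close> increases, so
  \<open>(t' - t) W x\<close> is bounded, whenever \<open>t' \<le> |u x|\<close>, by the integral of \<open>|\<nabla>u| W\<close> over the part of
  the line where \<open>t < |u| < t'\<close>. A Loomis-Whitney argument turns these \<open>N\<close> bounds into
  \<open>(t' - t) m(|u| \<ge> t')^(1 - 1/N) \<le> \<integral>\<^bsub>t < |u| < t'\<^esub> |\<nabla>u| dm\<close>.
  With \<open>t = u\<^sup>*(2\<^sup>-\<^sup>k)\<close> and \<open>t' = u\<^sup>*(2\<^sup>-\<^sup>k\<^sup>-\<^sup>1)\<close> and Cauchy-Schwarz, the increments of \<open>u\<^sup>*\<close> along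
  the dyadic points are square summable with the weight that the discrete Hardy inequalities
  require, which bounds the integral over \<open>(0, 1]\<close>. The integral over \<open>(1, \<infinity>)\<close> is controlled by
  the Poincare inequality \<open>\<integral> u\<^sup>2 dm \<le> \<integral> |\<nabla>u|\<^sup>2 dm\<close> and Chebyshev's inequality.\<close>

section \<open>Smooth functions of one real variable\<close>

text \<open>The passage from the weak gradient to lines rests on one construction. A product bump,
  integrated over its translates along a segment parallel to axis \<open>i\<close>, is again a
  product of smooth functions of one coordinate, and its \<open>i\<close>-th partial derivative is a
  difference of two translates of the bump. Testing with it turns the defining identity into a
  formula for \<open>u (x + h v) - u x\<close> as a line integral. Every test function constructed
  here is such a product, so smoothness in one variable is the notion to develop. The dyadic points
  make the masses cancel: at heights below \<open>rearr u (2^(-k-1))\<close> the superlevel sets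
  have mass at least \<open>2^(-k-1)\<close>, while the band above \<open>rearr u (2^(-k))\<close>
  has mass at most \<open>2^(-k)\<close>. What survives is the weight \<open>\<rho>^k\<close> with
  \<open>\<rho> = 2 powr (2/N - 1)\<close>. For N at least 3 it decays and a geometric Hardy
  inequality applies; for N = 2 it is 1, and the Hardy weight \<open>1/k^2\<close> is the squared
  logarithm of the claim. The gradient side has no \<open>u^2\<close> term, so the first dyadic
  value, from which both Hardy sums start, must also be bounded by the gradient; the Poincare
  inequality does this as well.\<close>

primrec smooth_upto :: "nat \<Rightarrow> (real \<Rightarrow> real) \<Rightarrow> bool" where
  "smooth_upto 0 f \<longleftrightarrow> True"
| "smooth_upto (Suc k) f \<longleftrightarrow> (\<exists>f'. (\<forall>x. (f has_real_derivative f' x) (at x)) \<and> smooth_upto k f')"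

text \<open>\<open>smooth_upto\<close> asks for no continuity of the last derivative. Having every
  order repairs this, since each derivative is then differentiable and so continuous.\<close>

definition smooth :: "(real \<Rightarrow> real) \<Rightarrow> bool"
  where "smooth f \<longleftrightarrow> (\<forall>k. smooth_upto k f)"

lemma smooth_upto_Suc_D: "smooth_upto (Suc k) f \<Longrightarrow> smooth_upto k f"
proof (induction k arbitrary: f)
  case (Suc k)
  then obtain f' where "\<forall>x. (f has_real_derivative f' x) (at x)" "smooth_upto (Suc k) f'"
    by (auto simp: smooth_upto.simps(2)[of "Suc k"])
  with Suc.IH[of f'] show ?case by auto
qed simp

lemma smooth_upto_add: "smooth_upto k f \<Longrightarrow> smooth_upto k g \<Longrightarrow> smooth_upto k (\<lambda>x. f x + g x)"
proof (induction k arbitrary: f g)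
  case (Suc k)
  then obtain f' g' where "\<forall>x. (f has_real_derivative f' x) (at x)" "smooth_upto k f'"
    "\<forall>x. (g has_real_derivative g' x) (at x)" "smooth_upto k g'"
    by auto
  then show ?case
    using Suc.IH[of f' g'] by (auto intro!: exI[of _ "\<lambda>x. f' x + g' x"] derivative_intros)
qed simp

lemma smooth_upto_mult: "smooth_upto k f \<Longrightarrow> smooth_upto k g \<Longrightarrow> smooth_upto k (\<lambda>x. f x * g x)"
proof (induction k arbitrary: f g)
  case (Suc k)
  then obtain f' g' where d: "\<And>x. (f has_real_derivative f' x) (at x)" "smooth_upto k f'"
    "\<And>x. (g has_real_derivative g' x) (at x)" "smooth_upto k g'"
    by auto
  have "((\<lambda>x. f x * g x) has_real_derivative f' x * g x + f x * g' x) (at x)" for x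
    using DERIV_mult[OF d(1) d(3), of x] by (simp add: mult.commute add.commute)
  moreover have "smooth_upto k (\<lambda>x. f' x * g x + f x * g' x)"
    by (intro smooth_upto_add Suc.IH d Suc.prems[THEN smooth_upto_Suc_D])
  ultimately show ?case
    by (auto intro!: exI[of _ "\<lambda>x. f' x * g x + f x * g' x"])
qed simp

lemma smooth_upto_const: "smooth_upto k (\<lambda>x. c)"
  by (induction k arbitrary: c) (auto intro!: exI[of _ "\<lambda>x. 0"])

lemma smooth_upto_affine: "smooth_upto k f \<Longrightarrow> smooth_upto k (\<lambda>x. f (a * x + b))"
proof (induction k arbitrary: f)
  case (Suc k)
  then obtain f' where d: "\<And>x. (f has_real_derivative f' x) (at x)" "smooth_upto k f'"
    by auto
  have "((\<lambda>x. f (a * x + b)) has_real_derivative f' (a * x + b) * a) (at x)" for x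
    by (rule DERIV_chain'[OF _ d(1), unfolded]) (auto intro!: derivative_eq_intros)
  moreover have "smooth_upto k (\<lambda>x. f' (a * x + b) * a)"
    using Suc.IH[OF d(2)] by (intro smooth_upto_mult smooth_upto_const)
  ultimately show ?case
    by (auto intro!: exI[of _ "\<lambda>x. f' (a * x + b) * a"])
qed simp

lemma smooth_mult: "smooth f \<Longrightarrow> smooth g \<Longrightarrow> smooth (\<lambda>x. f x * g x)"
  and smooth_add: "smooth f \<Longrightarrow> smooth g \<Longrightarrow> smooth (\<lambda>x. f x + g x)"
  and smooth_const: "smooth (\<lambda>x. c)"
  and smooth_affine: "smooth f \<Longrightarrow> smooth (\<lambda>x. f (a * x + b))"
  by (auto simp: smooth_def smooth_upto_add smooth_upto_mult smooth_upto_const smooth_upto_affine)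

text \<open>Each order \<open>k\<close> supplies its own witness for the derivative; uniqueness of
  derivatives identifies them, so a single derivative has all orders.\<close>

lemma smooth_derivE:
  assumes "smooth f"
  obtains f' where "\<And>x. (f has_real_derivative f' x) (at x)" "smooth f'"
proof -
  obtain f' where f': "\<And>x. (f has_real_derivative f' x) (at x)"
    using assms unfolding smooth_def by (metis smooth_upto.simps(2))
  have "smooth f'"
    unfolding smooth_def
  proof
    fix k
    obtain f'' where f'': "\<And>x. (f has_real_derivative f'' x) (at x)" "smooth_upto k f''"
      using assms unfolding smooth_def by (metis smooth_upto.simps(2))
    with f' have "f'' = f'" by (auto intro: DERIV_unique)
    with f'' show "smooth_upto k f'" by simp
  qed
  with f' that show ?thesis by blast
qed

lemma smooth_antideriv:
  assumes "smooth f" "\<And>x. (F has_real_derivative f x) (at x)"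
  shows "smooth F"
  unfolding smooth_def
proof
  fix k show "smooth_upto k F"
    using assms by (cases k) (auto simp: smooth_def)
qed

lemma smooth_imp_continuous: "smooth f \<Longrightarrow> continuous_on S f"
  by (metis smooth_derivE DERIV_continuous_on has_field_derivative_at_within)

subsection \<open>Bump functions\<close>

text \<open>The classical function \<open>exp (-1/x)\<close> that is flat at 0, times a power of
  \<open>1/x\<close>. The index makes linear combinations of the family closed under
  differentiation.\<close>

definition flat :: "nat \<Rightarrow> real \<Rightarrow> real"
  where "flat n x = (if x > 0 then inverse x ^ n * exp (- inverse x) else 0)"

lemma flat_tendsto_right: "(flat n \<longlongrightarrow> 0) (at_right 0)"
proof -
  have "((\<lambda>x. inverse x ^ n / exp (inverse x)) \<longlongrightarrow> 0) (at_right (0::real))"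
    using filterlim_compose[OF tendsto_power_div_exp_0 filterlim_inverse_at_top_right] .
  then show ?thesis
    by (rule Lim_transform_eventually)
       (auto simp: flat_def eventually_at_filter exp_minus divide_inverse)
qed

text \<open>Only the origin is delicate: there the right difference quotient of
  \<open>flat n\<close> is \<open>flat (Suc n)\<close>, which tends to 0 because the exponential
  beats every power.\<close>

lemma flat_deriv:
  "(flat n has_real_derivative (- real n * flat (Suc n) x + flat (n + 2) x)) (at x)"
proof -
  consider "x > 0" | "x < 0" | "x = 0" by linarith
  then show ?thesis
  proof cases
    case 1
    have "((\<lambda>x. inverse x ^ n * exp (- inverse x)) has_real_derivative
        (- real n * flat (Suc n) x + flat (n + 2) x)) (at x)"
    proof -
      have "((\<lambda>x. inverse x ^ n * exp (- inverse x)) has_real_derivative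
          real n * (- (inverse x ^ 2) * inverse x ^ (n - 1)) * exp (- inverse x)
          + exp (- inverse x) * inverse x ^ 2 * inverse x ^ n) (at x)"
        using 1 by (auto intro!: derivative_eq_intros simp: power2_eq_square)
      moreover have "real n * (- (y ^ 2) * y ^ (n - 1)) * E + E * y ^ 2 * y ^ n =
          - real n * (y ^ Suc n * E) + y ^ (n + 2) * E" for y E :: real
        by (cases n) (auto simp: power2_eq_square algebra_simps)
      ultimately show ?thesis
        using 1 by (simp only: flat_def if_True)
    qed
    then show ?thesis
      by (rule DERIV_cong_ev[THEN iffD1, OF refl _ refl, rotated])
         (use 1 in \<open>auto simp: flat_def eventually_nhds intro!: exI[of _ "{0<..}"]\<close>)
  next
    case 2
    have "((\<lambda>x. 0) has_real_derivative 0) (at x)" by simp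
    then have "(flat n has_real_derivative 0) (at x)"
      by (rule DERIV_cong_ev[THEN iffD1, OF refl _ refl, rotated])
         (use 2 in \<open>auto simp: flat_def eventually_nhds intro!: exI[of _ "{..<0}"]\<close>)
    with 2 show ?thesis by (simp add: flat_def)
  next
    case 3
    have "((\<lambda>y. flat n y / y) \<longlongrightarrow> 0) (at_right 0)"
      using flat_tendsto_right[of "Suc n"]
      by (rule Lim_transform_eventually)
         (auto simp: flat_def eventually_at_filter divide_inverse)
    moreover have "((\<lambda>y. flat n y / y) \<longlongrightarrow> 0) (at_left 0)"
      by (rule Lim_transform_eventually[OF tendsto_const])
         (auto simp: flat_def eventually_at_filter)
    ultimately have "((\<lambda>y. flat n y / y) \<longlongrightarrow> 0) (at 0)"
      by (simp add: filterlim_split_at)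
    with 3 show ?thesis
      by (simp add: has_field_derivative_iff flat_def)
  qed
qed

lemma smooth_upto_flat: "smooth_upto k (flat n)"
proof (induction k arbitrary: n)
  case (Suc k)
  have "smooth_upto k (\<lambda>x. - real n * flat (Suc n) x + flat (n + 2) x)"
    by (intro smooth_upto_add smooth_upto_mult smooth_upto_const Suc.IH)
  with flat_deriv show ?case
    by (auto intro!: exI[of _ "\<lambda>x. - real n * flat (Suc n) x + flat (n + 2) x"])
qed simp

text \<open>As \<open>k\<close> grows this tends to the indicator function of the interval: \<open>flat 0 (k s) = exp (- 1 / (k s))\<close>
  tends to 1 for \<open>s > 0\<close>, so no normalisation is needed.\<close>

definition bump :: "nat \<Rightarrow> real \<Rightarrow> real \<Rightarrow> real \<Rightarrow> real"
  where "bump k a b x = flat 0 (real k * x - real k * a) * flat 0 (real k * b - real k * x)"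

lemma smooth_bump: "smooth (bump k a b)"
proof -
  have "smooth (flat 0)" by (simp add: smooth_def smooth_upto_flat)
  then have "smooth (\<lambda>x. flat 0 (real k * x + (- (real k * a))) * flat 0 ((- real k) * x + real k * b))"
    by (intro smooth_mult smooth_affine)
  moreover have "bump k a b =
      (\<lambda>x. flat 0 (real k * x + (- (real k * a))) * flat 0 ((- real k) * x + real k * b))"
    by (auto simp: bump_def algebra_simps)
  ultimately show ?thesis by simp
qed

lemma bump_bounds: "0 \<le> bump k a b x" "bump k a b x \<le> 1"
  by (auto simp: bump_def flat_def intro!: mult_le_one)

lemma bump_outside: "x \<notin> {a<..<b} \<Longrightarrow> bump k a b x = 0"
  by (auto simp: bump_def flat_def not_less zero_less_mult_iff simp flip: right_diff_distrib)

lemma bump_tendsto: "(\<lambda>k. bump k a b x) \<longlonglongrightarrow> indicator {a<..<b} x"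
proof (cases "x \<in> {a<..<b}")
  case True
  have *: "(\<lambda>k. flat 0 (real k * c)) \<longlonglongrightarrow> 1" if "c > 0" for c
  proof -
    have "(\<lambda>k. exp (- (inverse (real k) * inverse c))) \<longlonglongrightarrow> exp (- (0 * inverse c))"
      by (intro tendsto_intros lim_inverse_n)
    then have "(\<lambda>k. exp (- (inverse (real k) * inverse c))) \<longlonglongrightarrow> 1" by simp
    then show ?thesis
      by (rule Lim_transform_eventually)
         (use that in \<open>auto simp: flat_def eventually_sequentially intro!: exI[of _ 1]\<close>)
  qed
  have "(\<lambda>k. bump k a b x) \<longlonglongrightarrow> 1 * 1"
    unfolding bump_def right_diff_distrib[symmetric] using True
    by (intro tendsto_mult *) auto
  with True show ?thesis by simp
next
  case False
  then show ?thesis by (simp add: bump_outside)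
qed

subsection \<open>Products of one-dimensional functions as test functions\<close>

lemma has_derivative_prod_coords:
  fixes f :: "'n::finite \<Rightarrow> real \<Rightarrow> real"
  assumes "\<And>i s. (f i has_real_derivative f' i s) (at s)"
  shows "((\<lambda>x::real^'n. \<Prod>j\<in>UNIV. f j (x $ j)) has_derivative
    (\<lambda>y. \<Sum>i\<in>UNIV. f' i (x $ i) * y $ i * (\<Prod>j\<in>UNIV - {i}. f j (x $ j)))) (at x)"
proof -
  have "((\<lambda>x::real^'n. f i (x $ i)) has_derivative (\<lambda>y. f' i (x $ i) * y $ i)) (at x)" for i
    by (rule has_derivative_compose[OF bounded_linear.has_derivative[OF bounded_linear_vec_nth
          has_derivative_ident] assms[unfolded has_field_derivative_def]])
  then show ?thesis
    by (rule has_derivative_prod)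
qed

text \<open>Differentiation in direction \<open>i\<close> changes factor \<open>i\<close> only.
  Coordinate products are thus closed under partial derivatives, which is what the induction over
  \<open>C_k\<close> needs.\<close>

lemma partial_derivative_prod_coords:
  fixes f :: "'n::finite \<Rightarrow> real \<Rightarrow> real"
  assumes f: "\<And>j. smooth (f j)"
  assumes f': "\<And>s. (f i has_real_derivative f' s) (at s)"
  shows "partial_derivative i (\<lambda>x::real^'n. \<Prod>j\<in>UNIV. f j (x $ j)) =
    (\<lambda>x. \<Prod>j\<in>UNIV. (f(i := f')) j (x $ j))"
proof
  fix x :: "real^'n"
  have "\<forall>j. \<exists>f'. \<forall>s. (f j has_real_derivative f' s) (at s)"
    using f by (metis smooth_derivE)
  then obtain D where D: "\<And>j s. (f j has_real_derivative D j s) (at s)" by metis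
  then have "D i = f'" using f' by (blast intro: DERIV_unique)
  have "partial_derivative i (\<lambda>x::real^'n. \<Prod>j\<in>UNIV. f j (x $ j)) x
     = (\<Sum>k\<in>UNIV. D k (x $ k) * (axis i 1 :: real^'n) $ k * (\<Prod>j\<in>UNIV - {k}. f j (x $ j)))"
    unfolding partial_derivative_def
    by (rule fun_cong[OF frechet_derivative_at[OF has_derivative_prod_coords[OF D], symmetric]])
  also have "\<dots> = (\<Sum>k\<in>UNIV. if k = i then f' (x $ i) * (\<Prod>j\<in>UNIV - {i}. f j (x $ j)) else 0)"
    using \<open>D i = f'\<close> by (intro sum.cong) (auto simp: axis_def)
  also have "\<dots> = f' (x $ i) * (\<Prod>j\<in>UNIV - {i}. f j (x $ j))" by simp
  also have "\<dots> = (\<Prod>j\<in>UNIV. (f(i := f')) j (x $ j))"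
    by (subst prod.remove[of UNIV i]) (auto intro!: prod.cong)
  finally show "partial_derivative i (\<lambda>x::real^'n. \<Prod>j\<in>UNIV. f j (x $ j)) x =
    (\<Prod>j\<in>UNIV. (f(i := f')) j (x $ j))" .
qed

lemma C_k_prod_coords:
  fixes f :: "'n::finite \<Rightarrow> real \<Rightarrow> real"
  assumes "\<And>j. smooth (f j)"
  shows "C_k k (\<lambda>x::real^'n. \<Prod>j\<in>UNIV. f j (x $ j))"
  using assms
proof (induction k arbitrary: f)
  case 0
  have "continuous_on UNIV (\<lambda>x::real^'n. f j (x $ j))" for j
    by (rule continuous_on_compose2[OF smooth_imp_continuous[OF 0, of UNIV]])
       (auto intro!: continuous_intros)
  then show ?case
    by (simp add: continuous_on_prod)
next
  case (Suc k)
  have "\<forall>j. \<exists>f'. (\<forall>s. (f j has_real_derivative f' s) (at s)) \<and> smooth f'"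
    using Suc.prems by (metis smooth_derivE)
  then obtain D where D: "\<And>j s. (f j has_real_derivative D j s) (at s)" "\<And>j. smooth (D j)"
    by metis
  have "(\<lambda>x::real^'n. \<Prod>j\<in>UNIV. f j (x $ j)) differentiable (at x)" for x
    using has_derivative_prod_coords[of f D x, OF D(1)] unfolding differentiable_def by blast
  moreover have "C_k k (partial_derivative i (\<lambda>x::real^'n. \<Prod>j\<in>UNIV. f j (x $ j)))" for i
    unfolding partial_derivative_prod_coords[OF Suc.prems D(1)]
    by (rule Suc.IH) (use Suc.prems D in auto)
  ultimately show ?case by simp
qed

lemma test_function_prod_coords:
  fixes f :: "'n::finite \<Rightarrow> real \<Rightarrow> real"
  assumes "\<And>j. smooth (f j)" and supp: "\<And>j s. s \<notin> {a j..b j} \<Longrightarrow> f j s = 0"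
  shows "test_function (\<lambda>x::real^'n. \<Prod>j\<in>UNIV. f j (x $ j))"
proof -
  have "{x::real^'n. (\<Prod>j\<in>UNIV. f j (x $ j)) \<noteq> 0} \<subseteq> cbox (\<chi> j. a j) (\<chi> j. b j)"
    using supp by (fastforce simp: mem_box_cart)
  then have "bounded {x::real^'n. (\<Prod>j\<in>UNIV. f j (x $ j)) \<noteq> 0}"
    using bounded_subset bounded_cbox by blast
  then show ?thesis
    using C_k_prod_coords[of f, OF assms(1)] unfolding test_function_def compact_closure by blast
qed

section \<open>The fundamental lemma of the calculus of variations\<close>

text \<open>Local integrability of Borel functions in terms of open boxes. Boxes generate the Borel
  sets, and their indicators are pointwise limits of smooth bumps.\<close>

definition box_integrable :: "('a::euclidean_space \<Rightarrow> real) \<Rightarrow> bool"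
  where "box_integrable f \<longleftrightarrow> f \<in> borel_measurable borel \<and>
    (\<forall>a b. integrable lborel (\<lambda>x. indicator (box a b) x * f x))"

lemma box_integrable_measurable: "box_integrable f \<Longrightarrow> f \<in> borel_measurable borel"
  by (simp add: box_integrable_def)

text \<open>The measures with densities \<open>ennreal (D x)\<close> and
  \<open>ennreal (- D x)\<close> agree on boxes, an intersection-stable generator on which they are
  finite, so they coincide. By uniqueness of densities the positive and negative parts of
  \<open>D\<close> agree almost everywhere; one of them is always 0, hence so is
  \<open>D\<close>.\<close>

lemma AE_zero_if_box_integrals_zero:
  fixes D :: "'a::euclidean_space \<Rightarrow> real"
  assumes D: "box_integrable D"
    and zero: "\<And>a b. (\<integral>x. indicator (box a b) x * D x \<partial>lborel) = 0"
  shows "AE x in lborel. D x = 0"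
proof -
  have [measurable]: "D \<in> borel_measurable borel"
    using D by (rule box_integrable_measurable)
  have eq: "emeasure (density lborel (\<lambda>x. ennreal (D x))) (box a b) =
      emeasure (density lborel (\<lambda>x. ennreal (- D x))) (box a b)" (is "?P = ?M")
    and fin: "emeasure (density lborel (\<lambda>x. ennreal (D x))) (box a b) \<noteq> \<infinity>" for a b
  proof -
    let ?f = "\<lambda>x. indicator (box a b) x * D x"
    have int: "integrable lborel ?f" using D by (simp add: box_integrable_def)
    have 1: "?P = (\<integral>\<^sup>+x. ennreal (?f x) \<partial>lborel)"
      by (subst emeasure_density) (auto intro!: nn_integral_cong simp: indicator_def)
    have 2: "?M = (\<integral>\<^sup>+x. ennreal (- ?f x) \<partial>lborel)"
      by (subst emeasure_density) (auto intro!: nn_integral_cong simp: indicator_def)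
    have f: "?P \<noteq> \<infinity>" "?M \<noteq> \<infinity>"
      using int by (simp_all add: 1 2 real_integrable_def)
    have "enn2real ?P - enn2real ?M = 0"
      using real_lebesgue_integral_def[OF int] zero[of a b] by (simp add: 1 2)
    with f show "?P = ?M" by (metis eq_iff_diff_eq_0 ennreal_enn2real infinity_ennreal_def
        top.not_eq_extremum)
    show "?P \<noteq> \<infinity>" by fact
  qed
  have "density lborel (\<lambda>x. ennreal (D x)) = density lborel (\<lambda>x. ennreal (- D x))"
  proof (rule measure_eqI_generator_eq)
    let ?E = "range (\<lambda>(a, b). box a b::'a set)"
    show "Int_stable ?E"
      by (auto simp: Int_stable_def box_Int_box)
    show "?E \<subseteq> Pow UNIV" by auto
    show "sets (density lborel (\<lambda>x. ennreal (D x))) = sigma_sets UNIV ?E"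
      "sets (density lborel (\<lambda>x. ennreal (- D x))) = sigma_sets UNIV ?E"
      by (simp_all add: borel_eq_box)
    let ?A = "\<lambda>n::nat. box (- (real n *\<^sub>R One)) (real n *\<^sub>R One) :: 'a set"
    show "range ?A \<subseteq> ?E" by auto
    show "(\<Union>i. ?A i) = UNIV"
      unfolding UN_box_eq_UNIV by simp
    show "emeasure (density lborel (\<lambda>x. ennreal (D x))) (?A i) \<noteq> \<infinity>" for i
      by (rule fin)
  qed (auto simp: eq)
  then have "AE x in lborel. ennreal (D x) = ennreal (- D x)"
    by (intro sigma_finite_measure.density_unique[OF sigma_finite_lborel]) auto
  then show ?thesis
  proof eventually_elim
    case (elim x)
    show ?case
    proof (rule ccontr)
      assume "D x \<noteq> 0"
      then consider "D x > 0" | "D x < 0" by linarith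
      then show False using elim by cases (simp_all add: ennreal_neg)
    qed
  qed
qed

definition box_bump :: "nat \<Rightarrow> real^'n::finite \<Rightarrow> real^'n \<Rightarrow> real^'n \<Rightarrow> real"
  where "box_bump k a b x = (\<Prod>j\<in>UNIV. bump k (a $ j) (b $ j) (x $ j))"

lemma box_bump_measurable[measurable]: "box_bump k a b \<in> borel_measurable borel"
proof -
  have [measurable]: "bump k c d \<in> borel_measurable borel" for c d
    by (intro borel_measurable_continuous_onI smooth_imp_continuous smooth_bump)
  show ?thesis unfolding box_bump_def[abs_def] by measurable
qed

lemma box_bump_le: "\<bar>box_bump k a b x\<bar> \<le> indicator (box a b) x"
proof (cases "x \<in> box a b")
  case True
  then show ?thesis
    using bump_bounds by (simp add: box_bump_def abs_prod prod_le_1 bump_bounds)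
next
  case False
  then obtain j where "x $ j \<notin> {a $ j <..< b $ j}" by (auto simp: mem_box_cart)
  then have "box_bump k a b x = 0"
    using bump_outside[of "x $ j"] by (auto simp: box_bump_def)
  then show ?thesis by simp
qed

lemma box_bump_tendsto: "(\<lambda>k. box_bump k a b x) \<longlonglongrightarrow> indicator (box a b) x"
proof -
  have "(\<lambda>k. box_bump k a b x) \<longlonglongrightarrow> (\<Prod>j\<in>UNIV. indicator {a $ j<..<b $ j} (x $ j))"
    unfolding box_bump_def by (intro tendsto_prod bump_tendsto)
  also have "(\<Prod>j\<in>UNIV. indicator {a $ j<..<b $ j} (x $ j)) = (indicator (box a b) x :: real)"
    by (auto simp: indicator_def mem_box_cart prod_zero_iff)
  finally show ?thesis .
qed

lemma test_function_box_bump: "test_function (box_bump k a b)"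
  unfolding box_bump_def[abs_def]
  by (rule test_function_prod_coords[where a="\<lambda>j. a $ j" and b="\<lambda>j. b $ j"])
     (auto intro!: smooth_bump bump_outside)

text \<open>Dominated convergence: the bumps are bounded by the indicator of their box and converge
  to it.\<close>

lemma AE_zero_if_bump_integrals_zero:
  fixes D :: "real^'n::finite \<Rightarrow> real"
  assumes D: "box_integrable D"
    and zero: "\<And>k a b. (\<integral>x. box_bump k a b x * D x \<partial>lborel) = 0"
  shows "AE x in lborel. D x = 0"
proof (rule AE_zero_if_box_integrals_zero[OF D])
  have [measurable]: "D \<in> borel_measurable borel"
    using D by (rule box_integrable_measurable)
  fix a b :: "real^'n"
  have "(\<lambda>k. \<integral>x. box_bump k a b x * D x \<partial>lborel) \<longlonglongrightarrow> (\<integral>x. indicator (box a b) x * D x \<partial>lborel)"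
  proof (rule integral_dominated_convergence[where w="\<lambda>x. \<bar>indicator (box a b) x * D x\<bar>"])
    show "integrable lborel (\<lambda>x. \<bar>indicator (box a b) x * D x\<bar>)"
      using D by (simp add: box_integrable_def)
    show "AE x in lborel. (\<lambda>k. box_bump k a b x * D x) \<longlonglongrightarrow> indicator (box a b) x * D x"
      by (intro AE_I2 tendsto_mult box_bump_tendsto tendsto_const)
    show "AE x in lborel. norm (box_bump k a b x * D x) \<le> \<bar>indicator (box a b) x * D x\<bar>" for k
      using box_bump_le[of k a b]
      by (intro AE_I2) (auto simp: abs_mult intro!: mult_right_mono)
  qed auto
  then show "(\<integral>x. indicator (box a b) x * D x \<partial>lborel) = 0"
    by (simp add: zero LIMSEQ_const_iff)
qed

lemma box_integrable_diff:
  assumes "box_integrable f" "box_integrable g"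
  shows "box_integrable (\<lambda>x. f x - g x)"
  unfolding box_integrable_def right_diff_distrib
  using assms by (simp add: box_integrable_def borel_measurable_diff)

lemma box_bump_mult_integrable:
  assumes "box_integrable D"
  shows "integrable lborel (\<lambda>x. box_bump k a b x * D x)"
proof (rule Bochner_Integration.integrable_bound)
  show "integrable lborel (\<lambda>x. indicator (box a b) x * D x)"
    using assms by (simp add: box_integrable_def)
  have [measurable]: "D \<in> borel_measurable borel"
    using assms by (rule box_integrable_measurable)
  show "(\<lambda>x. box_bump k a b x * D x) \<in> borel_measurable lborel" by measurable
  show "AE x in lborel. norm (box_bump k a b x * D x) \<le> norm (indicator (box a b) x * D x)"
    using box_bump_le[of k a b]
    by (intro AE_I2) (auto simp: abs_mult intro!: mult_right_mono)
qed

subsection \<open>Borel representatives\<close>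

text \<open>The identity is moved from \<open>lebesgue\<close> to \<open>lborel\<close> because the
  Fubini arguments below need joint measurability of maps such as
  \<open>(x, \<tau>) \<mapsto> u (x + \<tau> v)\<close>, which Borel functions provide.\<close>

definition borel_weak_gradient :: "(real^'n::finite \<Rightarrow> real) \<Rightarrow> (real^'n \<Rightarrow> real^'n) \<Rightarrow> bool"
  where "borel_weak_gradient u g \<longleftrightarrow> box_integrable u \<and> (\<forall>i. box_integrable (\<lambda>x. g x $ i)) \<and>
    (\<forall>\<phi> i. test_function \<phi> \<longrightarrow>
      (\<integral>x. u x * partial_derivative i \<phi> x \<partial>lborel) = - (\<integral>x. g x $ i * \<phi> x \<partial>lborel))"

lemma test_function_measurable:
  assumes "test_function \<phi>"
  shows "\<phi> \<in> borel_measurable borel" "partial_derivative i \<phi> \<in> borel_measurable borel"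
proof -
  have C: "C_k k \<phi>" for k using assms by (simp add: test_function_def)
  show "\<phi> \<in> borel_measurable borel"
    using C[of 0] by (intro borel_measurable_continuous_onI) simp
  show "partial_derivative i \<phi> \<in> borel_measurable borel"
    using C[of "Suc 0"] by (intro borel_measurable_continuous_onI) simp
qed

lemma box_integrable_cong_AE:
  assumes f: "\<And>K. compact K \<Longrightarrow> f absolutely_integrable_on K"
    and f': "f' \<in> borel_measurable borel" "AE x in lborel. f x = f' x"
  shows "box_integrable f'"
  unfolding box_integrable_def
proof (intro conjI allI f')
  fix a b :: 'a
  have [measurable]: "f' \<in> borel_measurable borel" by fact
  have "f absolutely_integrable_on box a b"
    by (rule set_integrable_subset[OF f[OF compact_cbox] _ box_subset_cbox]) simp
  then have "integrable lebesgue (\<lambda>x. indicator (box a b) x * f x)"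
    by (simp add: set_integrable_def)
  then have "integrable lebesgue (\<lambda>x. indicator (box a b) x * f' x)"
    by (rule integrable_cong_AE_imp)
       (use f' in \<open>auto simp: AE_completion_iff intro!: measurable_completion\<close>)
  then show "integrable lborel (\<lambda>x. indicator (box a b) x * f' x)"
    by (subst (asm) integrable_completion) auto
qed

lemma AE_borel_representative:
  fixes g :: "'a::euclidean_space \<Rightarrow> real^'n::finite"
  assumes "g \<in> borel_measurable lebesgue"
  obtains g' where "g' \<in> borel_measurable borel" "AE x in lborel. g x = g' x"
proof -
  have "\<forall>i. \<exists>h. h \<in> borel_measurable borel \<and> (AE x in lborel. g x $ i = h x)"
  proof
    fix i
    have "(\<lambda>x. g x $ i) \<in> borel_measurable lebesgue"
      using measurable_compose[OF assms borel_measurable_nth] by simp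
    from completion_ex_borel_measurable_real[OF this]
    show "\<exists>h. h \<in> borel_measurable borel \<and> (AE x in lborel. g x $ i = h x)"
      by auto
  qed
  then obtain h where h: "\<And>i. h i \<in> borel_measurable borel" "\<And>i. AE x in lborel. g x $ i = h i x"
    by metis
  have "(\<lambda>x. \<chi> i. h i x) \<in> borel_measurable borel"
    using h(1) by (subst borel_measurable_euclidean_space) (auto simp: Basis_vec_def inner_axis)
  moreover have "AE x in lborel. \<forall>i. g x $ i = h i x"
    using h(2) by (simp add: AE_all_countable)
  then have "AE x in lborel. g x = (\<chi> i. h i x)"
    by eventually_elim (simp add: vec_eq_iff)
  ultimately show thesis by (rule that)
qed


lemma has_weak_gradient_borel:
  assumes w: "has_weak_gradient u g"
    and u': "u' \<in> borel_measurable borel" "AE x in lborel. u x = u' x"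
    and g': "g' \<in> borel_measurable borel" "AE x in lborel. g x = g' x"
  shows "borel_weak_gradient u' g'"
proof -
  have [measurable]: "u' \<in> borel_measurable borel" "g' \<in> borel_measurable borel" by fact+
  have [measurable]: "u \<in> borel_measurable lebesgue" "g \<in> borel_measurable lebesgue"
    and iu: "\<And>K. compact K \<Longrightarrow> u absolutely_integrable_on K"
    and ig: "\<And>K. compact K \<Longrightarrow> g absolutely_integrable_on K"
    using w by (auto simp: has_weak_gradient_def locally_integrable_def)
  have "box_integrable u'"
    by (rule box_integrable_cong_AE[OF iu u'])
  moreover have "box_integrable (\<lambda>x. g' x $ i)" for i
  proof (rule box_integrable_cong_AE)
    show "(\<lambda>x. g x $ i) absolutely_integrable_on K" if "compact K" for K
      using absolutely_integrable_linear[OF ig[OF that] bounded_linear_vec_nth]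
      by (simp add: o_def)
    show "AE x in lborel. g x $ i = g' x $ i"
      using g'(2) by eventually_elim simp
    show "(\<lambda>x. g' x $ i) \<in> borel_measurable borel"
      using measurable_compose[OF g'(1) borel_measurable_nth] by simp
  qed
  moreover have "(\<integral>x. u' x * partial_derivative i \<phi> x \<partial>lborel) = - (\<integral>x. g' x $ i * \<phi> x \<partial>lborel)"
    if \<phi>: "test_function \<phi>" for \<phi> i
  proof -
    note [measurable] = test_function_measurable[OF \<phi>]
    have [measurable]: "u' \<in> borel_measurable lebesgue" "g' \<in> borel_measurable lebesgue"
      "\<phi> \<in> borel_measurable lebesgue" "partial_derivative i \<phi> \<in> borel_measurable lebesgue"
      by (auto intro!: measurable_completion)
    have [measurable]: "(\<lambda>x. g' x $ i) \<in> borel_measurable lebesgue"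
      "(\<lambda>x. g x $ i) \<in> borel_measurable lebesgue" "(\<lambda>x. g' x $ i) \<in> borel_measurable borel"
      by (rule measurable_compose[OF _ borel_measurable_nth], measurable)+
    have "(\<integral>x. u' x * partial_derivative i \<phi> x \<partial>lborel) =
        (\<integral>x. u' x * partial_derivative i \<phi> x \<partial>lebesgue)"
      by (subst integral_completion) auto
    also have "\<dots> = (\<integral>x. u x * partial_derivative i \<phi> x \<partial>lebesgue)"
      by (intro integral_cong_AE) (use u'(2) in \<open>auto simp: AE_completion_iff\<close>)
    also have "\<dots> = - (\<integral>x. g x $ i * \<phi> x \<partial>lebesgue)"
      using w \<phi> by (simp add: has_weak_gradient_def)
    also have "(\<integral>x. g x $ i * \<phi> x \<partial>lebesgue) = (\<integral>x. g' x $ i * \<phi> x \<partial>lebesgue)"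
      by (intro integral_cong_AE) (use g'(2) in \<open>auto simp: AE_completion_iff\<close>)
    also have "\<dots> = (\<integral>x. g' x $ i * \<phi> x \<partial>lborel)"
      by (subst integral_completion) auto
    finally show ?thesis .
  qed
  ultimately show ?thesis by (simp add: borel_weak_gradient_def)
qed

lemma borel_weak_gradient_unique:
  assumes "borel_weak_gradient u g" "borel_weak_gradient u g'"
  shows "AE x in lborel. g x = g' x"
proof -
  have int: "box_integrable (\<lambda>x. g x $ i)" "box_integrable (\<lambda>x. g' x $ i)" for i
    using assms by (auto simp: borel_weak_gradient_def)
  have "AE x in lborel. g x $ i - g' x $ i = 0" for i
  proof (rule AE_zero_if_bump_integrals_zero)
    show "box_integrable (\<lambda>x. g x $ i - g' x $ i)"
      by (rule box_integrable_diff[OF int])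
    fix k a b
    have "(\<integral>x. g x $ i * box_bump k a b x \<partial>lborel) = (\<integral>x. g' x $ i * box_bump k a b x \<partial>lborel)"
    proof -
      have "- (\<integral>x. g x $ i * box_bump k a b x \<partial>lborel) = - (\<integral>x. g' x $ i * box_bump k a b x \<partial>lborel)"
        using assms[unfolded borel_weak_gradient_def, THEN conjunct2, THEN conjunct2,
            rule_format, OF test_function_box_bump[of k a b], of i]
        by (rule trans[OF sym])
      then show ?thesis by simp
    qed
    then show "(\<integral>x. box_bump k a b x * (g x $ i - g' x $ i) \<partial>lborel) = 0"
      unfolding right_diff_distrib
      by (subst Bochner_Integration.integral_diff[OF box_bump_mult_integrable[OF int(1)]
            box_bump_mult_integrable[OF int(2)]])
         (simp add: mult.commute[of "box_bump k a b _"])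
  qed
  then have "AE x in lborel. \<forall>i. g x $ i - g' x $ i = 0"
    by (simp add: AE_all_countable)
  then show ?thesis by eventually_elim (simp add: vec_eq_iff)
qed

text \<open>\<open>weak_gradient\<close> is an arbitrary choice, while membership in
  \<open>H1_mN\<close> bounds only some weak gradient. Uniqueness carries the bound over to the
  chosen one.\<close>

lemma has_weak_gradient_unique:
  assumes g: "has_weak_gradient u g" and g': "has_weak_gradient u g'"
  shows "AE x in lborel. g x = g' x"
proof -
  have "g \<in> borel_measurable lebesgue" "g' \<in> borel_measurable lebesgue" "u \<in> borel_measurable lebesgue"
    using g g' by (auto simp: has_weak_gradient_def locally_integrable_def)
  note m = this
  obtain h where "h \<in> borel_measurable borel" "AE x in lborel. g x = h x"
    using AE_borel_representative[OF m(1)] .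
  moreover obtain h' where "h' \<in> borel_measurable borel" "AE x in lborel. g' x = h' x"
    using AE_borel_representative[OF m(2)] .
  moreover obtain v where "v \<in> borel_measurable borel" "AE x in lborel. u x = v x"
    using completion_ex_borel_measurable_real[OF m(3)] by auto
  ultimately have *: "h \<in> borel_measurable borel" "AE x in lborel. g x = h x"
    "h' \<in> borel_measurable borel" "AE x in lborel. g' x = h' x"
    "v \<in> borel_measurable borel" "AE x in lborel. u x = v x" by auto
  have "AE x in lborel. h x = h' x"
    by (rule borel_weak_gradient_unique[OF has_weak_gradient_borel[OF g *(5,6) *(1,2)]
      has_weak_gradient_borel[OF g' *(5,6) *(3,4)]])
  with *(2,4) show ?thesis by eventually_elim simp
qed

section \<open>Difference quotients along coordinate axes\<close>

lemma nn_integral_lborel_shift: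
  fixes f :: "'a::euclidean_space \<Rightarrow> ennreal"
  assumes [measurable]: "f \<in> borel_measurable borel"
  shows "(\<integral>\<^sup>+x. f (x + c) \<partial>lborel) = (\<integral>\<^sup>+x. f x \<partial>lborel)"
  by (subst (2) lborel_distr_plus[of c, symmetric])
     (simp add: nn_integral_distr add.commute)

lemma integral_lborel_shift:
  fixes f :: "'a::euclidean_space \<Rightarrow> real"
  assumes [measurable]: "f \<in> borel_measurable borel"
  shows "(\<integral>x. f (x + c) \<partial>lborel) = (\<integral>x. f x \<partial>lborel)"
  by (subst (2) lborel_distr_plus[of c, symmetric])
     (simp add: integral_distr add.commute)

lemma integrable_lborel_shift:
  fixes f :: "'a::euclidean_space \<Rightarrow> real"
  assumes "integrable lborel f"
  shows "integrable lborel (\<lambda>x. f (x + c))"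
proof -
  have "integrable (distr lborel borel ((+) c)) f"
    using assms by (simp add: lborel_distr_plus)
  then show ?thesis
    by (subst (asm) integrable_distr_eq) (use assms in \<open>auto simp: add.commute\<close>)
qed

lemma box_integrable_shift:
  fixes f :: "'a::euclidean_space \<Rightarrow> real"
  assumes f: "box_integrable f"
  shows "box_integrable (\<lambda>x. f (x + c))"
  unfolding box_integrable_def
proof (intro conjI allI)
  have [measurable]: "f \<in> borel_measurable borel"
    using f by (rule box_integrable_measurable)
  show "(\<lambda>x. f (x + c)) \<in> borel_measurable borel" by measurable
  fix a b
  have "integrable lborel (\<lambda>x. indicator (box (a + c) (b + c)) (x + c) * f (x + c))"
    using f by (intro integrable_lborel_shift) (simp add: box_integrable_def)
  then show "integrable lborel (\<lambda>x. indicator (box a b) x * f (x + c))"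
    by (rule Bochner_Integration.integrable_cong[THEN iffD1, rotated -1])
       (auto simp: indicator_def mem_box inner_add_left)
qed

text \<open>With an antiderivative \<open>H\<close> of \<open>\<beta>\<close>, the integral of the
  translates of \<open>\<beta>\<close> is \<open>\<sigma> * (H s - H (s - h * \<sigma>))\<close>,
  whose derivative is a difference of translates. This \<open>F\<close> becomes the
  \<open>i\<close>-th factor of the test function in
  \<open>weak_gradient_difference\<close>.\<close>

lemma line_average:
  assumes \<beta>: "smooth \<beta>" "\<And>s. s \<notin> {a..b} \<Longrightarrow> \<beta> s = 0" and "0 \<le> h" and \<sigma>: "\<sigma> = 1 \<or> \<sigma> = -1"
  obtains F where "smooth F" "\<And>s. (F has_real_derivative \<sigma> * (\<beta> s - \<beta> (s - h * \<sigma>))) (at s)"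
    "\<And>s. s \<notin> {a - h..b + h} \<Longrightarrow> F s = 0"
    "\<And>s. (\<integral>\<tau>. indicator {0..h} \<tau> * \<beta> (s - \<tau> * \<sigma>) \<partial>lborel) = F s"
proof -
  have cont: "continuous_on S \<beta>" for S
    using \<beta>(1) by (rule smooth_imp_continuous)
  have "\<exists>H. \<forall>s. (H has_vector_derivative \<beta> s) (at s)"
    using einterval_antiderivative[of "-\<infinity>" \<infinity> \<beta>] cont[of UNIV]
    by (auto simp: continuous_on_eq_continuous_at)
  then obtain H where H: "\<And>s. (H has_real_derivative \<beta> s) (at s)"
    by (auto simp: has_real_derivative_iff_has_vector_derivative)
  define F where "F s = \<sigma> * (H s - H (s - h * \<sigma>))" for s
  have F': "(F has_real_derivative \<sigma> * (\<beta> s - \<beta> (s - h * \<sigma>))) (at s)" for s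
    unfolding F_def
    by (auto intro!: derivative_eq_intros DERIV_chain2[OF H])
  have "smooth (\<lambda>s. \<sigma> * (\<beta> s + (- 1) * \<beta> (1 * s + (- h * \<sigma>))))"
    by (intro smooth_mult smooth_const smooth_add smooth_affine \<beta>)
  then have "smooth F"
    by (rule smooth_antideriv) (use F' in simp)
  moreover have F_int: "(\<integral>\<tau>. indicator {0..h} \<tau> * \<beta> (s - \<tau> * \<sigma>) \<partial>lborel) = F s" for s
  proof -
    have "(\<integral>\<tau>. \<beta> (s - \<tau> * \<sigma>) * indicator {0..h} \<tau> \<partial>lborel) =
        - \<sigma> * H (s - h * \<sigma>) - (- \<sigma> * H (s - 0 * \<sigma>))"
    proof (rule integral_FTC_Icc_real[OF \<open>0 \<le> h\<close>])
      fix x assume "0 \<le> x" "x \<le> h"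
      show "((\<lambda>\<tau>. - \<sigma> * H (s - \<tau> * \<sigma>)) has_real_derivative \<beta> (s - x * \<sigma>)) (at x)"
      proof -
        have "((\<lambda>\<tau>. H (s - \<tau> * \<sigma>)) has_real_derivative \<beta> (s - x * \<sigma>) * (- \<sigma>)) (at x)"
          by (rule DERIV_chain2[OF H]) (auto intro!: derivative_eq_intros)
        from DERIV_cmult[OF this, of "- \<sigma>"] show ?thesis
          using \<sigma> by (elim disjE) simp_all
      qed
      have "isCont \<beta> y" for y
        using cont[of UNIV] by (simp add: continuous_on_eq_continuous_at)
      then show "isCont (\<lambda>\<tau>. \<beta> (s - \<tau> * \<sigma>)) x"
        by (intro isCont_o2[where g=\<beta> and f="\<lambda>\<tau>. s - \<tau> * \<sigma>"] continuous_intros)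
    qed
    then show ?thesis by (simp add: F_def algebra_simps)
  qed
  moreover have "F s = 0" if s: "s \<notin> {a - h..b + h}" for s
  proof -
    have "indicator {0..h} \<tau> * \<beta> (s - \<tau> * \<sigma>) = 0" for \<tau>
    proof (cases "\<tau> \<in> {0..h}")
      case True
      then have "s - \<tau> * \<sigma> \<notin> {a..b}"
        using s \<sigma> by (elim disjE) auto
      then show ?thesis by (simp add: \<beta>(2))
    qed simp
    then show ?thesis unfolding F_int[of s, symmetric] by (simp only: integral_zero)
  qed
  ultimately show thesis using F' by (intro that)
qed

text \<open>Justifies the Fubini exchanges in \<open>weak_gradient_difference\<close>. The
  translates of a box by \<open>\<tau> v\<close> with \<open>\<tau>\<close> in a bounded interval
  stay inside one larger box, so local integrability of \<open>w\<close> is enough.\<close>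

lemma shift_mult_integrable:
  fixes w \<theta> :: "'a::euclidean_space \<Rightarrow> real"
  assumes w: "box_integrable w" and [measurable]: "\<theta> \<in> borel_measurable borel"
    and \<theta>: "\<And>x. \<bar>\<theta> x\<bar> \<le> indicator (box a b) x"
  shows "integrable (lborel \<Otimes>\<^sub>M lborel) (\<lambda>(\<tau>::real, x). indicator {0..h} \<tau> * (w x * \<theta> (x - \<tau> *\<^sub>R v)))"
    and "integrable (lborel \<Otimes>\<^sub>M lborel) (\<lambda>(\<tau>::real, x). indicator {0..h} \<tau> * (w (x + \<tau> *\<^sub>R v) * \<theta> x))"
proof -
  have [measurable]: "w \<in> borel_measurable borel"
    using w by (rule box_integrable_measurable)
  have "bounded ((\<lambda>(x, \<tau>). x + \<tau> *\<^sub>R v) ` (cbox a b \<times> {0..h}))"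
    by (intro compact_imp_bounded compact_continuous_image compact_Times)
       (auto intro!: continuous_intros simp: case_prod_unfold)
  then obtain c where "(\<lambda>(x, \<tau>). x + \<tau> *\<^sub>R v) ` (cbox a b \<times> {0..h}) \<subseteq> box (- c) c"
    using bounded_subset_box_symmetric by metis
  then have c: "x + \<tau> *\<^sub>R v \<in> box (- c) c" if "x \<in> box a b" "\<tau> \<in> {0..h}" for x \<tau>
    using that box_subset_cbox[of a b] by fastforce
  define K where "K = (\<integral>\<^sup>+x. ennreal \<bar>indicator (box (- c) c) x * w x\<bar> \<partial>lborel)"
  have K: "K < \<infinity>"
    using w by (simp add: K_def box_integrable_def integrable_iff_bounded)
  have bd: "(\<integral>\<^sup>+x. ennreal \<bar>indicator {0..h} \<tau> * (w x * \<theta> (x - \<tau> *\<^sub>R v))\<bar> \<partial>lborel)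
      \<le> indicator {0..h} \<tau> * K" for \<tau>
  proof (cases "\<tau> \<in> {0..h}")
    case True
    have "\<bar>w x * \<theta> (x - \<tau> *\<^sub>R v)\<bar> \<le> \<bar>indicator (box (- c) c) x * w x\<bar>" for x
    proof (cases "x - \<tau> *\<^sub>R v \<in> box a b")
      case t: True
      then have "x \<in> box (- c) c" using c[OF t True] by simp
      with \<theta>[of "x - \<tau> *\<^sub>R v"] t show ?thesis
        by (simp add: abs_mult mult_left_le)
    next
      case False
      then show ?thesis using \<theta>[of "x - \<tau> *\<^sub>R v"] by simp
    qed
    then show ?thesis using True
      unfolding K_def by (simp add: nn_integral_mono ennreal_leI)
  qed simp
  have fin: "(\<integral>\<^sup>+\<tau>. indicator {0..h} \<tau> * K \<partial>(lborel::real measure)) < \<infinity>"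
    using K by (simp add: nn_integral_multc ennreal_mult_less_top emeasure_lborel_Icc_eq)
  show "integrable (lborel \<Otimes>\<^sub>M lborel) (\<lambda>(\<tau>::real, x). indicator {0..h} \<tau> * (w x * \<theta> (x - \<tau> *\<^sub>R v)))"
  proof (rule integrableI_bounded)
    show "(\<integral>\<^sup>+z. ennreal (norm (case z of (\<tau>::real, x) \<Rightarrow> indicator {0..h} \<tau> * (w x * \<theta> (x - \<tau> *\<^sub>R v))))
        \<partial>(lborel \<Otimes>\<^sub>M lborel)) < \<infinity>"
      by (subst lborel.nn_integral_fst[symmetric])
         (use le_less_trans[OF nn_integral_mono[OF bd] fin] in simp_all)
  qed measurable
  have bd': "(\<integral>\<^sup>+x. ennreal \<bar>indicator {0..h} \<tau> * (w (x + \<tau> *\<^sub>R v) * \<theta> x)\<bar> \<partial>lborel)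
      \<le> indicator {0..h} \<tau> * K" for \<tau>
    using bd[of \<tau>]
    by (subst (asm) nn_integral_lborel_shift[where c="\<tau> *\<^sub>R v", symmetric]) auto
  show "integrable (lborel \<Otimes>\<^sub>M lborel) (\<lambda>(\<tau>::real, x). indicator {0..h} \<tau> * (w (x + \<tau> *\<^sub>R v) * \<theta> x))"
  proof (rule integrableI_bounded)
    show "(\<integral>\<^sup>+z. ennreal (norm (case z of (\<tau>::real, x) \<Rightarrow> indicator {0..h} \<tau> * (w (x + \<tau> *\<^sub>R v) * \<theta> x)))
        \<partial>(lborel \<Otimes>\<^sub>M lborel)) < \<infinity>"
      by (subst lborel.nn_integral_fst[symmetric])
         (use le_less_trans[OF nn_integral_mono[OF bd'] fin] in simp_all)
  qed measurable
qed

text \<open>Both sides are tested against a bump \<open>\<eta>\<close>. Fubini and translation move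
  the line integral of the gradient onto \<open>\<eta>\<close>, giving the integral of the gradient
  component against \<open>\<psi>\<close>, up to the sign \<open>\<sigma>\<close>; the weak gradient
  identity replaces it by the integral of \<open>u\<close> against the derivative of
  \<open>\<psi>\<close>, a difference of translates of \<open>\<eta>\<close>; translating back
  yields the difference of translates of \<open>u\<close>.\<close>

lemma weak_gradient_difference:
  fixes u :: "real^'n::finite \<Rightarrow> real" and i :: 'n
  assumes ug: "borel_weak_gradient u g" and "0 \<le> h" and \<sigma>: "\<sigma> = 1 \<or> \<sigma> = -1"
  defines "v \<equiv> \<sigma> *\<^sub>R axis i 1"
  shows "AE x in lborel. u (x + h *\<^sub>R v) - u x =
    (\<integral>\<tau>. indicator {0..h} \<tau> * (\<sigma> * g (x + \<tau> *\<^sub>R v) $ i) \<partial>lborel)"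
proof -
  have u: "box_integrable u" and g: "box_integrable (\<lambda>x. g x $ i)"
    using ug by (auto simp: borel_weak_gradient_def)
  define w where "w x = \<sigma> * g x $ i" for x
  have w: "box_integrable w"
    using g unfolding w_def box_integrable_def mult.left_commute[of _ \<sigma>] by (simp add: borel_measurable_times)
  have [measurable]: "u \<in> borel_measurable borel" "w \<in> borel_measurable borel"
    using u w by (auto dest: box_integrable_measurable)
  define I where "I x = (\<integral>\<tau>. indicator {0..h} \<tau> * w (x + \<tau> *\<^sub>R v) \<partial>lborel)" for x
  have I_mult: "(\<integral>\<tau>. indicator {0..h} \<tau> * (w (x + \<tau> *\<^sub>R v) * \<theta> x) \<partial>lborel) = \<theta> x * I x"
    for \<theta> :: "real^'n \<Rightarrow> real" and x
    unfolding I_def mult.assoc[symmetric] by (simp add: mult.commute[of "\<theta> x"])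
  have I_int: "box_integrable I"
    unfolding box_integrable_def
  proof (intro conjI allI)
    show "I \<in> borel_measurable borel" unfolding I_def[abs_def] by measurable
    fix a b
    show "integrable lborel (\<lambda>x. indicator (box a b) x * I x)"
      using lborel_pair.integrable_snd[OF shift_mult_integrable(2)[OF w, of "indicator (box a b)" a b h v]]
      by (simp add: I_mult)
  qed
  have "AE x in lborel. (u (x + h *\<^sub>R v) - u x) - I x = 0"
  proof (rule AE_zero_if_bump_integrals_zero)
    note ints = box_integrable_shift[OF u, of "h *\<^sub>R v"] u I_int
    show "box_integrable (\<lambda>x. (u (x + h *\<^sub>R v) - u x) - I x)"
      by (intro box_integrable_diff ints)
    fix k and a b :: "real^'n"
    define \<eta> where "\<eta> = box_bump k a b"
    have [measurable]: "\<eta> \<in> borel_measurable borel" by (simp add: \<eta>_def)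
    define \<psi> where "\<psi> x = (\<integral>\<tau>. indicator {0..h} \<tau> * \<eta> (x - \<tau> *\<^sub>R v) \<partial>lborel)" for x
    let ?\<beta> = "\<lambda>j. bump k (a $ j) (b $ j)"
    obtain F where F: "smooth F"
      "\<And>s. (F has_real_derivative \<sigma> * (?\<beta> i s - ?\<beta> i (s - h * \<sigma>))) (at s)"
      "\<And>s. s \<notin> {a $ i - h..b $ i + h} \<Longrightarrow> F s = 0"
      "\<And>s. (\<integral>\<tau>. indicator {0..h} \<tau> * ?\<beta> i (s - \<tau> * \<sigma>) \<partial>lborel) = F s"
    proof (rule line_average[of "?\<beta> i" "a $ i" "b $ i" h \<sigma>])
      show "?\<beta> i s = 0" if "s \<notin> {a $ i..b $ i}" for s
        using that by (intro bump_outside) auto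
    qed (use smooth_bump \<open>0 \<le> h\<close> \<sigma> in auto)
    let ?f = "?\<beta>(i := F)"
    \<comment> \<open>Since \<open>v\<close> is parallel to axis \<open>i\<close>, only one factor
      depends on \<open>\<tau>\<close>. Hence \<open>\<psi>\<close> remains a coordinate product,
      with \<open>F\<close> in place of that factor.\<close>
    have \<eta>_split: "\<eta> (x - \<tau> *\<^sub>R v) = ?\<beta> i (x $ i - \<tau> * \<sigma>) * (\<Prod>j\<in>UNIV - {i}. ?\<beta> j (x $ j))"
      for x \<tau>
      unfolding \<eta>_def box_bump_def v_def
      by (subst prod.remove[of UNIV i]) (auto simp: axis_def intro!: prod.cong)
    have \<psi>_eq: "\<psi> = (\<lambda>x. \<Prod>j\<in>UNIV. ?f j (x $ j))"
    proof
      fix x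
      have "\<psi> x = F (x $ i) * (\<Prod>j\<in>UNIV - {i}. ?\<beta> j (x $ j))"
        unfolding \<psi>_def \<eta>_split mult.assoc[symmetric] by (simp add: F(4))
      also have "\<dots> = (\<Prod>j\<in>UNIV. ?f j (x $ j))"
        by (subst prod.remove[of UNIV i]) (auto intro!: prod.cong)
      finally show "\<psi> x = (\<Prod>j\<in>UNIV. ?f j (x $ j))" .
    qed
    have smooth_f: "smooth (?f j)" for j using F(1) smooth_bump by simp
    have "test_function \<psi>"
      unfolding \<psi>_eq
    proof (rule test_function_prod_coords[OF smooth_f])
      show "?f j s = 0" if "s \<notin> {a $ j - h..b $ j + h}" for j s
        using that F(3) bump_outside[of s "a $ j" "b $ j" k] \<open>0 \<le> h\<close> by auto
    qed
    have "partial_derivative i \<psi> =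
        (\<lambda>x. \<Prod>j\<in>UNIV. (?f(i := \<lambda>s. \<sigma> * (?\<beta> i s - ?\<beta> i (s - h * \<sigma>)))) j (x $ j))"
      unfolding \<psi>_eq by (rule partial_derivative_prod_coords[OF smooth_f]) (simp add: F(2))
    also have "\<dots> = (\<lambda>x. \<sigma> * (\<eta> (x - 0 *\<^sub>R v) - \<eta> (x - h *\<^sub>R v)))"
      unfolding \<eta>_split
      by (rule ext, subst prod.remove[of UNIV i]) (auto simp: algebra_simps intro!: prod.cong)
    finally have \<psi>': "partial_derivative i \<psi> = (\<lambda>x. \<sigma> * (\<eta> x - \<eta> (x - h *\<^sub>R v)))" by simp
    have \<sigma>\<sigma>: "\<sigma> * (\<sigma> * r) = r" for r using \<sigma> by auto
    have \<eta>_le: "\<bar>\<eta> x\<bar> \<le> indicator (box a b) x" for x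
      unfolding \<eta>_def by (rule box_bump_le)
    note int1 = shift_mult_integrable(1)[OF w \<open>\<eta> \<in> borel_measurable borel\<close> \<eta>_le, of h v]
    note int2 = shift_mult_integrable(2)[OF w \<open>\<eta> \<in> borel_measurable borel\<close> \<eta>_le, of h v]
    have "(\<integral>x. \<eta> x * I x \<partial>lborel) =
        (\<integral>x. \<integral>\<tau>. indicator {0..h} \<tau> * (w (x + \<tau> *\<^sub>R v) * \<eta> x) \<partial>lborel \<partial>lborel)"
      by (simp add: I_mult)
    also have "\<dots> = (\<integral>\<tau>. \<integral>x. indicator {0..h} \<tau> * (w (x + \<tau> *\<^sub>R v) * \<eta> x) \<partial>lborel \<partial>lborel)"
      by (rule lborel_pair.Fubini_integral[OF int2])
    also have "\<dots> = (\<integral>\<tau>. \<integral>x. indicator {0..h} \<tau> * (w x * \<eta> (x - \<tau> *\<^sub>R v)) \<partial>lborel \<partial>lborel)"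
    proof (rule Bochner_Integration.integral_cong[OF refl])
      fix \<tau> :: real
      show "(\<integral>x. indicator {0..h} \<tau> * (w (x + \<tau> *\<^sub>R v) * \<eta> x) \<partial>lborel) =
        (\<integral>x. indicator {0..h} \<tau> * (w x * \<eta> (x - \<tau> *\<^sub>R v)) \<partial>lborel)"
        by (subst (2) integral_lborel_shift[where c="\<tau> *\<^sub>R v", symmetric]) auto
    qed
    also have "\<dots> = (\<integral>x. \<integral>\<tau>. indicator {0..h} \<tau> * (w x * \<eta> (x - \<tau> *\<^sub>R v)) \<partial>lborel \<partial>lborel)"
      by (rule lborel_pair.Fubini_integral[OF int1, symmetric])
    also have "\<dots> = (\<integral>x. \<sigma> * (g x $ i * \<psi> x) \<partial>lborel)"
      by (simp add: \<psi>_def w_def mult_ac flip: integral_mult_right_zero integral_mult_left_zero)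
    also have "\<dots> = \<sigma> * (- (\<integral>x. u x * partial_derivative i \<psi> x \<partial>lborel))"
      using ug \<open>test_function \<psi>\<close> by (simp add: borel_weak_gradient_def)
    also have "(\<integral>x. u x * partial_derivative i \<psi> x \<partial>lborel) =
        (\<integral>x. \<sigma> * (\<eta> x * u x - \<eta> (x - h *\<^sub>R v) * u x) \<partial>lborel)"
      by (intro Bochner_Integration.integral_cong) (auto simp: \<psi>' algebra_simps)
    also have "\<dots> = \<sigma> * ((\<integral>x. \<eta> x * u x \<partial>lborel) - (\<integral>x. \<eta> (x - h *\<^sub>R v) * u x \<partial>lborel))"
    proof -
      have 1: "integrable lborel (\<lambda>x. \<eta> x * u x)"
        unfolding \<eta>_def by (rule box_bump_mult_integrable[OF u])
      have "integrable lborel (\<lambda>x. \<eta> x * u (x + h *\<^sub>R v))"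
        unfolding \<eta>_def by (rule box_bump_mult_integrable[OF ints(1)])
      from integrable_lborel_shift[OF this, of "- (h *\<^sub>R v)"]
      have 2: "integrable lborel (\<lambda>x. \<eta> (x - h *\<^sub>R v) * u x)" by simp
      from 1 2 show ?thesis by simp
    qed
    also have "(\<integral>x. \<eta> (x - h *\<^sub>R v) * u x \<partial>lborel) = (\<integral>x. \<eta> x * u (x + h *\<^sub>R v) \<partial>lborel)"
      by (subst integral_lborel_shift[where c="h *\<^sub>R v", symmetric]) auto
    finally have main: "(\<integral>x. \<eta> x * I x \<partial>lborel) =
        (\<integral>x. \<eta> x * u (x + h *\<^sub>R v) \<partial>lborel) - (\<integral>x. \<eta> x * u x \<partial>lborel)"
      by (simp add: \<sigma>\<sigma>)
    show "(\<integral>x. box_bump k a b x * ((u (x + h *\<^sub>R v) - u x) - I x) \<partial>lborel) = 0"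
      using main box_bump_mult_integrable[OF ints(1), of k a b]
        box_bump_mult_integrable[OF ints(2), of k a b] box_bump_mult_integrable[OF ints(3), of k a b]
      by (simp add: \<eta>_def right_diff_distrib)
  qed
  then show ?thesis
    unfolding I_def w_def by eventually_elim simp
qed

section \<open>Behaviour on lines\<close>

text \<open>Integrating over all starting points would count every line infinitely often. With
  starting points in a ball of radius \<open>R\<close>, a point is reached only for
  \<open>\<tau>\<close> in an interval of length \<open>2 R\<close>, so Fubini gives a finite total;
  countably many radii then cover the space.\<close>

lemma AE_line_nn_integral_finite:
  fixes f :: "'a::euclidean_space \<Rightarrow> ennreal" and v :: 'a
  assumes [measurable]: "f \<in> borel_measurable borel" and f: "(\<integral>\<^sup>+x. f x \<partial>lborel) < \<infinity>"
    and v: "norm v = 1"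
  shows "AE x in lborel. (\<integral>\<^sup>+\<tau>. f (x + \<tau> *\<^sub>R v) \<partial>lborel) < \<infinity>"
proof -
  have [measurable]: "(\<lambda>(x, \<tau>). f (x + \<tau> *\<^sub>R v)) \<in> borel_measurable (lborel \<Otimes>\<^sub>M lborel)"
    "(\<lambda>(x, \<tau>). f (x + \<tau> *\<^sub>R v)) \<in> borel_measurable (borel \<Otimes>\<^sub>M borel)"
    by measurable
  have "AE x in lborel. indicator {..R} (norm x) * (\<integral>\<^sup>+\<tau>. f (x + \<tau> *\<^sub>R v) \<partial>lborel) \<noteq> \<infinity>" for R :: real
  proof (rule nn_integral_noteq_infinite)
    have "(\<integral>\<^sup>+x. indicator {..R} (norm x) * (\<integral>\<^sup>+\<tau>. f (x + \<tau> *\<^sub>R v) \<partial>lborel) \<partial>lborel)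
      = (\<integral>\<^sup>+x. (\<integral>\<^sup>+\<tau>. indicator {..R} (norm x) * f (x + \<tau> *\<^sub>R v) \<partial>lborel) \<partial>lborel)"
      by (simp add: nn_integral_cmult)
    also have "\<dots> = (\<integral>\<^sup>+\<tau>. (\<integral>\<^sup>+x. indicator {..R} (norm x) * f (x + \<tau> *\<^sub>R v) \<partial>lborel) \<partial>lborel)"
      by (rule lborel_pair.Fubini'[symmetric]) measurable
    also have "\<dots> = (\<integral>\<^sup>+\<tau>. (\<integral>\<^sup>+x. indicator {..R} (norm (x - \<tau> *\<^sub>R v)) * f x \<partial>lborel) \<partial>lborel)"
    proof (rule nn_integral_cong)
      fix \<tau> :: real
      show "(\<integral>\<^sup>+x. indicator {..R} (norm x) * f (x + \<tau> *\<^sub>R v) \<partial>lborel) =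
        (\<integral>\<^sup>+x. indicator {..R} (norm (x - \<tau> *\<^sub>R v)) * f x \<partial>lborel)"
        by (subst (2) nn_integral_lborel_shift[where c="\<tau> *\<^sub>R v", symmetric]) auto
    qed
    also have "\<dots> = (\<integral>\<^sup>+x. (\<integral>\<^sup>+\<tau>. indicator {..R} (norm (x - \<tau> *\<^sub>R v)) * f x \<partial>lborel) \<partial>lborel)"
      by (rule lborel_pair.Fubini') measurable
    also have "\<dots> \<le> (\<integral>\<^sup>+x. ennreal (2 * \<bar>R\<bar>) * f x \<partial>lborel)"
    proof (rule nn_integral_mono)
      fix x :: 'a
      have "(\<integral>\<^sup>+\<tau>. indicator {..R} (norm (x - \<tau> *\<^sub>R v)) * f x \<partial>lborel)
          \<le> (\<integral>\<^sup>+\<tau>. indicator {x \<bullet> v - \<bar>R\<bar>..x \<bullet> v + \<bar>R\<bar>} \<tau> * f x \<partial>lborel)"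
      proof (rule nn_integral_mono)
        fix \<tau> :: real
        have "\<bar>x \<bullet> v - \<tau>\<bar> \<le> norm (x - \<tau> *\<^sub>R v)"
          using Cauchy_Schwarz_ineq2[of "x - \<tau> *\<^sub>R v" v] v
          by (simp add: inner_diff_left dot_square_norm)
        then show "indicator {..R} (norm (x - \<tau> *\<^sub>R v)) * f x
            \<le> indicator {x \<bullet> v - \<bar>R\<bar>..x \<bullet> v + \<bar>R\<bar>} \<tau> * f x"
          by (auto simp: indicator_def)
      qed
      also have "\<dots> = ennreal (2 * \<bar>R\<bar>) * f x"
        by (simp add: nn_integral_multc)
      finally show "(\<integral>\<^sup>+\<tau>. indicator {..R} (norm (x - \<tau> *\<^sub>R v)) * f x \<partial>lborel) \<le> ennreal (2 * \<bar>R\<bar>) * f x" .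
    qed
    also have "\<dots> < \<infinity>"
      using f by (simp add: nn_integral_cmult ennreal_mult_less_top)
    finally show "(\<integral>\<^sup>+x. indicator {..R} (norm x) * (\<integral>\<^sup>+\<tau>. f (x + \<tau> *\<^sub>R v) \<partial>lborel) \<partial>lborel) \<noteq> \<infinity>"
      by simp
  qed measurable
  then have "AE x in lborel. \<forall>n::nat. indicator {..real n} (norm x) * (\<integral>\<^sup>+\<tau>. f (x + \<tau> *\<^sub>R v) \<partial>lborel) \<noteq> \<infinity>"
    by (simp add: AE_all_countable)
  then show ?thesis
  proof eventually_elim
    case (elim x)
    obtain n where "norm x \<le> real n" using real_arch_simple by blast
    with elim[rule_format, of n] show ?case by (simp add: top.not_eq_extremum)
  qed
qed

text \<open>An intermediate value argument: \<open>a\<close> is the last time up to \<open>r\<close>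
  with \<open>|U|\<close> at least \<open>t'\<close>, and \<open>b\<close> the first time after it
  with \<open>|U|\<close> at most \<open>t + e\<close>. Between them \<open>|U|\<close> lies
  strictly inside the band, so the drop is paid for there. The slack \<open>e\<close> is needed
  because \<open>|U|\<close> may approach \<open>t\<close> without reaching it.\<close>

lemma line_drop:
  fixes U \<gamma> :: "real \<Rightarrow> real"
  assumes \<gamma>: "\<And>r. integrable lborel (\<lambda>\<tau>. indicator {0..r} \<tau> * \<gamma> \<tau>)"
    and U: "\<And>r. 0 \<le> r \<Longrightarrow> U r = c + (\<integral>\<tau>. indicator {0..r} \<tau> * \<gamma> \<tau> \<partial>lborel)"
    and t: "t < t'" "t' \<le> \<bar>U 0\<bar>"
    and small: "\<And>e. 0 < e \<Longrightarrow> \<exists>r\<ge>0. \<bar>U r\<bar> < t + e"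
  shows "ennreal (t' - t) \<le> (\<integral>\<^sup>+\<tau>. ennreal \<bar>\<gamma> \<tau>\<bar> * indicator {\<tau>. 0 \<le> \<tau> \<and> t < \<bar>U \<tau>\<bar> \<and> \<bar>U \<tau>\<bar> < t'} \<tau> \<partial>lborel)"
    (is "_ \<le> ?X")
proof -
  have cont: "continuous_on {0..r} U" if "0 \<le> r" for r
  proof -
    have \<gamma>': "set_integrable lborel {0..r} \<gamma>" for r
      using \<gamma>[of r] by (simp add: set_integrable_def)
    have "continuous_on {0..r} (\<lambda>s. c + integral {0..s} \<gamma>)"
      by (intro continuous_on_add continuous_on_const indefinite_integral_continuous_1
          set_borel_integral_eq_integral(1) \<gamma>')
    then show ?thesis
      by (rule continuous_on_eq)
         (use U set_borel_integral_eq_integral(2)[OF \<gamma>'] in \<open>auto simp: set_lebesgue_integral_def\<close>)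
  qed
  have step: "ennreal (t' - t - e) \<le> ?X" if e: "0 < e" "e < t' - t" for e
  proof -
    obtain r where r: "0 \<le> r" "\<bar>U r\<bar> < t + e" using small e by blast
    have absU: "continuous_on {0..r} (\<lambda>s. \<bar>U s\<bar>)"
      using cont[OF r(1)] by (rule continuous_on_rabs)
    define A where "A = {s \<in> {0..r}. t' \<le> \<bar>U s\<bar>}"
    have "A = {0..r} \<inter> (\<lambda>s. \<bar>U s\<bar>) -` {t'..}" by (auto simp: A_def)
    then have "closed A"
      using continuous_closed_preimage[OF absU closed_real_atLeastAtMost closed_atLeast] by simp
    then have "compact A"
      unfolding compact_eq_bounded_closed
      by (intro conjI bounded_subset[OF bounded_closed_interval[of 0 r]]) (auto simp: A_def)
    moreover have "0 \<in> A" using t r by (simp add: A_def)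
    ultimately obtain a where a: "a \<in> A" "\<And>s. s \<in> A \<Longrightarrow> s \<le> a"
      using compact_attains_sup[of A] by auto
    define B where "B = {s \<in> {a..r}. \<bar>U s\<bar> \<le> t + e}"
    have "B = {a..r} \<inter> (\<lambda>s. \<bar>U s\<bar>) -` {..t + e}" by (auto simp: B_def)
    moreover have "continuous_on {a..r} (\<lambda>s. \<bar>U s\<bar>)"
      using a(1) by (intro continuous_on_subset[OF absU]) (auto simp: A_def)
    ultimately have "closed B"
      using continuous_closed_preimage[OF _ closed_real_atLeastAtMost closed_atMost] by metis
    then have "compact B"
      unfolding compact_eq_bounded_closed
      by (intro conjI bounded_subset[OF bounded_closed_interval[of a r]]) (auto simp: B_def)

    moreover have "r \<in> B" using r a by (auto simp: B_def A_def)
    ultimately obtain b where b: "b \<in> B" "\<And>s. s \<in> B \<Longrightarrow> b \<le> s"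
      using compact_attains_inf[of B] by auto
    have ab: "0 \<le> a" "a \<le> b" "b \<le> r" and Ua: "t' \<le> \<bar>U a\<bar>" and Ub: "\<bar>U b\<bar> \<le> t + e"
      using a(1) b(1) by (auto simp: A_def B_def)
    have mid: "t < \<bar>U s\<bar> \<and> \<bar>U s\<bar> < t'" if "a < s" "s < b" for s
    proof -
      have "s \<notin> A" using a(2)[of s] that by auto
      moreover have "s \<notin> B" using b(2)[of s] that by auto
      ultimately show ?thesis using that ab e by (auto simp: A_def B_def)
    qed
    have int: "integrable lborel (\<lambda>\<tau>. indicator {a<..b} \<tau> * \<gamma> \<tau>)"
      by (rule Bochner_Integration.integrable_cong[THEN iffD1, OF refl _
            Bochner_Integration.integrable_diff[OF \<gamma>[of b] \<gamma>[of a]]])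
         (use ab in \<open>auto simp: indicator_def\<close>)
    have diff: "U b - U a = (\<integral>\<tau>. indicator {a<..b} \<tau> * \<gamma> \<tau> \<partial>lborel)"
    proof -
      have "U b - U a = (\<integral>\<tau>. indicator {0..b} \<tau> * \<gamma> \<tau> - indicator {0..a} \<tau> * \<gamma> \<tau> \<partial>lborel)"
        using U[of a] U[of b] ab by (simp add: Bochner_Integration.integral_diff[OF \<gamma> \<gamma>])
      also have "\<dots> = (\<integral>\<tau>. indicator {a<..b} \<tau> * \<gamma> \<tau> \<partial>lborel)"
        using ab by (intro Bochner_Integration.integral_cong) (auto simp: indicator_def)
      finally show ?thesis .
    qed
    have "ennreal (t' - t - e) \<le> ennreal \<bar>U b - U a\<bar>"
      using Ua Ub by (intro ennreal_leI) linarith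
    also have "\<dots> \<le> (\<integral>\<^sup>+\<tau>. ennreal (norm (indicator {a<..b} \<tau> * \<gamma> \<tau>)) \<partial>lborel)"
      unfolding diff real_norm_def[symmetric] by (rule integral_norm_bound_ennreal[OF int])
    also have "\<dots> \<le> ?X"
    proof (rule nn_integral_mono_AE)
      \<comment> \<open>The half-open interval contains \<open>b\<close>, which \<open>mid\<close>
        does not cover; a single point is null.\<close>
      have "AE \<tau> in lborel. \<tau> \<noteq> b" by (rule AE_lborel_singleton)
      then show "AE \<tau> in lborel. ennreal (norm (indicator {a<..b} \<tau> * \<gamma> \<tau>)) \<le>
         ennreal \<bar>\<gamma> \<tau>\<bar> * indicator {\<tau>. 0 \<le> \<tau> \<and> t < \<bar>U \<tau>\<bar> \<and> \<bar>U \<tau>\<bar> < t'} \<tau>"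
        by eventually_elim (use mid ab in \<open>auto simp: indicator_def\<close>)
    qed
    finally show ?thesis .
  qed
  show ?thesis
  proof (cases "?X = \<infinity>")
    case False
    then obtain X where X: "?X = ennreal X" "0 \<le> X" by (cases ?X) auto
    have "t' - t \<le> X + e" if "0 < e" for e
    proof (cases "e < t' - t")
      case True
      with step[OF that True] X show ?thesis by (simp add: ennreal_le_iff)
    qed (use X in linarith)
    then have "t' - t \<le> X" by (rule field_le_epsilon)
    with X show ?thesis by (simp add: ennreal_leI)
  qed simp
qed


text \<open>In \<open>weak_gradient_difference\<close> the null set depends on \<open>h\<close>.
  Fubini exchanges the quantifiers, so a single starting point serves almost every
  \<open>h\<close>.\<close>

lemma AE_weak_gradient_difference:
  fixes u :: "real^'n::finite \<Rightarrow> real" and i :: 'n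
  assumes ug: "borel_weak_gradient u g" and \<sigma>: "\<sigma> = 1 \<or> \<sigma> = -1"
  defines "v \<equiv> \<sigma> *\<^sub>R axis i 1"
  shows "AE x in lborel. AE h in lborel. 0 \<le> h \<longrightarrow> u (x + h *\<^sub>R v) - u x =
    (\<integral>\<tau>. indicator {0..h} \<tau> * (\<sigma> * g (x + \<tau> *\<^sub>R v) $ i) \<partial>lborel)"
proof -
  have [measurable]: "u \<in> borel_measurable borel" "(\<lambda>x. g x $ i) \<in> borel_measurable borel"
    using ug by (auto simp: borel_weak_gradient_def dest: box_integrable_measurable)
  define w where "w x = g x $ i" for x
  have [measurable]: "w \<in> borel_measurable borel" unfolding w_def[abs_def] by measurable
  let ?P = "\<lambda>x h. 0 \<le> h \<longrightarrow> u (x + h *\<^sub>R v) - u x =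
    (\<integral>\<tau>. indicator {0..h} \<tau> * (\<sigma> * w (x + \<tau> *\<^sub>R v)) \<partial>lborel)"
  have "(AE x in lborel. AE h in lborel. ?P x h) \<longleftrightarrow> (AE h in lborel. AE x in lborel. ?P x h)"
  proof (rule lborel_pair.AE_commute)
    have *: "indicator {0..h} \<tau> = (if 0 \<le> \<tau> \<and> \<tau> \<le> h then 1 else 0::real)" for h \<tau> :: real
      by (simp add: indicator_def)
    show "{z \<in> space (lborel \<Otimes>\<^sub>M lborel). ?P (fst z) (snd z)} \<in> sets (lborel \<Otimes>\<^sub>M lborel)"
      unfolding * by measurable
  qed
  moreover have "AE x in lborel. ?P x h" for h
    using weak_gradient_difference[OF ug _ \<sigma>, of h i]
    by (cases "0 \<le> h") (auto simp: w_def v_def)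
  ultimately show ?thesis by (simp add: w_def)
qed

text \<open>The levels \<open>t\<close> and \<open>t'\<close> are quantified inside the
  almost-everywhere statement because the Poincare inequality uses \<open>t' = |u x|\<close>, which
  varies with the point.\<close>

lemma AE_line_drop:
  fixes u :: "real^'n::finite \<Rightarrow> real" and i :: 'n
  assumes ug: "borel_weak_gradient u g" and \<sigma>: "\<sigma> = 1 \<or> \<sigma> = -1"
    and [measurable]: "g \<in> borel_measurable borel"
    and u2: "(\<integral>\<^sup>+x. ennreal ((u x)\<^sup>2) \<partial>lborel) < \<infinity>"
    and g2: "(\<integral>\<^sup>+x. ennreal ((norm (g x))\<^sup>2) \<partial>lborel) < \<infinity>"
  defines "v \<equiv> \<sigma> *\<^sub>R axis i 1"
  shows "AE x in lborel. \<forall>t t'. 0 \<le> t \<longrightarrow> t < t' \<longrightarrow> t' \<le> \<bar>u x\<bar> \<longrightarrow>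
    ennreal (t' - t) \<le> (\<integral>\<^sup>+\<tau>. ennreal (norm (g (x + \<tau> *\<^sub>R v))) *
        indicator {x. t < \<bar>u x\<bar> \<and> \<bar>u x\<bar> < t'} (x + \<tau> *\<^sub>R v) * indicator {0..} \<tau> \<partial>lborel)"
proof -
  have [measurable]: "u \<in> borel_measurable borel" "(\<lambda>x. g x $ i) \<in> borel_measurable borel"
    using ug by (auto simp: borel_weak_gradient_def dest: box_integrable_measurable)
  have nv: "norm v = 1" using \<sigma> by (auto simp: v_def)
  have lu: "AE x in lborel. (\<integral>\<^sup>+\<tau>. ennreal ((u (x + \<tau> *\<^sub>R v))\<^sup>2) \<partial>lborel) < \<infinity>"
    using AE_line_nn_integral_finite[OF _ u2 nv] by simp
  have lg: "AE x in lborel. (\<integral>\<^sup>+\<tau>. ennreal ((norm (g (x + \<tau> *\<^sub>R v)))\<^sup>2) \<partial>lborel) < \<infinity>"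
    using AE_line_nn_integral_finite[OF _ g2 nv] by simp
  from AE_weak_gradient_difference[OF ug \<sigma>, of i] lu lg show ?thesis
    unfolding v_def[symmetric]
  proof eventually_elim
    case (elim x)
    define \<gamma> where "\<gamma> \<tau> = \<sigma> * g (x + \<tau> *\<^sub>R v) $ i" for \<tau>
    \<comment> \<open>Anchoring \<open>U\<close> at \<open>u x\<close> makes
      \<open>U 0 = u x\<close> exact at the starting point; elsewhere on the half line
      \<open>U\<close> agrees with \<open>u\<close> only almost everywhere.\<close>
    define U where "U r = u x + (\<integral>\<tau>. indicator {0..r} \<tau> * \<gamma> \<tau> \<partial>lborel)" for r
    have [measurable]: "\<gamma> \<in> borel_measurable borel" unfolding \<gamma>_def by measurable
    have \<gamma>_le: "\<bar>\<gamma> \<tau>\<bar> \<le> norm (g (x + \<tau> *\<^sub>R v))" for \<tau>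
      using component_le_norm_cart[of "g (x + \<tau> *\<^sub>R v)" i] \<sigma> by (auto simp: \<gamma>_def)
    have \<gamma>_int: "integrable lborel (\<lambda>\<tau>. indicator {0..r} \<tau> * \<gamma> \<tau>)" for r
    proof (rule integrableI_bounded)
      have "(\<integral>\<^sup>+\<tau>. ennreal (norm (indicator {0..r} \<tau> * \<gamma> \<tau>)) \<partial>lborel) \<le>
        (\<integral>\<^sup>+\<tau>. indicator {0..r} \<tau> + ennreal ((norm (g (x + \<tau> *\<^sub>R v)))\<^sup>2) \<partial>lborel)"
      proof (rule nn_integral_mono)
        fix \<tau>
        let ?n = "norm (g (x + \<tau> *\<^sub>R v))"
        \<comment> \<open>On a bounded interval this makes the square-integrable gradient
          integrable.\<close>
        have "?n \<le> 1 + ?n\<^sup>2"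
        proof -
          have "0 \<le> (?n - 1)\<^sup>2" by simp
          then have "2 * ?n \<le> ?n\<^sup>2 + 1" by (simp add: power2_diff)
          then show ?thesis using norm_ge_zero[of "g (x + \<tau> *\<^sub>R v)"] by linarith
        qed
        then have "\<bar>\<gamma> \<tau>\<bar> \<le> 1 + ?n\<^sup>2" using \<gamma>_le[of \<tau>] by linarith
        then show "ennreal (norm (indicator {0..r} \<tau> * \<gamma> \<tau>)) \<le> indicator {0..r} \<tau> + ennreal (?n\<^sup>2)"
          by (auto simp: indicator_def ennreal_plus[symmetric] ennreal_1[symmetric]
              simp del: ennreal_plus ennreal_1 intro!: ennreal_leI)
      qed
      also have "\<dots> < \<infinity>"
        using elim(3) by (simp add: nn_integral_add emeasure_lborel_Icc_eq)
      finally show "(\<integral>\<^sup>+\<tau>. ennreal (norm (indicator {0..r} \<tau> * \<gamma> \<tau>)) \<partial>lborel) < \<infinity>" .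
    qed measurable
    have U_eq: "AE \<tau> in lborel. 0 \<le> \<tau> \<longrightarrow> u (x + \<tau> *\<^sub>R v) = U \<tau>"
      using elim(1) by eventually_elim (auto simp: U_def \<gamma>_def)
    have "U 0 = u x"
    proof -
      have "(\<integral>\<tau>. indicator {0..0} \<tau> * \<gamma> \<tau> \<partial>lborel) = (\<integral>\<tau>. 0 \<partial>(lborel :: real measure))"
      proof (rule integral_cong_AE)
        show "AE \<tau> in lborel. indicator {0..0} \<tau> * \<gamma> \<tau> = 0"
          using AE_lborel_singleton[of "0::real"] by eventually_elim simp
      qed measurable
      then show ?thesis by (simp add: U_def)
    qed
    \<comment> \<open>If \<open>|U|\<close> stayed above \<open>e\<close>, the integral of
      \<open>u^2\<close> over the half line, which has infinite length, would be infinite.\<close>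
    have small: "\<exists>r\<ge>0. \<bar>U r\<bar> < t + e" if "0 \<le> t" "0 < e" for t e
    proof (rule ccontr)
      assume "\<not> (\<exists>r\<ge>0. \<bar>U r\<bar> < t + e)"
      then have big: "e \<le> \<bar>U r\<bar>" if "0 \<le> r" for r using that \<open>0 \<le> t\<close> by (smt (verit))
      have "(\<integral>\<^sup>+\<tau>. ennreal (e\<^sup>2) * indicator {0::real..} \<tau> \<partial>lborel) \<le> (\<integral>\<^sup>+\<tau>. ennreal ((u (x + \<tau> *\<^sub>R v))\<^sup>2) \<partial>lborel)"
      proof (rule nn_integral_mono_AE)
        show "AE \<tau> in lborel. ennreal (e\<^sup>2) * indicator {0..} \<tau> \<le> ennreal ((u (x + \<tau> *\<^sub>R v))\<^sup>2)"
          using U_eq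
        proof eventually_elim
          case (elim \<tau>)
          then show ?case using big[of \<tau>] \<open>0 < e\<close>
            by (cases "0 \<le> \<tau>") (auto intro!: ennreal_leI simp: abs_le_square_iff[symmetric])
        qed
      qed
      moreover have "emeasure lborel {0::real..} = \<infinity>"
      proof (rule ccontr)
        assume "emeasure lborel {0::real..} \<noteq> \<infinity>"
        then obtain c where c: "emeasure lborel {0::real..} = ennreal c" "0 \<le> c"
          by (cases "emeasure lborel {0::real..}") auto
        have "emeasure lborel {0..c + 1} \<le> emeasure lborel {0::real..}"
          by (rule emeasure_mono) auto
        then show False using c by (simp add: ennreal_le_iff)
      qed
      ultimately have "(\<integral>\<^sup>+\<tau>. ennreal ((u (x + \<tau> *\<^sub>R v))\<^sup>2) \<partial>lborel) = \<infinity>"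
        using \<open>0 < e\<close> by (simp add: nn_integral_cmult_indicator ennreal_mult_top top_unique)
      with elim(2) show False by simp
    qed
    show ?case
    proof (intro allI impI)
      fix t t' assume t: "0 \<le> t" "t < t'" "t' \<le> \<bar>u x\<bar>"
      have "ennreal (t' - t) \<le> (\<integral>\<^sup>+\<tau>. ennreal \<bar>\<gamma> \<tau>\<bar> * indicator {\<tau>. 0 \<le> \<tau> \<and> t < \<bar>U \<tau>\<bar> \<and> \<bar>U \<tau>\<bar> < t'} \<tau> \<partial>lborel)"
        by (rule line_drop[OF \<gamma>_int]) (use t \<open>U 0 = u x\<close> small in \<open>auto simp: U_def\<close>)
      also have "\<dots> \<le> (\<integral>\<^sup>+\<tau>. ennreal (norm (g (x + \<tau> *\<^sub>R v))) *
          indicator {x. t < \<bar>u x\<bar> \<and> \<bar>u x\<bar> < t'} (x + \<tau> *\<^sub>R v) * indicator {0..} \<tau> \<partial>lborel)"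
      proof (rule nn_integral_mono_AE)
        show "AE \<tau> in lborel. ennreal \<bar>\<gamma> \<tau>\<bar> * indicator {\<tau>. 0 \<le> \<tau> \<and> t < \<bar>U \<tau>\<bar> \<and> \<bar>U \<tau>\<bar> < t'} \<tau> \<le>
          ennreal (norm (g (x + \<tau> *\<^sub>R v))) *
          indicator {x. t < \<bar>u x\<bar> \<and> \<bar>u x\<bar> < t'} (x + \<tau> *\<^sub>R v) * indicator {0..} \<tau>"
          using U_eq by eventually_elim (auto simp: indicator_def intro!: ennreal_leI \<gamma>_le)
      qed
      finally show "ennreal (t' - t) \<le> (\<integral>\<^sup>+\<tau>. ennreal (norm (g (x + \<tau> *\<^sub>R v))) *
          indicator {x. t < \<bar>u x\<bar> \<and> \<bar>u x\<bar> < t'} (x + \<tau> *\<^sub>R v) * indicator {0..} \<tau> \<partial>lborel)" .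
    qed
  qed
qed

section \<open>Loomis-Whitney inequality\<close>

lemma ennreal_power_le_imp_le:
  fixes x y :: ennreal
  assumes "x ^ n \<le> y ^ n" "0 < n"
  shows "x \<le> y"
proof (cases x; cases y)
  fix r s assume "0 \<le> r" "0 \<le> s" "x = ennreal r" "y = ennreal s"
  with assms show ?thesis
    by (auto simp: ennreal_power intro!: ennreal_leI dest: power_le_imp_le_base[of r "n - 1" s, simplified])
next
  fix s assume "0 \<le> s" "x = top" "y = ennreal s"
  with assms show ?thesis by (auto simp: ennreal_power top_power_ennreal top_unique)
qed (use assms in auto)

text \<open>The induction slices along a coordinate \<open>i\<close>. If \<open>A s\<close> and \<open>\<Lambda> s\<close> are the integrals of \<open>a\<close> and \<open>f\<close> over
  the slice and \<open>L\<close> is the integral of \<open>f\<close>, then \<open>A s \<le> L\<close> by the hypothesis in direction \<open>i\<close>, which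
  with the induction hypothesis gives \<open>A s \<le> L powr (1/n) * \<Lambda> s\<close>. Allowing only the values 0 and
  \<open>\<ge> 1\<close> for \<open>a\<close> makes dimension 1, where the exponent is infinite, a valid base case.\<close>

lemma Loomis_Whitney_PiM:
  fixes f a :: "('i \<Rightarrow> real) \<Rightarrow> ennreal"
  assumes "finite I" "I \<noteq> {}"
    and "f \<in> borel_measurable (\<Pi>\<^sub>M i\<in>I. lborel)" "a \<in> borel_measurable (\<Pi>\<^sub>M i\<in>I. lborel)"
    and "\<And>x. a x = 0 \<or> 1 \<le> a x"
    and "\<And>x i. x \<in> space (\<Pi>\<^sub>M i\<in>I. lborel) \<Longrightarrow> i \<in> I \<Longrightarrow> a x \<le> (\<integral>\<^sup>+\<tau>. f (x(i := \<tau>)) \<partial>lborel)"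
  shows "integral\<^sup>N (\<Pi>\<^sub>M i\<in>I. lborel) a = 0 \<or>
    integral\<^sup>N (\<Pi>\<^sub>M i\<in>I. lborel) a ^ (card I - 1) \<le> integral\<^sup>N (\<Pi>\<^sub>M i\<in>I. lborel) f ^ card I"
  using assms
proof (induction I arbitrary: f a rule: finite_ne_induct)
  case (singleton i)
  interpret product_sigma_finite "\<lambda>_::'i. lborel :: real measure" ..
  let ?P = "\<Pi>\<^sub>M i\<in>{i}. lborel :: real measure" and ?u = "\<lambda>_::'i. undefined :: real"
  have L: "integral\<^sup>N ?P f = (\<integral>\<^sup>+\<tau>. f (?u(i := \<tau>)) \<partial>lborel)"
    using singleton.prems(1)
    by (subst product_nn_integral_insert) (auto simp: PiM_empty nn_integral_count_space_finite fun_upd_def)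
  have le: "a x \<le> integral\<^sup>N ?P f" if "x \<in> space ?P" for x
  proof -
    have "x(i := \<tau>) = ?u(i := \<tau>)" for \<tau>
      using that by (auto simp: space_PiM PiE_def extensional_def)
    then have "(\<integral>\<^sup>+\<tau>. f (x(i := \<tau>)) \<partial>lborel) = (\<integral>\<^sup>+\<tau>. f (?u(i := \<tau>)) \<partial>lborel)"
      by (intro nn_integral_cong arg_cong[where f=f])
    then show ?thesis
      using singleton.prems(4)[OF that insertI1] unfolding L by (elim subst)
  qed
  \<comment> \<open>In dimension 1 the second alternative reads \<open>1 \<le> integral f\<close>.
    If it fails, \<open>a\<close> is below 1 everywhere and so vanishes.\<close>
  show ?case
  proof (cases "1 \<le> integral\<^sup>N ?P f")
    case False
    have "a x = 0" if "x \<in> space ?P" for x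
      using le[OF that] singleton.prems(3)[of x] False by (auto dest: order_trans)
    then have "integral\<^sup>N ?P a = (\<integral>\<^sup>+x. 0 \<partial>?P)" by (intro nn_integral_cong)
    then show ?thesis by simp
  qed simp
next
  case (insert i I)
  interpret product_sigma_finite "\<lambda>_::'i. lborel :: real measure" ..
  let ?P = "\<Pi>\<^sub>M i\<in>I. lborel :: real measure" and ?Q = "\<Pi>\<^sub>M i\<in>insert i I. lborel :: real measure"
  define n where "n = card I"
  have n: "0 < n" using insert.hyps by (simp add: n_def card_gt_0_iff)
  note [measurable] = insert.prems(1,2)
  define A where "A s = (\<integral>\<^sup>+x. a (x(i := s)) \<partial>?P)" for s
  define \<Lambda> where "\<Lambda> s = (\<integral>\<^sup>+x. f (x(i := s)) \<partial>?P)" for s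
  define L where "L = integral\<^sup>N ?Q f"
  have upd: "(\<lambda>x. x(i := s)) \<in> measurable ?P ?Q" for s
    using measurable_compose[OF measurable_Pair2'[of s lborel ?P] measurable_add_dim, of i]
    by simp
  have L: "L = (\<integral>\<^sup>+s. \<Lambda> s \<partial>lborel)" and A: "integral\<^sup>N ?Q a = (\<integral>\<^sup>+s. A s \<partial>lborel)"
    unfolding L_def \<Lambda>_def A_def using insert.hyps insert.prems
    by (simp_all add: product_nn_integral_insert_rev)
  have [measurable]: "\<Lambda> \<in> borel_measurable borel"
  proof -
    interpret P: sigma_finite_measure ?P
      using insert.hyps by (intro sigma_finite)
    have "(\<lambda>(s, x). (x, s)) \<in> measurable (borel \<Otimes>\<^sub>M ?P) (?P \<Otimes>\<^sub>M (lborel :: real measure))"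
      by measurable
    from measurable_compose[OF measurable_compose[OF this measurable_add_dim] insert.prems(1)]
    show ?thesis
      unfolding \<Lambda>_def[abs_def] by (intro P.borel_measurable_nn_integral) (simp add: case_prod_unfold)
  qed
  have A_L: "A s \<le> L" for s
  proof -
    have "A s \<le> (\<integral>\<^sup>+x. \<integral>\<^sup>+\<tau>. f ((x(i := s))(i := \<tau>)) \<partial>lborel \<partial>?P)"
      unfolding A_def
      by (intro nn_integral_mono insert.prems(4) measurable_space[OF upd]) auto
    also have "\<dots> = L"
      unfolding L_def using insert.hyps insert.prems by (simp add: product_nn_integral_insert)
    finally show ?thesis .
  qed
  have A_\<Lambda>: "A s = 0 \<or> A s ^ (n - 1) \<le> \<Lambda> s ^ n" for s
    unfolding A_def \<Lambda>_def n_def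
  proof (rule insert.IH)
    show "(\<lambda>x. f (x(i := s))) \<in> borel_measurable ?P" "(\<lambda>x. a (x(i := s))) \<in> borel_measurable ?P"
      by (intro measurable_compose[OF upd] insert.prems)+
    show "a (x(i := s)) = 0 \<or> 1 \<le> a (x(i := s))" for x by (rule insert.prems)
    fix x j assume x: "x \<in> space ?P" and j: "j \<in> I"
    then have "j \<noteq> i" using insert.hyps by auto
    then show "a (x(i := s)) \<le> (\<integral>\<^sup>+\<tau>. f ((x(j := \<tau>))(i := s)) \<partial>lborel)"
      unfolding fun_upd_twist[OF \<open>j \<noteq> i\<close>]
      using insert.prems(4)[OF measurable_space[OF upd x] insertI2[OF j], of s] by blast
  qed
  have pow: "A s ^ n \<le> L * \<Lambda> s ^ n" for s
  proof (cases "A s = 0")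
    case False
    have "A s ^ n = A s * A s ^ (n - 1)" using n by (cases n) auto
    also have "\<dots> \<le> L * \<Lambda> s ^ n" using A_L A_\<Lambda>[of s] False by (intro mult_mono) auto
    finally show ?thesis .
  qed (use n in \<open>simp add: power_0_left\<close>)
  have "integral\<^sup>N ?Q a ^ n \<le> L ^ Suc n"
  proof (cases L)
    case (real l)
    \<comment> \<open>With \<open>\<kappa>\<close> the \<open>n\<close>-th root of \<open>L\<close>,
      the bound \<open>pow\<close> becomes \<open>A s \<le> \<kappa> * \<Lambda> s\<close>.
      Integration over \<open>s\<close> gives \<open>\<kappa> * L\<close>, whose \<open>n\<close>-th
      power is \<open>L ^ Suc n\<close>.\<close>
    define \<kappa> where "\<kappa> = ennreal (root n l)"
    have \<kappa>: "\<kappa> ^ n = L" using real n by (simp add: \<kappa>_def ennreal_power)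
    have "A s \<le> \<kappa> * \<Lambda> s" for s
      by (rule ennreal_power_le_imp_le[OF _ n]) (simp add: power_mult_distrib \<kappa> pow)
    then have "integral\<^sup>N ?Q a \<le> (\<integral>\<^sup>+s. \<kappa> * \<Lambda> s \<partial>lborel)"
      unfolding A by (intro nn_integral_mono)
    also have "\<dots> = \<kappa> * L" by (simp add: L nn_integral_cmult)
    finally have "integral\<^sup>N ?Q a ^ n \<le> (\<kappa> * L) ^ n" by (rule power_mono) simp
    then show ?thesis by (simp add: power_mult_distrib \<kappa>)
  qed (simp add: top_power_ennreal)
  then show ?case
    using insert.hyps by (simp add: L_def n_def)
qed

section \<open>Loomis-Whitney for Lebesgue measure on vectors\<close>

lemma lborel_vec_eq_PiM:
  "(lborel :: (real^'n::finite) measure) = distr (\<Pi>\<^sub>M i\<in>UNIV. lborel) borel (\<lambda>f. \<chi> i. f i)"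
proof (rule lborel_eqI)
  interpret finite_product_sigma_finite "\<lambda>_::'n. lborel :: real measure" UNIV
    by standard simp
  have m: "(\<lambda>f. \<chi> i. f i) \<in> measurable (\<Pi>\<^sub>M i\<in>UNIV. lborel) (borel :: (real^'n) measure)"
    by (subst borel_measurable_euclidean_space) (auto simp: Basis_vec_def inner_axis)
  fix l u :: "real^'n" assume le: "\<And>b. b \<in> Basis \<Longrightarrow> l \<bullet> b \<le> u \<bullet> b"
  have le': "l $ i \<le> u $ i" for i
    using le[of "axis i 1"] by (simp add: inner_axis)
  have "emeasure (distr (\<Pi>\<^sub>M i\<in>UNIV. lborel) borel (\<lambda>f. \<chi> i. f i)) (box l u) =
      emeasure (\<Pi>\<^sub>M i\<in>UNIV. lborel) (\<Pi>\<^sub>E i\<in>UNIV. {l $ i<..<u $ i})"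
    using m by (subst emeasure_distr) (auto simp: mem_box_cart space_PiM PiE_iff intro!: arg_cong2[where f=emeasure])
  also have "\<dots> = (\<Prod>i\<in>UNIV. emeasure lborel {l $ i<..<u $ i})"
    by (rule measure_times) simp
  also have "\<dots> = (\<Prod>i\<in>UNIV. ennreal (u $ i - l $ i))"
    using le' by simp
  also have "\<dots> = ennreal (\<Prod>i\<in>UNIV. (u - l) $ i)"
    using le' by (subst prod_ennreal) auto
  also have "(\<Prod>i\<in>UNIV. (u - l) $ i) = (\<Prod>b\<in>Basis. (u - l) \<bullet> b)"
  proof -
    have "(\<Prod>b\<in>Basis. (u - l) \<bullet> b) = (\<Prod>b\<in>range (\<lambda>i::'n. axis i (1::real)). (u - l) \<bullet> b)"
      by (rule prod.cong) (auto simp: Basis_vec_def)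
    also have "\<dots> = (\<Prod>i\<in>UNIV. (u - l) \<bullet> axis i 1)"
      by (subst prod.reindex) (auto simp: inj_on_def axis_eq_axis)
    finally show ?thesis by (simp add: inner_axis)
  qed
  finally show "emeasure (distr (\<Pi>\<^sub>M i\<in>UNIV. lborel) borel (\<lambda>f. \<chi> i. f i)) (box l u) =
    ennreal (\<Prod>b\<in>Basis. (u - l) \<bullet> b)" .
qed simp

lemma Loomis_Whitney_vec:
  fixes f a :: "real^'n::finite \<Rightarrow> ennreal"
  assumes [measurable]: "f \<in> borel_measurable borel" "a \<in> borel_measurable borel"
    and a: "\<And>x. a x = 0 \<or> 1 \<le> a x"
    and le: "\<And>x i. a x \<le> (\<integral>\<^sup>+\<tau>. f (x + \<tau> *\<^sub>R axis i 1) \<partial>lborel)"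
  shows "integral\<^sup>N lborel a = 0 \<or> integral\<^sup>N lborel a ^ (CARD('n) - 1) \<le> integral\<^sup>N lborel f ^ CARD('n)"
proof -
  let ?T = "\<lambda>f::'n \<Rightarrow> real. \<chi> i. f i" and ?P = "\<Pi>\<^sub>M i\<in>(UNIV::'n set). lborel :: real measure"
  have T[measurable]: "?T \<in> measurable ?P (borel :: (real^'n) measure)"
    by (subst borel_measurable_euclidean_space) (auto simp: Basis_vec_def inner_axis)
  have eq: "integral\<^sup>N lborel h = (\<integral>\<^sup>+x. h (?T x) \<partial>?P)"
    if [measurable]: "h \<in> borel_measurable borel" for h :: "real^'n \<Rightarrow> ennreal"
    by (subst lborel_vec_eq_PiM) (simp add: nn_integral_distr)
  have "(\<integral>\<^sup>+x. a (?T x) \<partial>?P) = 0 \<or>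
    (\<integral>\<^sup>+x. a (?T x) \<partial>?P) ^ (CARD('n) - 1) \<le> (\<integral>\<^sup>+x. f (?T x) \<partial>?P) ^ CARD('n)"
  proof (rule Loomis_Whitney_PiM)
    fix x :: "'n \<Rightarrow> real" and i
    have "a (?T x) \<le> (\<integral>\<^sup>+\<tau>. f (?T x + \<tau> *\<^sub>R axis i 1) \<partial>lborel)" by (rule le)
    \<comment> \<open>Shifting the line parameter by \<open>x i\<close> turns displacement from
      \<open>x\<close> into the \<open>i\<close>-th coordinate itself, as the product version
      requires.\<close>
    also have "\<dots> = (\<integral>\<^sup>+\<tau>. f (?T x + (\<tau> + (- x i)) *\<^sub>R axis i 1) \<partial>lborel)"
      by (rule nn_integral_lborel_shift[symmetric]) measurable
    also have "\<dots> = (\<integral>\<^sup>+\<tau>. f (?T (x(i := \<tau>))) \<partial>lborel)"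
      by (intro nn_integral_cong arg_cong[where f=f]) (auto simp: vec_eq_iff axis_def)
    finally show "a (?T x) \<le> (\<integral>\<^sup>+\<tau>. f (?T (x(i := \<tau>))) \<partial>lborel)" .
  qed (use a in auto)
  then show ?thesis by (simp add: eq)
qed

section \<open>Weighted Sobolev and Poincare inequalities\<close>

definition weight :: "'a::real_inner \<Rightarrow> real"
  where "weight x = exp ((norm x)\<^sup>2 / 2)"

lemma weight_pos[simp]: "0 < weight x" "0 \<le> weight x" "weight x \<noteq> 0"
  by (simp_all add: weight_def)

lemma weight_ge_1: "1 \<le> weight x"
  by (simp add: weight_def)

lemma weight_measurable[measurable]: "weight \<in> borel_measurable borel"
  unfolding weight_def[abs_def] by measurable

text \<open>The sign of \<open>x \<bullet> v\<close> decides the behaviour: if it is nonnegative,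
  the weight increases along the half line from \<open>x\<close> in direction
  \<open>v\<close>.\<close>

lemma weight_along_line:
  assumes "norm v = 1"
  shows "weight (x + \<tau> *\<^sub>R v) = weight x * exp ((x \<bullet> v) * \<tau> + \<tau>\<^sup>2 / 2)"
proof -
  have "(norm (x + \<tau> *\<^sub>R v))\<^sup>2 = (norm x)\<^sup>2 + 2 * (\<tau> * (x \<bullet> v)) + \<tau>\<^sup>2"
  proof -
    have "v \<bullet> v = 1" using assms by (simp add: norm_eq_1)
    then show ?thesis
      unfolding power2_norm_eq_inner
      by (simp add: inner_add_left inner_add_right inner_commute[of v x] power2_eq_square algebra_simps)
  qed
  then show ?thesis
    by (simp add: weight_def exp_add[symmetric] field_simps)
qed

lemma nn_integral_mN:
  fixes f :: "real^'n::finite \<Rightarrow> ennreal"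
  assumes [measurable]: "f \<in> borel_measurable borel"
  shows "(\<integral>\<^sup>+x. f x \<partial>mN) = (\<integral>\<^sup>+x. ennreal (weight x) * f x \<partial>lborel)"
proof -
  have "(\<integral>\<^sup>+x. f x \<partial>mN) = (\<integral>\<^sup>+x. ennreal (weight x) * f x \<partial>lebesgue)"
    unfolding mN_def weight_def
    by (rule nn_integral_density) (auto intro!: measurable_completion)
  then show ?thesis by (simp add: nn_integral_completion)
qed

lemma nn_integral_reflect:
  fixes f :: "real \<Rightarrow> ennreal"
  assumes [measurable]: "f \<in> borel_measurable borel"
  shows "(\<integral>\<^sup>+x. f (- x) \<partial>lborel) = (\<integral>\<^sup>+x. f x \<partial>lborel)"
  by (subst (2) lborel_distr_uminus[symmetric]) (simp add: nn_integral_distr)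

text \<open>The factor \<open>p + \<tau>\<close> is the derivative of the exponent, so the integrand
  has the antiderivative \<open>- exp (- (p * \<tau> + \<tau>^2 / 2))\<close>. With
  \<open>p = x \<bullet> v\<close> the exponential is the weight at \<open>x\<close> divided by the
  weight at \<open>x + \<tau> v\<close>.\<close>

lemma nn_integral_inverse_weight:
  assumes "0 \<le> p"
  shows "(\<integral>\<^sup>+\<tau>. ennreal ((p + \<tau>) * exp (- (p * \<tau> + \<tau>\<^sup>2 / 2))) * indicator {0..} \<tau> \<partial>lborel) = 1"
proof -
  have "((\<lambda>\<tau>::real. - exp (- (p * \<tau> + \<tau>\<^sup>2 / 2))) \<longlongrightarrow> - 0) at_top"
  proof (intro tendsto_minus filterlim_compose[OF exp_at_bot] filterlim_compose[OF filterlim_uminus_at_bot_at_top])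
    have "filterlim (\<lambda>\<tau>::real. \<tau>\<^sup>2 / 2) at_top at_top"
      by (rule filterlim_at_top_mono[where f="\<lambda>x. x"])
         (auto intro!: filterlim_ident eventually_at_top_linorderI[of 2] simp: power2_eq_square)
    then show "filterlim (\<lambda>\<tau>::real. p * \<tau> + \<tau>\<^sup>2 / 2) at_top at_top"
      by (rule filterlim_at_top_mono)
         (use assms in \<open>auto intro!: eventually_at_top_linorderI[of 0]\<close>)
  qed
  then have "(\<integral>\<^sup>+\<tau>. ennreal ((p + \<tau>) * exp (- (p * \<tau> + \<tau>\<^sup>2 / 2))) * indicator {0..} \<tau> \<partial>lborel)
      = ennreal (- 0 - (- exp (- (p * 0 + 0\<^sup>2 / 2))))"
    by (intro nn_integral_FTC_atLeast)
       (use assms in \<open>auto intro!: derivative_eq_intros simp: field_simps power2_eq_square\<close>)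
  then show ?thesis by simp
qed

text \<open>Borel data standing for an element of \<open>H1_mN\<close>;
  \<open>H1_mN_representative\<close> shows that every element has such data.\<close>

locale weighted_sobolev_function =
  fixes u :: "real^'n::finite \<Rightarrow> real" and g :: "real^'n \<Rightarrow> real^'n"
  assumes ug: "borel_weak_gradient u g"
    and g_meas[measurable]: "g \<in> borel_measurable borel"
    and u2: "(\<integral>\<^sup>+x. ennreal (weight x * (u x)\<^sup>2) \<partial>lborel) < \<infinity>"
    and g2: "(\<integral>\<^sup>+x. ennreal (weight x * (norm (g x))\<^sup>2) \<partial>lborel) < \<infinity>"
begin

lemma u_meas[measurable]: "u \<in> borel_measurable borel"
  using ug by (auto simp: borel_weak_gradient_def dest: box_integrable_measurable)

lemma line_drop_AE:
  fixes i :: 'n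
  assumes "\<sigma> = 1 \<or> \<sigma> = -1"
  defines "v \<equiv> \<sigma> *\<^sub>R axis i 1"
  shows "AE x in lborel. \<forall>t t'. 0 \<le> t \<longrightarrow> t < t' \<longrightarrow> t' \<le> \<bar>u x\<bar> \<longrightarrow>
    ennreal (t' - t) \<le> (\<integral>\<^sup>+\<tau>. ennreal (norm (g (x + \<tau> *\<^sub>R v))) *
        indicator {x. t < \<bar>u x\<bar> \<and> \<bar>u x\<bar> < t'} (x + \<tau> *\<^sub>R v) * indicator {0..} \<tau> \<partial>lborel)"
  unfolding v_def
proof (rule AE_line_drop[OF ug assms(1) g_meas])
  have le: "r \<le> weight x * r" if "0 \<le> r" for r and x :: "real^'n"
    using mult_right_mono[OF weight_ge_1[of x] that] by simp
  show "(\<integral>\<^sup>+x. ennreal ((u x)\<^sup>2) \<partial>lborel) < \<infinity>" "(\<integral>\<^sup>+x. ennreal ((norm (g x))\<^sup>2) \<partial>lborel) < \<infinity>"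
    by (rule le_less_trans[OF nn_integral_mono u2] le_less_trans[OF nn_integral_mono g2],
        intro ennreal_leI le, simp)+
qed

text \<open>This is the \<open>CARD('n)\<close>-th power of the inequality announced in the
  introduction, so that all exponents are natural numbers and infinite values are harmless.\<close>

lemma weighted_sobolev_step:
  assumes t: "0 \<le> t" "t < t'" and N: "2 \<le> CARD('n)"
  shows "ennreal (t' - t) ^ CARD('n) *
      (\<integral>\<^sup>+x. ennreal (weight x) * indicator {x. t' \<le> \<bar>u x\<bar>} x \<partial>lborel) ^ (CARD('n) - 1)
    \<le> (\<integral>\<^sup>+x. ennreal (weight x * norm (g x)) * indicator {x. t < \<bar>u x\<bar> \<and> \<bar>u x\<bar> < t'} x \<partial>lborel) ^ CARD('n)"
proof -
  define h where "h = t' - t"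
  have h: "0 < h" using t by (simp add: h_def)
  let ?band = "{x. t < \<bar>u x\<bar> \<and> \<bar>u x\<bar> < t'}"
  define F where "F x = ennreal (weight x * norm (g x)) * indicator ?band x" for x
  \<comment> \<open>Dividing by \<open>h\<close> turns the line bounds into
    \<open>weight x \<le> integral f\<close>. As the weight is at least 1, the function
    \<open>weight * indicator E\<close> has only values 0 or at least 1, as Loomis-Whitney
    demands.\<close>
  define f where "f x = ennreal (1 / h) * F x" for x
  \<comment> \<open>Loomis-Whitney needs its hypotheses at every point, whereas
    \<open>line_drop_AE\<close> holds almost everywhere. The set \<open>E\<close> satisfies them by
    definition and contains the superlevel set up to a null set.\<close>
  define E where "E = {x. \<forall>i. ennreal (weight x) \<le> (\<integral>\<^sup>+\<tau>. f (x + \<tau> *\<^sub>R axis i 1) \<partial>lborel)}"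
  have F[measurable]: "F \<in> borel_measurable borel" unfolding F_def[abs_def] by measurable
  have f[measurable]: "f \<in> borel_measurable borel" unfolding f_def[abs_def] by measurable
  have [measurable]: "(\<lambda>x. \<integral>\<^sup>+\<tau>. f (x + \<tau> *\<^sub>R axis i 1) \<partial>lborel) \<in> borel_measurable borel" for i :: 'n
    by measurable
  have E[measurable]: "E \<in> sets borel"
    unfolding E_def by measurable
  define A where "A = (\<integral>\<^sup>+x. ennreal (weight x) * indicator E x \<partial>lborel)"
  have LW: "A = 0 \<or> A ^ (CARD('n) - 1) \<le> integral\<^sup>N lborel f ^ CARD('n)"
    unfolding A_def
  proof (rule Loomis_Whitney_vec)
    show "ennreal (weight x) * indicator E x = 0 \<or> 1 \<le> ennreal (weight x) * indicator E x" for x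
      by (auto simp: indicator_def ennreal_ge_1 weight_ge_1)
    show "ennreal (weight x) * indicator E x \<le> (\<integral>\<^sup>+\<tau>. f (x + \<tau> *\<^sub>R axis i 1) \<partial>lborel)" for x i
      by (auto simp: indicator_def E_def)
  qed measurable
  have "AE x in lborel. t' \<le> \<bar>u x\<bar> \<longrightarrow> ennreal (weight x) \<le> (\<integral>\<^sup>+\<tau>. f (x + \<tau> *\<^sub>R axis i 1) \<partial>lborel)" for i
    using line_drop_AE[OF disjI1[OF refl], of i] line_drop_AE[OF disjI2[OF refl], of i]
  proof eventually_elim
    case (elim x)
    show ?case
    proof
      assume tx: "t' \<le> \<bar>u x\<bar>"
      define \<sigma> :: real where "\<sigma> = (if 0 \<le> x $ i then 1 else - 1)"
      define v where "v = \<sigma> *\<^sub>R axis i (1::real)"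
      have v: "norm v = 1" and xv: "0 \<le> x \<bullet> v"
        by (auto simp: v_def \<sigma>_def inner_axis)
      have "ennreal h \<le> (\<integral>\<^sup>+\<tau>. ennreal (norm (g (x + \<tau> *\<^sub>R v))) *
          indicator ?band (x + \<tau> *\<^sub>R v) * indicator {0..} \<tau> \<partial>lborel)"
        using elim[rule_format, OF t tx] by (simp add: h_def v_def \<sigma>_def)
      then have "ennreal (weight x) * ennreal h \<le> ennreal (weight x) * (\<integral>\<^sup>+\<tau>. ennreal (norm (g (x + \<tau> *\<^sub>R v))) *
          indicator ?band (x + \<tau> *\<^sub>R v) * indicator {0..} \<tau> \<partial>lborel)"
        by (rule mult_left_mono) simp
      also have "\<dots> = (\<integral>\<^sup>+\<tau>. ennreal (weight x) * (ennreal (norm (g (x + \<tau> *\<^sub>R v))) *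
          indicator ?band (x + \<tau> *\<^sub>R v) * indicator {0..} \<tau>) \<partial>lborel)"
        by (rule nn_integral_cmult[symmetric]) measurable
      also have "\<dots> \<le> (\<integral>\<^sup>+\<tau>. F (x + \<tau> *\<^sub>R v) \<partial>lborel)"
      proof (rule nn_integral_mono)
        fix \<tau> :: real
        have "weight x \<le> weight (x + \<tau> *\<^sub>R v)" if "0 \<le> \<tau>"
          unfolding weight_along_line[OF v] using xv that by simp
        then have "weight x * norm (g (x + \<tau> *\<^sub>R v)) \<le> weight (x + \<tau> *\<^sub>R v) * norm (g (x + \<tau> *\<^sub>R v))" if "0 \<le> \<tau>"
          using that by (intro mult_right_mono) auto
        then show "ennreal (weight x) * (ennreal (norm (g (x + \<tau> *\<^sub>R v))) *
          indicator ?band (x + \<tau> *\<^sub>R v) * indicator {0..} \<tau>) \<le> F (x + \<tau> *\<^sub>R v)"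
          unfolding F_def
          by (cases "0 \<le> \<tau>") (auto simp: indicator_def ennreal_mult[symmetric] intro!: ennreal_leI)
      qed
      \<comment> \<open>The half line has been enlarged to the whole line, so a reflection of
        \<open>\<tau>\<close> removes the sign and both sides of the hyperplane share one
        bound.\<close>
      also have "\<dots> = (\<integral>\<^sup>+\<tau>. F (x + \<tau> *\<^sub>R axis i 1) \<partial>lborel)"
      proof (cases "0 \<le> x $ i")
        case False
        then show ?thesis
          using nn_integral_reflect[of "\<lambda>\<tau>. F (x + \<tau> *\<^sub>R axis i 1)"] by (simp add: v_def \<sigma>_def)
      qed (simp add: v_def \<sigma>_def)
      finally have "ennreal (1 / h) * (ennreal (weight x) * ennreal h) \<le>
          ennreal (1 / h) * (\<integral>\<^sup>+\<tau>. F (x + \<tau> *\<^sub>R axis i 1) \<partial>lborel)"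
        by (rule mult_left_mono) simp
      moreover have "ennreal (1 / h) * (ennreal (weight x) * ennreal h) = ennreal (weight x)"
        using h by (simp add: ennreal_mult[symmetric])
      ultimately show "ennreal (weight x) \<le> (\<integral>\<^sup>+\<tau>. f (x + \<tau> *\<^sub>R axis i 1) \<partial>lborel)"
        unfolding f_def by (simp add: nn_integral_cmult)
    qed
  qed
  then have "AE x in lborel. \<forall>i. t' \<le> \<bar>u x\<bar> \<longrightarrow> ennreal (weight x) \<le> (\<integral>\<^sup>+\<tau>. f (x + \<tau> *\<^sub>R axis i 1) \<partial>lborel)"
    unfolding AE_all_countable by (rule allI)
  then have "(\<integral>\<^sup>+x. ennreal (weight x) * indicator {x. t' \<le> \<bar>u x\<bar>} x \<partial>lborel) \<le> A" (is "?M \<le> A")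
    unfolding A_def
    by (intro nn_integral_mono_AE, eventually_elim) (auto simp: indicator_def E_def)
  then have "ennreal h ^ CARD('n) * ?M ^ (CARD('n) - 1) \<le> ennreal h ^ CARD('n) * A ^ (CARD('n) - 1)"
    by (intro mult_left_mono power_mono) auto
  \<comment> \<open>In the case \<open>A = 0\<close> the left side vanishes because the exponent
    \<open>CARD('n) - 1\<close> is positive; this is where \<open>N\<close> enters.\<close>
  also have "\<dots> \<le> ennreal h ^ CARD('n) * integral\<^sup>N lborel f ^ CARD('n)"
    using LW N by (intro mult_left_mono) (auto simp: power_0_left)
  also have "\<dots> = (ennreal h * integral\<^sup>N lborel f) ^ CARD('n)"
    by (simp add: power_mult_distrib)
  also have "ennreal h * integral\<^sup>N lborel f = integral\<^sup>N lborel F"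
    unfolding f_def using h by (simp add: nn_integral_cmult mult.assoc[symmetric] ennreal_mult[symmetric])
  finally show ?thesis unfolding h_def F_def[abs_def] .
qed

text \<open>A one-dimensional Hardy inequality on each half line leading away from the hyperplane,
  obtained from \<open>line_drop_AE\<close> with \<open>t = 0\<close> and \<open>t' = |u x|\<close>
  by Cauchy-Schwarz, and then integrated over the starting points. The weights are matched so that
  the constant is 1.\<close>

lemma half_space_Poincare:
  fixes i :: 'n
  assumes \<sigma>: "\<sigma> = 1 \<or> \<sigma> = -1"
  defines "v \<equiv> \<sigma> *\<^sub>R axis i 1"
  shows "(\<integral>\<^sup>+x. ennreal (weight x * (u x)\<^sup>2) * indicator {x. 0 \<le> x \<bullet> v} x \<partial>lborel)
    \<le> (\<integral>\<^sup>+x. ennreal (weight x * (norm (g x))\<^sup>2) * indicator {x. 0 < x \<bullet> v} x \<partial>lborel)"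
proof -
  have v: "norm v = 1" using \<sigma> by (auto simp: v_def)
  have vv: "v \<bullet> v = 1" using v by (simp add: norm_eq_1)
  define k where "k y = ennreal (weight y * (norm (g y))\<^sup>2 / (y \<bullet> v))" for y
  have [measurable]: "k \<in> borel_measurable borel" unfolding k_def[abs_def] by measurable
  have "AE x in lborel. ennreal (weight x * (u x)\<^sup>2) * indicator {x. 0 \<le> x \<bullet> v} x \<le>
      (\<integral>\<^sup>+\<tau>. k (x + \<tau> *\<^sub>R v) * indicator {0<..} \<tau> * indicator {x. 0 \<le> x \<bullet> v} x \<partial>lborel)"
    using line_drop_AE[OF \<sigma>, of i]
  proof eventually_elim
    case (elim x)
    show ?case
    proof (cases "0 \<le> x \<bullet> v \<and> u x \<noteq> 0")
      case True
      define p where "p = x \<bullet> v"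
      have p: "0 \<le> p" "0 < \<bar>u x\<bar>" using True by (auto simp: p_def)
      let ?G = "\<lambda>\<tau>. norm (g (x + \<tau> *\<^sub>R v))" and ?W = "\<lambda>\<tau>. weight (x + \<tau> *\<^sub>R v)"
      \<comment> \<open>The factor \<open>p + \<tau>\<close> makes the integral of \<open>b\<^sup>2\<close> exactly \<open>1 / weight x\<close>, and integrating
        \<open>1 / (p + \<tau>)\<close> over the half line of starting points cancels it again.\<close>
      define a where "a \<tau> = ennreal (?G \<tau> * sqrt (?W \<tau> / (p + \<tau>))) * indicator {0<..} \<tau>" for \<tau>
      define b where "b \<tau> = ennreal (sqrt ((p + \<tau>) / ?W \<tau>)) * indicator {0<..} \<tau>" for \<tau>
      have [measurable]: "a \<in> borel_measurable borel" "b \<in> borel_measurable borel"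
        unfolding a_def[abs_def] b_def[abs_def] by measurable
      have "ennreal \<bar>u x\<bar> \<le> (\<integral>\<^sup>+\<tau>. ennreal (?G \<tau>) *
          indicator {y. 0 < \<bar>u y\<bar> \<and> \<bar>u y\<bar> < \<bar>u x\<bar>} (x + \<tau> *\<^sub>R v) * indicator {0..} \<tau> \<partial>lborel)"
        using elim[rule_format, of 0 "\<bar>u x\<bar>"] p by (simp add: v_def)
      also have "\<dots> \<le> (\<integral>\<^sup>+\<tau>. a \<tau> * b \<tau> \<partial>lborel)"
      proof (rule nn_integral_mono_AE)
        \<comment> \<open>The functions \<open>a\<close> and \<open>b\<close> live on the open half
          line, where \<open>p + \<tau>\<close> is positive even when \<open>p = 0\<close>.\<close>
        have "AE \<tau> in lborel. \<tau> \<noteq> (0::real)" by (rule AE_lborel_singleton)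
        then show "AE \<tau> in lborel. ennreal (?G \<tau>) * indicator {y. 0 < \<bar>u y\<bar> \<and> \<bar>u y\<bar> < \<bar>u x\<bar>} (x + \<tau> *\<^sub>R v) *
            indicator {0..} \<tau> \<le> a \<tau> * b \<tau>"
        proof eventually_elim
          case (elim \<tau>)
          show ?case
          proof (cases "0 < \<tau>")
            case True
            then have "sqrt (?W \<tau> / (p + \<tau>)) * sqrt ((p + \<tau>) / ?W \<tau>) = 1"
              using p by (simp add: real_sqrt_mult[symmetric])
            then have "a \<tau> * b \<tau> = ennreal (?G \<tau>)"
              using True p by (simp add: a_def b_def ennreal_mult[symmetric] mult.assoc)
            then show ?thesis by (auto simp: indicator_def)
          qed (use elim in \<open>auto simp: indicator_def\<close>)
        qed
      qed
      finally have "(ennreal \<bar>u x\<bar>)\<^sup>2 \<le> (\<integral>\<^sup>+\<tau>. a \<tau> * b \<tau> \<partial>lborel)\<^sup>2"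
        by (rule power_mono) simp
      also have "\<dots> \<le> (\<integral>\<^sup>+\<tau>. a \<tau> ^ 2 \<partial>lborel) * (\<integral>\<^sup>+\<tau>. b \<tau> ^ 2 \<partial>lborel)"
        by (rule Cauchy_Schwarz_nn_integral) measurable
      also have "(\<integral>\<^sup>+\<tau>. a \<tau> ^ 2 \<partial>lborel) = (\<integral>\<^sup>+\<tau>. k (x + \<tau> *\<^sub>R v) * indicator {0<..} \<tau> \<partial>lborel)"
        using p by (intro nn_integral_cong)
          (auto simp: a_def k_def indicator_def ennreal_power power_mult_distrib inner_add_left vv p_def mult.commute)
      also have "(\<integral>\<^sup>+\<tau>. b \<tau> ^ 2 \<partial>lborel) \<le> (\<integral>\<^sup>+\<tau>. ennreal (1 / weight x) *
          (ennreal ((p + \<tau>) * exp (- (p * \<tau> + \<tau>\<^sup>2 / 2))) * indicator {0..} \<tau>) \<partial>lborel)"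
        using p by (intro nn_integral_mono)
          (auto simp: b_def indicator_def ennreal_power weight_along_line[OF v] p_def[symmetric]
             exp_minus field_simps ennreal_mult[symmetric])
      also have "\<dots> = ennreal (1 / weight x)"
        by (subst nn_integral_cmult, measurable) (simp only: nn_integral_inverse_weight[OF p(1)] mult_1_right)
      finally have "(ennreal \<bar>u x\<bar>)\<^sup>2 \<le> (\<integral>\<^sup>+\<tau>. k (x + \<tau> *\<^sub>R v) * indicator {0<..} \<tau> \<partial>lborel) * ennreal (1 / weight x)"
        by (simp add: mult_left_mono)
      then have "ennreal (weight x) * (ennreal \<bar>u x\<bar>)\<^sup>2 \<le>
          ennreal (weight x) * ((\<integral>\<^sup>+\<tau>. k (x + \<tau> *\<^sub>R v) * indicator {0<..} \<tau> \<partial>lborel) * ennreal (1 / weight x))"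
        by (rule mult_left_mono) simp
      also have "\<dots> = (\<integral>\<^sup>+\<tau>. k (x + \<tau> *\<^sub>R v) * indicator {0<..} \<tau> \<partial>lborel)"
      proof -
        have "ennreal (weight x) * (K * ennreal (1 / weight x)) = (ennreal (weight x) * ennreal (1 / weight x)) * K" for K
          by (simp only: ac_simps)
        moreover have "ennreal (weight x) * ennreal (1 / weight x) = 1"
          by (simp add: ennreal_mult[symmetric])
        ultimately show ?thesis by simp
      qed
      finally show ?thesis
        using p by (simp add: p_def ennreal_power ennreal_mult)
    qed auto
  qed
  then have "(\<integral>\<^sup>+x. ennreal (weight x * (u x)\<^sup>2) * indicator {x. 0 \<le> x \<bullet> v} x \<partial>lborel) \<le>
      (\<integral>\<^sup>+x. (\<integral>\<^sup>+\<tau>. k (x + \<tau> *\<^sub>R v) * indicator {0<..} \<tau> * indicator {x. 0 \<le> x \<bullet> v} x \<partial>lborel) \<partial>lborel)"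
    by (rule nn_integral_mono_AE)
  also have "\<dots> = (\<integral>\<^sup>+\<tau>. (\<integral>\<^sup>+x. k (x + \<tau> *\<^sub>R v) * indicator {0<..} \<tau> * indicator {x. 0 \<le> x \<bullet> v} x \<partial>lborel) \<partial>lborel)"
    by (rule lborel_pair.Fubini'[symmetric]) measurable
  \<comment> \<open>A point \<open>y\<close> is reached from the half space exactly for
    \<open>\<tau>\<close> up to \<open>y \<bullet> v\<close>. This total length cancels the
    denominator of \<open>k\<close>.\<close>
  also have "\<dots> = (\<integral>\<^sup>+\<tau>. (\<integral>\<^sup>+y. k y * indicator {0<..y \<bullet> v} \<tau> \<partial>lborel) \<partial>lborel)"
  proof (rule nn_integral_cong)
    fix \<tau> :: real
    have *: "indicator {0<..y \<bullet> v} \<tau> = (if 0 < \<tau> \<and> \<tau> \<le> y \<bullet> v then 1 else 0 :: ennreal)" for y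
      by (simp add: indicator_def)
    show "(\<integral>\<^sup>+x. k (x + \<tau> *\<^sub>R v) * indicator {0<..} \<tau> * indicator {x. 0 \<le> x \<bullet> v} x \<partial>lborel) =
      (\<integral>\<^sup>+y. k y * indicator {0<..y \<bullet> v} \<tau> \<partial>lborel)"
      unfolding *
      by (subst (2) nn_integral_lborel_shift[where c="\<tau> *\<^sub>R v", symmetric])
         (auto intro!: nn_integral_cong simp: indicator_def inner_add_left vv)
  qed
  also have "\<dots> = (\<integral>\<^sup>+y. (\<integral>\<^sup>+\<tau>. k y * indicator {0<..y \<bullet> v} \<tau> \<partial>lborel) \<partial>lborel)"
  proof (rule lborel_pair.Fubini')
    have *: "indicator {0<..y \<bullet> v} \<tau> = (if 0 < \<tau> \<and> \<tau> \<le> y \<bullet> v then 1 else 0 :: ennreal)" for y \<tau>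
      by (simp add: indicator_def)
    show "(\<lambda>(y, \<tau>). k y * indicator {0<..y \<bullet> v} \<tau>) \<in> borel_measurable (lborel \<Otimes>\<^sub>M lborel)"
      unfolding * by measurable
  qed
  also have "\<dots> \<le> (\<integral>\<^sup>+x. ennreal (weight x * (norm (g x))\<^sup>2) * indicator {x. 0 < x \<bullet> v} x \<partial>lborel)"
  proof (rule nn_integral_mono)
    fix y
    show "(\<integral>\<^sup>+\<tau>. k y * indicator {0<..y \<bullet> v} \<tau> \<partial>lborel) \<le>
        ennreal (weight y * (norm (g y))\<^sup>2) * indicator {x. 0 < x \<bullet> v} y"
      by (cases "0 < y \<bullet> v") (auto simp: nn_integral_cmult k_def ennreal_mult[symmetric])
  qed
  finally show ?thesis .
qed

text \<open>The half-space bound has closed half spaces on the left, which cover the space, and open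
  ones on the right, which are disjoint. Adding the two signs therefore costs no factor.\<close>

lemma Poincare:
  "(\<integral>\<^sup>+x. ennreal (weight x * (u x)\<^sup>2) \<partial>lborel) \<le> (\<integral>\<^sup>+x. ennreal (weight x * (norm (g x))\<^sup>2) \<partial>lborel)"
proof -
  obtain i :: 'n where True by blast
  define e where "e = (axis i 1 :: real^'n)"
  have "(\<integral>\<^sup>+x. ennreal (weight x * (u x)\<^sup>2) \<partial>lborel) \<le>
    (\<integral>\<^sup>+x. ennreal (weight x * (u x)\<^sup>2) * indicator {x. 0 \<le> x \<bullet> (1 *\<^sub>R e)} x
      + ennreal (weight x * (u x)\<^sup>2) * indicator {x. 0 \<le> x \<bullet> ((- 1) *\<^sub>R e)} x \<partial>lborel)"
    by (intro nn_integral_mono) (auto simp: indicator_def)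
  also have "\<dots> \<le> (\<integral>\<^sup>+x. ennreal (weight x * (norm (g x))\<^sup>2) * indicator {x. 0 < x \<bullet> (1 *\<^sub>R e)} x \<partial>lborel)
      + (\<integral>\<^sup>+x. ennreal (weight x * (norm (g x))\<^sup>2) * indicator {x. 0 < x \<bullet> ((- 1) *\<^sub>R e)} x \<partial>lborel)"
    using half_space_Poincare[of 1 i] half_space_Poincare[of "-1" i]
    by (subst nn_integral_add) (auto simp: e_def intro!: add_mono)
  also have "\<dots> = (\<integral>\<^sup>+x. ennreal (weight x * (norm (g x))\<^sup>2) * indicator {x. 0 < x \<bullet> (1 *\<^sub>R e)} x
      + ennreal (weight x * (norm (g x))\<^sup>2) * indicator {x. 0 < x \<bullet> ((- 1) *\<^sub>R e)} x \<partial>lborel)"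
    by (rule nn_integral_add[symmetric]) measurable
  also have "\<dots> \<le> (\<integral>\<^sup>+x. ennreal (weight x * (norm (g x))\<^sup>2) \<partial>lborel)"
    by (intro nn_integral_mono) (auto simp: indicator_def)
  finally show ?thesis .
qed

end

section \<open>Discrete Hardy inequalities\<close>

text \<open>Shifting the sum by one index gains a factor \<open>\<rho> < 1\<close>. Part of this
  gain pays for splitting \<open>\<tau> (Suc k)\<close> into \<open>\<tau> k\<close> plus an
  increment; the rest lets the sum be absorbed into the left side.\<close>

lemma discrete_Hardy_geometric:
  fixes \<tau> :: "nat \<Rightarrow> real"
  assumes \<rho>: "0 < \<rho>" "\<rho> < 1" and \<tau>0: "(\<tau> 0)\<^sup>2 \<le> D"
    and diff: "\<And>n. (\<Sum>k<n. (\<tau> (Suc k) - \<tau> k)\<^sup>2 * \<rho> ^ k) \<le> D"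
  shows "(\<Sum>k<n. (\<tau> k)\<^sup>2 * \<rho> ^ k) \<le> 2 * (1 + \<rho> + 2 * \<rho>\<^sup>2 / (1 - \<rho>)) / (1 - \<rho>) * D"
proof -
  \<comment> \<open>Chosen so that \<open>\<rho> * (1 + \<delta>)\<close> is the midpoint
    \<open>(1 + \<rho>) / 2\<close>, still below 1.\<close>
  define \<delta> where "\<delta> = (1 - \<rho>) / (2 * \<rho>)"
  have \<delta>: "0 < \<delta>" using \<rho> by (simp add: \<delta>_def)
  define S where "S n = (\<Sum>k<n. (\<tau> k)\<^sup>2 * \<rho> ^ k)" for n
  have pt: "(\<tau> (Suc k))\<^sup>2 \<le> (1 + \<delta>) * (\<tau> k)\<^sup>2 + (1 + 1 / \<delta>) * (\<tau> (Suc k) - \<tau> k)\<^sup>2" for k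
  proof -
    have "(a + b)\<^sup>2 \<le> (1 + \<delta>) * a\<^sup>2 + (1 + 1 / \<delta>) * b\<^sup>2" for a b :: real
    proof -
      have "0 \<le> (\<delta> * a - b)\<^sup>2 / \<delta>" using \<delta> by simp
      then show ?thesis using \<delta> by (simp add: field_simps power2_eq_square)
    qed
    from this[of "\<tau> k" "\<tau> (Suc k) - \<tau> k"] show ?thesis by simp
  qed
  have "S (Suc n) = (\<tau> 0)\<^sup>2 + (\<Sum>k<n. (\<tau> (Suc k))\<^sup>2 * \<rho> ^ Suc k)"
    unfolding S_def by (subst sum.lessThan_Suc_shift) simp
  also have "(\<Sum>k<n. (\<tau> (Suc k))\<^sup>2 * \<rho> ^ Suc k) \<le>
      (\<Sum>k<n. ((1 + \<delta>) * (\<tau> k)\<^sup>2 + (1 + 1 / \<delta>) * (\<tau> (Suc k) - \<tau> k)\<^sup>2) * \<rho> ^ Suc k)"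
    using \<rho> by (intro sum_mono mult_right_mono pt) auto
  also have "\<dots> = \<rho> * (1 + \<delta>) * S n + \<rho> * (1 + 1 / \<delta>) * (\<Sum>k<n. (\<tau> (Suc k) - \<tau> k)\<^sup>2 * \<rho> ^ k)"
    unfolding S_def sum_distrib_left sum.distrib[symmetric]
    by (intro sum.cong) (auto simp: algebra_simps)
  also have "\<dots> \<le> \<rho> * (1 + \<delta>) * S n + \<rho> * (1 + 1 / \<delta>) * D"
    using \<rho> \<delta> by (intro add_left_mono mult_left_mono diff) auto
  also have "\<rho> * (1 + \<delta>) = (1 + \<rho>) / 2" using \<rho> by (simp add: \<delta>_def field_simps)
  also have "\<rho> * (1 + 1 / \<delta>) = \<rho> + 2 * \<rho>\<^sup>2 / (1 - \<rho>)"
    using \<rho> by (simp add: \<delta>_def field_simps power2_eq_square)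
  finally have "S (Suc n) \<le> D + ((1 + \<rho>) / 2 * S n + (\<rho> + 2 * \<rho>\<^sup>2 / (1 - \<rho>)) * D)"
    using \<tau>0 by simp
  moreover have "S n \<le> S (Suc n)" using \<rho> by (simp add: S_def)
  ultimately have "S n * ((1 - \<rho>) / 2) \<le> (1 + \<rho> + 2 * \<rho>\<^sup>2 / (1 - \<rho>)) * D"
    by (simp add: algebra_simps) (simp add: field_simps)
  then have "S n \<le> (1 + \<rho> + 2 * \<rho>\<^sup>2 / (1 - \<rho>)) * D / ((1 - \<rho>) / 2)"
    using \<rho> by (subst pos_le_divide_eq) auto
  then show ?thesis by (simp add: S_def mult_ac)
qed

text \<open>The critical case without geometric decay. Summation by parts moves the difference from
  the weights \<open>c k\<close> onto the squares \<open>(\<tau> k)^2\<close>, where the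
  square-summable increments appear.\<close>

lemma discrete_Hardy:
  fixes \<tau> :: "nat \<Rightarrow> real"
  assumes nonneg: "\<And>k. 0 \<le> \<tau> k" and mono: "\<And>k. \<tau> k \<le> \<tau> (Suc k)" and \<tau>0: "(\<tau> 0)\<^sup>2 \<le> D"
    and diff: "\<And>n. (\<Sum>k<n. (\<tau> (Suc k) - \<tau> k)\<^sup>2) \<le> D"
  shows "(\<Sum>k<n. (\<tau> (Suc k))\<^sup>2 / (real (Suc k))\<^sup>2) \<le> 20 * D"
proof -
  \<comment> \<open>The shift by 1/2 makes the telescoping difference \<open>c k - c (Suc k)\<close>
    just exceed \<open>1 / (k + 1)^2\<close>; replacing it by 1 would fall short.\<close>
  define c where "c k = 1 / (real k + 1 / 2)" for k
  define S where "S = (\<Sum>k<n. (\<tau> (Suc k))\<^sup>2 / (real (Suc k))\<^sup>2)"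
  have c0: "0 < c k" for k by (simp add: c_def)
  have "1 / (real (Suc k))\<^sup>2 \<le> c k - c (Suc k)" for k
  proof -
    have "c k - c (Suc k) = 1 / ((real (Suc k))\<^sup>2 - 1 / 4)"
      by (simp add: c_def field_simps power2_eq_square)
    also have "1 / (real (Suc k))\<^sup>2 \<le> \<dots>"
    proof -
      have "1 / q \<le> 1 / (q - 1 / 4)" if "1 \<le> q" for q :: real
        using that by (intro frac_le) auto
      moreover have "1 \<le> (real (Suc k))\<^sup>2" by (intro one_le_power) simp
      ultimately show ?thesis by blast
    qed
    finally show ?thesis .
  qed
  then have "(\<tau> (Suc k))\<^sup>2 * (1 / (real (Suc k))\<^sup>2) \<le> (\<tau> (Suc k))\<^sup>2 * (c k - c (Suc k))" for k
    by (intro mult_left_mono) auto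
  then have "S \<le> (\<Sum>k<n. (\<tau> (Suc k))\<^sup>2 * (c k - c (Suc k)))"
    unfolding S_def by (intro sum_mono) simp
  also have "\<dots> \<le> (\<tau> 0)\<^sup>2 * c 0 + (\<Sum>k<n. ((\<tau> (Suc k))\<^sup>2 - (\<tau> k)\<^sup>2) * c k) - (\<tau> n)\<^sup>2 * c n"
    by (induction n) (auto simp: algebra_simps)
  also have "\<dots> \<le> (\<tau> 0)\<^sup>2 * c 0 + (\<Sum>k<n. ((\<tau> (Suc k))\<^sup>2 - (\<tau> k)\<^sup>2) * c k)"
    using c0[of n] by simp
  also have "\<dots> \<le> 2 * (\<tau> 0)\<^sup>2 + (\<Sum>k<n. 1 / 2 * ((\<tau> (Suc k))\<^sup>2 / (real (Suc k))\<^sup>2) + 8 * (\<tau> (Suc k) - \<tau> k)\<^sup>2)"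
  proof (intro add_mono sum_mono)
    fix k
    define d where "d = \<tau> (Suc k) - \<tau> k"
    have d: "0 \<le> d" "(\<tau> (Suc k))\<^sup>2 - (\<tau> k)\<^sup>2 \<le> 2 * \<tau> (Suc k) * d"
    proof -
      have "0 \<le> (\<tau> (Suc k) - \<tau> k)\<^sup>2" by simp
      then show "(\<tau> (Suc k))\<^sup>2 - (\<tau> k)\<^sup>2 \<le> 2 * \<tau> (Suc k) * d"
        by (simp add: d_def power2_eq_square algebra_simps)
    qed (use mono[of k] in \<open>simp add: d_def\<close>)
    have ck: "c k \<le> 2 / real (Suc k)" by (simp add: c_def field_simps)
    have "((\<tau> (Suc k))\<^sup>2 - (\<tau> k)\<^sup>2) * c k \<le> (2 * \<tau> (Suc k) * d) * (2 / real (Suc k))"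
      using d ck nonneg[of "Suc k"] c0[of k] by (intro mult_mono) auto
    also have "\<dots> = 4 * (\<tau> (Suc k) / real (Suc k)) * d" by simp
    \<comment> \<open>The Young weights leave exactly half of \<open>S\<close> on the right.
      Absorbing it turns \<open>S \<le> 10 * D + S / 2\<close> into the constant 20.\<close>
    also have "\<dots> \<le> 1 / 2 * (\<tau> (Suc k) / real (Suc k))\<^sup>2 + 8 * d\<^sup>2"
    proof -
      have "4 * x * d \<le> 1 / 2 * x\<^sup>2 + 8 * d\<^sup>2" for x :: real
        using zero_le_power2[of "x - 4 * d"] by (simp add: power2_eq_square algebra_simps)
      then show ?thesis .
    qed
    finally show "((\<tau> (Suc k))\<^sup>2 - (\<tau> k)\<^sup>2) * c k \<le>
      1 / 2 * ((\<tau> (Suc k))\<^sup>2 / (real (Suc k))\<^sup>2) + 8 * (\<tau> (Suc k) - \<tau> k)\<^sup>2"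
      by (simp add: d_def power_divide)
  qed (simp add: c_def)
  also have "\<dots> = 2 * (\<tau> 0)\<^sup>2 + 1 / 2 * S + 8 * (\<Sum>k<n. (\<tau> (Suc k) - \<tau> k)\<^sup>2)"
    unfolding S_def sum.distrib sum_distrib_left by simp
  also have "\<dots> \<le> 2 * D + 1 / 2 * S + 8 * D"
    using \<tau>0 diff[of n] by simp
  finally show ?thesis by (simp add: S_def)
qed

subsection \<open>The rearrangement\<close>

lemma sets_mN: "sets mN = sets lebesgue"
  by (simp add: mN_def)

lemma rearr_antimono: "s \<le> s' \<Longrightarrow> rearr u s' \<le> rearr u s"
  unfolding rearr_def
  by (intro Sup_subset_mono) (auto intro: le_less_trans[OF ennreal_leI])

lemma emeasure_mN:
  fixes A :: "(real^'n::finite) set"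
  assumes [measurable]: "A \<in> sets borel"
  shows "emeasure mN A = (\<integral>\<^sup>+x. ennreal (weight x) * indicator A x \<partial>lborel)"
proof -
  have "emeasure mN A = (\<integral>\<^sup>+x. indicator A x \<partial>mN)"
    by (rule nn_integral_indicator[symmetric]) (use assms in \<open>simp add: sets_mN\<close>)
  then show ?thesis by (simp add: nn_integral_mN)
qed

text \<open>The lower mass bound holds only strictly below \<open>rearr u s\<close>; at that height
  the strict superlevel set already has mass at most \<open>s\<close>. This is why
  \<open>level_step\<close> takes a limit from the left.\<close>

lemma less_rearr_imp:
  assumes [measurable]: "u \<in> borel_measurable borel" and "0 \<le> t" "ennreal t < rearr u s"
  shows "ennreal s < emeasure mN {x. t < \<bar>u x\<bar>}"
proof -
  obtain t1 where t1: "t < t1" "ennreal s < emeasure mN {x. t1 < \<bar>u x\<bar>}"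
    using assms(2,3) unfolding rearr_def less_Sup_iff by (auto simp: ennreal_less_iff)
  have "emeasure mN {x. t1 < \<bar>u x\<bar>} \<le> emeasure mN {x. t < \<bar>u x\<bar>}"
    using t1(1) by (intro emeasure_mono) (auto simp: sets_mN intro!: sets_completionI_sets)
  with t1 show ?thesis by (simp add: less_le_trans)
qed

text \<open>By continuity from below, excess mass above \<open>r\<close> would already be present
  above some \<open>r + 1 / (n + 1)\<close>, which would then belong to the set whose supremum is
  \<open>r\<close>.\<close>

lemma emeasure_above_rearr:
  assumes [measurable]: "u \<in> borel_measurable borel" and r: "rearr u s = ennreal r" "0 \<le> r"
  shows "emeasure mN {x. r < \<bar>u x\<bar>} \<le> ennreal s"
proof (rule ccontr)
  assume "\<not> ?thesis"
  let ?A = "\<lambda>n. {x. r + 1 / real (Suc n) < \<bar>u x\<bar>}"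
  have "{x. r < \<bar>u x\<bar>} = (\<Union>n. ?A n)"
  proof (intro set_eqI iffI)
    fix x assume "x \<in> {x. r < \<bar>u x\<bar>}"
    then obtain n where "1 / real (Suc n) < \<bar>u x\<bar> - r"
      using nat_approx_posE[of "\<bar>u x\<bar> - r"] by auto
    then show "x \<in> (\<Union>n. ?A n)" by (auto simp: algebra_simps)
  next
    fix x assume "x \<in> (\<Union>n. ?A n)"
    then obtain n where "r + 1 / real (Suc n) < \<bar>u x\<bar>" by auto
    moreover have "0 < 1 / real (Suc n)" by simp
    ultimately have "r < \<bar>u x\<bar>" by linarith
    then show "x \<in> {x. r < \<bar>u x\<bar>}" by simp
  qed
  moreover have "incseq ?A"
  proof (intro incseq_SucI subsetI CollectI)
    fix n x assume "x \<in> ?A n"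
    moreover have "1 / real (Suc (Suc n)) \<le> 1 / real (Suc n)" by (simp add: field_simps)
    ultimately show "r + 1 / real (Suc (Suc n)) < \<bar>u x\<bar>" by simp
  qed
  moreover have "range ?A \<subseteq> sets mN"
    by (auto simp: sets_mN intro!: sets_completionI_sets)
  ultimately have "emeasure mN {x. r < \<bar>u x\<bar>} = (SUP n. emeasure mN (?A n))"
    by (simp add: SUP_emeasure_incseq)
  with \<open>\<not> ?thesis\<close> obtain n where n: "ennreal s < emeasure mN (?A n)"
    by (auto simp: not_le less_SUP_iff)
  have "ennreal (r + 1 / real (Suc n)) \<le> rearr u s"
    unfolding rearr_def using n r(2)
    by (intro Sup_upper CollectI exI[of _ "r + 1 / real (Suc n)"]) auto
  then have "r + 1 / real (Suc n) \<le> r" using r by (simp add: ennreal_le_iff)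
  then show False by simp
qed

section \<open>Dyadic levels of the rearrangement\<close>

context weighted_sobolev_function
begin

definition energy :: real
  where "energy = enn2real (\<integral>\<^sup>+x. ennreal (weight x * (norm (g x))\<^sup>2) \<partial>lborel)"

lemma energy_nonneg: "0 \<le> energy"
  by (simp add: energy_def)

lemma energy_eq: "(\<integral>\<^sup>+x. ennreal (weight x * (norm (g x))\<^sup>2) \<partial>lborel) = ennreal energy"
  using g2 by (simp add: energy_def)

text \<open>Chebyshev's inequality for each admissible \<open>t\<close>, followed by
  \<open>Poincare\<close>. Besides the decay at infinity it gives finiteness at every positive
  point, so that the dyadic values can be handled as reals.\<close>

lemma rearr_le:
  assumes "0 < s"
  shows "rearr u s \<le> ennreal (sqrt (energy / s))"
  unfolding rearr_def
proof (rule Sup_least, clarify)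
  fix t :: real assume t: "0 \<le> t" "ennreal s < emeasure mN {x. t < \<bar>u x\<bar>}"
  have "ennreal (t\<^sup>2 * s) = ennreal (t\<^sup>2) * ennreal s" using assms by (simp add: ennreal_mult)
  also have "\<dots> \<le> ennreal (t\<^sup>2) * emeasure mN {x. t < \<bar>u x\<bar>}"
    using t by (intro mult_left_mono) auto
  also have "\<dots> = (\<integral>\<^sup>+x. ennreal (t\<^sup>2) * (ennreal (weight x) * indicator {x. t < \<bar>u x\<bar>} x) \<partial>lborel)"
    by (simp add: emeasure_mN nn_integral_cmult)
  also have "\<dots> \<le> (\<integral>\<^sup>+x. ennreal (weight x * (u x)\<^sup>2) \<partial>lborel)"
  proof (rule nn_integral_mono)
    fix x
    have "t\<^sup>2 \<le> (u x)\<^sup>2" if "t < \<bar>u x\<bar>"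
      using t(1) that by (simp add: abs_le_square_iff[symmetric])
    then show "ennreal (t\<^sup>2) * (ennreal (weight x) * indicator {x. t < \<bar>u x\<bar>} x) \<le> ennreal (weight x * (u x)\<^sup>2)"
      by (auto simp: indicator_def ennreal_mult[symmetric] mult.commute intro!: ennreal_leI mult_left_mono)
  qed
  also have "\<dots> \<le> ennreal energy"
    using Poincare by (simp add: energy_eq)
  finally have "t\<^sup>2 \<le> energy / s"
    using assms energy_nonneg by (simp add: ennreal_le_iff field_simps)
  then show "ennreal t \<le> ennreal (sqrt (energy / s))"
    by (intro ennreal_leI real_le_rsqrt)
qed

lemma rearr_square_le:
  assumes "0 < s"
  shows "(rearr u s)\<^sup>2 \<le> ennreal (energy / s)"
proof -
  have "(rearr u s)\<^sup>2 \<le> (ennreal (sqrt (energy / s)))\<^sup>2"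
    by (intro power_mono rearr_le assms) simp
  also have "\<dots> = ennreal (energy / s)"
    using assms energy_nonneg by (simp add: ennreal_power)
  finally show ?thesis .
qed

definition level :: "nat \<Rightarrow> real"
  where "level k = enn2real (rearr u ((1/2) ^ k))"

lemma level_nonneg: "0 \<le> level k"
  by (simp add: level_def)

lemma rearr_eq_real: "0 < s \<Longrightarrow> rearr u s = ennreal (enn2real (rearr u s))"
  using rearr_le[of s] by (simp add: le_less_trans)

lemma rearr_eq_level: "rearr u ((1/2) ^ k) = ennreal (level k)"
  using rearr_eq_real[of "(1/2) ^ k"] by (simp add: level_def)

lemma level_mono: "level k \<le> level (Suc k)"
proof -
  have "rearr u ((1/2) ^ k) \<le> rearr u ((1/2) ^ Suc k)"
    by (rule rearr_antimono) simp
  then show ?thesis unfolding rearr_eq_level using level_nonneg by (simp add: ennreal_le_iff)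
qed

lemma level_0_le: "(level 0)\<^sup>2 \<le> energy"
proof -
  have "ennreal ((level 0)\<^sup>2) \<le> ennreal energy"
    using rearr_square_le[of 1] rearr_eq_level[of 0] level_nonneg by (simp add: ennreal_power)
  then show ?thesis using energy_nonneg by (simp add: ennreal_le_iff)
qed

definition band_energy :: "nat \<Rightarrow> real"
  where "band_energy k = enn2real (\<integral>\<^sup>+x. ennreal (weight x * (norm (g x))\<^sup>2) *
    indicator {x. level k < \<bar>u x\<bar> \<and> \<bar>u x\<bar> < level (Suc k)} x \<partial>lborel)"

lemma band_energy_nonneg: "0 \<le> band_energy k"
  by (simp add: band_energy_def)

lemma band_energy_eq:
  "(\<integral>\<^sup>+x. ennreal (weight x * (norm (g x))\<^sup>2) *
    indicator {x. level k < \<bar>u x\<bar> \<and> \<bar>u x\<bar> < level (Suc k)} x \<partial>lborel) = ennreal (band_energy k)"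
proof -
  have "(\<integral>\<^sup>+x. ennreal (weight x * (norm (g x))\<^sup>2) *
    indicator {x. level k < \<bar>u x\<bar> \<and> \<bar>u x\<bar> < level (Suc k)} x \<partial>lborel) \<le> ennreal energy"
    unfolding energy_eq[symmetric] by (intro nn_integral_mono) (auto simp: indicator_def)
  then have "(\<integral>\<^sup>+x. ennreal (weight x * (norm (g x))\<^sup>2) *
    indicator {x. level k < \<bar>u x\<bar> \<and> \<bar>u x\<bar> < level (Suc k)} x \<partial>lborel) < top"
    by (rule le_less_trans) simp
  then show ?thesis unfolding band_energy_def by simp
qed

text \<open>The levels increase, so the open bands are pairwise disjoint and their energies add up
  to at most the whole.\<close>

lemma sum_band_energy_le: "(\<Sum>k<n. band_energy k) \<le> energy"
proof -
  let ?B = "\<lambda>k. {x. level k < \<bar>u x\<bar> \<and> \<bar>u x\<bar> < level (Suc k)}"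
  have mono: "level j \<le> level k" if "j \<le> k" for j k
    using level_mono that by (rule lift_Suc_mono_le)
  have disj: "j = k" if "x \<in> ?B j" "x \<in> ?B k" for j k x
  proof (rule ccontr)
    assume "j \<noteq> k"
    then consider "Suc j \<le> k" | "Suc k \<le> j" by linarith
    then show False using that mono[of "Suc j" k] mono[of "Suc k" j] by cases auto
  qed
  have ind: "(\<Sum>k<n. indicator (?B k) x) \<le> (1::ennreal)" for x
  proof (cases "\<exists>k<n. x \<in> ?B k")
    case True
    then obtain k where k: "k < n" "x \<in> ?B k" by blast
    have "indicator (?B j) x = (if j = k then 1 else 0 :: ennreal)" for j
    proof (cases "j = k")
      case False
      then have "x \<notin> ?B j" using disj[OF k(2), of j] by blast
      then show ?thesis using False by (simp add: indicator_def del: mem_Collect_eq)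
    qed (use k(2) in \<open>simp add: indicator_def\<close>)
    then have "(\<Sum>j<n. indicator (?B j) x) = (\<Sum>j<n. if j = k then 1 else 0 :: ennreal)"
      by (rule sum.cong[OF refl])
    then show ?thesis using k by simp
  next
    case False
    then have "(\<Sum>j<n. indicator (?B j) x) = (\<Sum>j<n. 0 :: ennreal)"
      by (intro sum.cong) (auto simp: indicator_def)
    then show ?thesis by simp
  qed
  have "ennreal (\<Sum>k<n. band_energy k) = (\<Sum>k<n. ennreal (band_energy k))"
    using band_energy_nonneg by (simp add: sum_ennreal)
  also have "\<dots> = (\<integral>\<^sup>+x. (\<Sum>k<n. ennreal (weight x * (norm (g x))\<^sup>2) * indicator (?B k) x) \<partial>lborel)"
    unfolding band_energy_eq[symmetric] by (rule nn_integral_sum[symmetric]) measurable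
  also have "\<dots> \<le> (\<integral>\<^sup>+x. ennreal (weight x * (norm (g x))\<^sup>2) \<partial>lborel)"
  proof (rule nn_integral_mono)
    fix x
    show "(\<Sum>k<n. ennreal (weight x * (norm (g x))\<^sup>2) * indicator (?B k) x) \<le> ennreal (weight x * (norm (g x))\<^sup>2)"
      using mult_left_mono[OF ind[of x], of "ennreal (weight x * (norm (g x))\<^sup>2)"]
      unfolding sum_distrib_left mult_1_right by simp
  qed
  finally show ?thesis
    using energy_nonneg by (simp add: energy_eq ennreal_le_iff)
qed

text \<open>The mass above \<open>t\<close> is at least \<open>(1/2) ^ Suc k\<close> because
  \<open>t\<close> is below the next level, and the band has mass at most \<open>(1/2) ^ k\<close>
  because it lies above the current one. The first bound enters
  \<open>weighted_sobolev_step\<close>, the second Cauchy-Schwarz. Squaring avoids square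
  roots.\<close>

lemma level_step_power:
  assumes N: "2 \<le> CARD('n)" and t: "level k < t" "t < level (Suc k)"
  shows "((t - level k)\<^sup>2) ^ CARD('n) * (((1/2) ^ Suc k)\<^sup>2) ^ (CARD('n) - 1)
    \<le> (band_energy k * (1/2) ^ k) ^ CARD('n)"
proof -
  let ?N = "CARD('n)"
  let ?band = "{x. level k < \<bar>u x\<bar> \<and> \<bar>u x\<bar> < t}"
  define B where "B = (\<integral>\<^sup>+x. ennreal (weight x * norm (g x)) * indicator ?band x \<partial>lborel)"
  have t0: "0 \<le> t" using t level_nonneg[of k] by linarith
  have "ennreal ((1/2) ^ Suc k) \<le> emeasure mN {x. t < \<bar>u x\<bar>}"
    using t by (intro less_imp_le less_rearr_imp t0) (auto simp: rearr_eq_level ennreal_less_iff t0 simp del: power_Suc)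
  also have "\<dots> \<le> (\<integral>\<^sup>+x. ennreal (weight x) * indicator {x. t \<le> \<bar>u x\<bar>} x \<partial>lborel)"
    by (subst emeasure_mN) (auto intro!: nn_integral_mono simp: indicator_def)
  finally have "ennreal (t - level k) ^ ?N * ennreal ((1/2) ^ Suc k) ^ (?N - 1) \<le>
      ennreal (t - level k) ^ ?N * (\<integral>\<^sup>+x. ennreal (weight x) * indicator {x. t \<le> \<bar>u x\<bar>} x \<partial>lborel) ^ (?N - 1)"
    by (intro mult_left_mono power_mono) auto
  also have "\<dots> \<le> B ^ ?N"
    unfolding B_def by (rule weighted_sobolev_step) (use level_nonneg t N in auto)
  finally have 1: "ennreal (t - level k) ^ ?N * ennreal ((1/2) ^ Suc k) ^ (?N - 1) \<le> B ^ ?N" .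
  have "B = (\<integral>\<^sup>+x. (ennreal (sqrt (weight x) * norm (g x)) * indicator ?band x) *
      (ennreal (sqrt (weight x)) * indicator ?band x) \<partial>lborel)"
    unfolding B_def
    by (intro nn_integral_cong) (auto simp: indicator_def ennreal_mult[symmetric])
  then have "B\<^sup>2 \<le> (\<integral>\<^sup>+x. (ennreal (sqrt (weight x) * norm (g x)) * indicator ?band x)\<^sup>2 \<partial>lborel) *
      (\<integral>\<^sup>+x. (ennreal (sqrt (weight x)) * indicator ?band x)\<^sup>2 \<partial>lborel)"
    by (simp only:) (rule Cauchy_Schwarz_nn_integral; measurable)
  also have "\<dots> \<le> ennreal (band_energy k) * ennreal ((1/2) ^ k)"
  proof (rule mult_mono)
    show "(\<integral>\<^sup>+x. (ennreal (sqrt (weight x) * norm (g x)) * indicator ?band x)\<^sup>2 \<partial>lborel) \<le> ennreal (band_energy k)"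
      unfolding band_energy_eq[symmetric] using t
      by (intro nn_integral_mono) (auto simp: indicator_def ennreal_power power_mult_distrib)
    have "(\<integral>\<^sup>+x. (ennreal (sqrt (weight x)) * indicator ?band x)\<^sup>2 \<partial>lborel) \<le> emeasure mN {x. level k < \<bar>u x\<bar>}"
      by (subst emeasure_mN) (auto intro!: nn_integral_mono simp: indicator_def ennreal_power)
    also have "\<dots> \<le> ennreal ((1/2) ^ k)"
      by (rule emeasure_above_rearr) (auto simp: rearr_eq_level level_nonneg)
    finally show "(\<integral>\<^sup>+x. (ennreal (sqrt (weight x)) * indicator ?band x)\<^sup>2 \<partial>lborel) \<le> ennreal ((1/2) ^ k)" .
  qed auto
  also have "\<dots> = ennreal (band_energy k * (1/2) ^ k)"
    by (simp add: ennreal_mult band_energy_nonneg)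
  finally have 2: "B\<^sup>2 \<le> ennreal (band_energy k * (1/2) ^ k)" .
  have "ennreal (((t - level k)\<^sup>2) ^ ?N * (((1/2) ^ Suc k)\<^sup>2) ^ (?N - 1)) =
      (ennreal (t - level k) ^ ?N * ennreal ((1/2) ^ Suc k) ^ (?N - 1))\<^sup>2"
    using t by (simp add: ennreal_power ennreal_mult[symmetric] power_mult_distrib power_mult[symmetric] mult.commute)
  also have "\<dots> \<le> (B ^ ?N)\<^sup>2" using 1 by (rule power_mono) simp
  also have "\<dots> = (B\<^sup>2) ^ ?N" by (simp add: power_mult[symmetric] mult.commute)
  also have "\<dots> \<le> ennreal (band_energy k * (1/2) ^ k) ^ ?N" using 2 by (rule power_mono) simp
  also have "\<dots> = ennreal ((band_energy k * (1/2) ^ k) ^ ?N)"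
    by (simp add: ennreal_power band_energy_nonneg)
  finally show ?thesis
    by (subst (asm) ennreal_le_iff) (auto simp: band_energy_nonneg)
qed

text \<open>The limit \<open>t \<rightarrow> level (Suc k)\<close> and an \<open>N\<close>-th root.
  With \<open>s = (1/2) ^ k\<close>, the Sobolev step contributes
  \<open>s powr (2 * (N - 1) / N)\<close> and Cauchy-Schwarz removes one factor \<open>s\<close>;
  the remaining \<open>s powr (1 - 2 / N)\<close> is \<open>\<rho> ^ k\<close>.\<close>

lemma level_step:
  assumes N: "2 \<le> CARD('n)"
  defines "\<rho> \<equiv> 2 powr (2 / real CARD('n) - 1)"
  shows "(level (Suc k) - level k)\<^sup>2 * \<rho> ^ k \<le> 4 * band_energy k"
proof (cases "level k < level (Suc k)")
  case True
  let ?N = "CARD('n)"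
  have "((level (Suc k) - level k)\<^sup>2) ^ ?N * (((1/2) ^ Suc k)\<^sup>2) ^ (?N - 1)
    \<le> (band_energy k * (1/2) ^ k) ^ ?N"
  proof (rule tendsto_upperbound)
    show "((\<lambda>t. ((t - level k)\<^sup>2) ^ ?N * (((1/2) ^ Suc k)\<^sup>2) ^ (?N - 1)) \<longlongrightarrow>
      ((level (Suc k) - level k)\<^sup>2) ^ ?N * (((1/2) ^ Suc k)\<^sup>2) ^ (?N - 1)) (at_left (level (Suc k)))"
      by (intro tendsto_intros)
    show "\<forall>\<^sub>F t in at_left (level (Suc k)). ((t - level k)\<^sup>2) ^ ?N * (((1/2) ^ Suc k)\<^sup>2) ^ (?N - 1)
        \<le> (band_energy k * (1/2) ^ k) ^ ?N"
      using eventually_at_left_real[OF True]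
      by eventually_elim (use level_step_power[OF N] in auto)
  qed simp
  moreover define d where "d = (level (Suc k) - level k)\<^sup>2"
  moreover define s :: real where "s = (1/2) ^ k"
  moreover obtain m where m: "?N = Suc (Suc m)" using N by (metis add_2_eq_Suc le_Suc_ex)
  ultimately have "d ^ ?N * ((s / 2)\<^sup>2) ^ (?N - 1) \<le> (band_energy k * s) ^ ?N"
    by simp
  moreover have s: "0 < s" by (simp add: s_def)
  have \<rho>N: "(\<rho> ^ k) ^ ?N = s ^ m"
  proof -
    have "\<rho> ^ ?N = 2 powr (real ?N * (2 / real ?N - 1))"
      unfolding \<rho>_def by (simp add: powr_realpow[symmetric] powr_powr mult.commute)
    also have "real ?N * (2 / real ?N - 1) = - real m"
      by (simp add: m field_simps)
    also have "2 powr (- real m) = (1 / 2 :: real) ^ m"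
      by (simp add: powr_minus powr_realpow power_one_over inverse_eq_divide)
    finally have "\<rho> ^ ?N = (1/2) ^ m" .
    then show ?thesis unfolding s_def power_mult[symmetric] mult.commute[of k] by (simp only: power_mult)
  qed
  have "(d * \<rho> ^ k) ^ ?N \<le> (4 * band_energy k) ^ ?N"
  proof -
    \<comment> \<open>As \<open>m = N - 2\<close>, the power \<open>s ^ (2 * (N - 1))\<close> splits
      into \<open>s ^ m\<close> and \<open>s ^ N\<close>, the latter cancelling against the right
      side. Halving \<open>s\<close> costs \<open>4 ^ (N - 1)\<close>, enlarged to
      \<open>4 ^ N\<close> so that the root is 4.\<close>
    have eq1: "d ^ ?N * ((s / 2)\<^sup>2) ^ (?N - 1) = d ^ ?N * s ^ m * (s ^ Suc (Suc m) / 4 ^ Suc m)"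
      by (simp add: m power_divide power_mult_distrib power2_eq_square power_add field_simps)
    have eq2: "(band_energy k * s) ^ ?N = band_energy k ^ ?N * s ^ Suc (Suc m)"
      by (simp add: m power_mult_distrib)
    have "d ^ ?N * s ^ m * (s ^ Suc (Suc m) / 4 ^ Suc m) \<le> band_energy k ^ ?N * s ^ Suc (Suc m)"
      using calculation(1) unfolding eq1 eq2 .
    then have "d ^ ?N * s ^ m / 4 ^ Suc m * s ^ Suc (Suc m) \<le> band_energy k ^ ?N * s ^ Suc (Suc m)"
      by simp
    then have "d ^ ?N * s ^ m / 4 ^ Suc m \<le> band_energy k ^ ?N"
      using s by (subst (asm) mult_le_cancel_right_pos) auto
    then have "d ^ ?N * s ^ m \<le> band_energy k ^ ?N * 4 ^ Suc m"
      by (simp add: divide_le_eq)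
    also have "\<dots> \<le> band_energy k ^ ?N * 4 ^ ?N"
      using band_energy_nonneg[of k] by (intro mult_left_mono) (auto simp: m)
    finally show ?thesis by (simp add: power_mult_distrib \<rho>N mult.commute)
  qed
  then have "d * \<rho> ^ k \<le> 4 * band_energy k"
    unfolding m by (rule power_le_imp_le_base) (simp add: band_energy_nonneg)
  then show ?thesis by (simp add: d_def)
next
  case False
  then show ?thesis using level_mono[of k] band_energy_nonneg[of k] by simp
qed

lemma sum_level_step:
  assumes N: "2 \<le> CARD('n)"
  shows "(\<Sum>k<n. (level (Suc k) - level k)\<^sup>2 * (2 powr (2 / real CARD('n) - 1)) ^ k) \<le> 4 * energy"
proof -
  have "(\<Sum>k<n. (level (Suc k) - level k)\<^sup>2 * (2 powr (2 / real CARD('n) - 1)) ^ k) \<le>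
    (\<Sum>k<n. 4 * band_energy k)"
    by (intro sum_mono level_step N)
  also have "\<dots> \<le> 4 * energy"
    using sum_band_energy_le[of n] by (simp add: sum_distrib_left[symmetric])
  finally show ?thesis .
qed

end

section \<open>Integrals of the rearrangement\<close>

text \<open>Reduces both parts of the theorem to a discrete sum and a tail. The factor
  \<open>(1/2) ^ Suc k\<close> in the hypothesis on \<open>X\<close> is the length of the
  \<open>k\<close>-th dyadic interval.\<close>

lemma nn_integral_dyadic_le:
  fixes f :: "real \<Rightarrow> ennreal" and c :: "nat \<Rightarrow> real" and b :: "real \<Rightarrow> real"
  assumes c: "\<And>k t. (1/2) ^ Suc k < t \<Longrightarrow> t \<le> (1/2) ^ k \<Longrightarrow> f t \<le> ennreal (c k)" "\<And>k. 0 \<le> c k"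
    and b: "\<And>t. 1 < t \<Longrightarrow> f t \<le> ennreal (b t)" and [measurable]: "b \<in> borel_measurable borel"
    and X: "\<And>n. (\<Sum>k<n. c k * (1/2) ^ Suc k) \<le> X"
    and Y: "(\<integral>\<^sup>+t. ennreal (b t) * indicator {1..} t \<partial>lborel) \<le> ennreal Y" and "0 \<le> Y"
  shows "(\<integral>\<^sup>+t\<in>{0<..}. f t \<partial>lborel) \<le> ennreal (X + Y)"
proof -
  have "0 \<le> X" using X[of 0] by simp
  let ?I = "\<lambda>k. {(1/2) ^ Suc k<..(1/2) ^ k :: real}"
  let ?h = "\<lambda>t. (\<Sum>k. ennreal (c k) * indicator (?I k) t)"
  have "(\<integral>\<^sup>+t\<in>{0<..}. f t \<partial>lborel) \<le> (\<integral>\<^sup>+t. ?h t + ennreal (b t) * indicator {1..} t \<partial>lborel)"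
  proof (rule nn_integral_mono)
    fix t :: real
    consider "t \<le> 0" | "1 < t" | "0 < t" "t \<le> 1" by linarith
    then show "f t * indicator {0<..} t \<le> ?h t + ennreal (b t) * indicator {1..} t"
    proof cases
      case 2
      then have "f t * indicator {0<..} t \<le> ennreal (b t) * indicator {1..} t" using b[of t] by simp
      then show ?thesis by (rule add_increasing[OF zero_le])
    next
      case 3
      \<comment> \<open>The dyadic interval of \<open>t\<close> is found from the first power of 1/2
        below \<open>t\<close>; it is not the zeroth one, since \<open>t \<le> 1\<close>.\<close>
      define m where "m = (LEAST m. (1/2) ^ m < t)"
      have "\<exists>m. (1/2) ^ m < t" using real_arch_pow_inv[of t "1/2"] 3 by auto
      then have m: "(1/2) ^ m < t" unfolding m_def by (rule LeastI_ex)
      then obtain k where k: "m = Suc k" using 3 by (cases m) auto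
      have "\<not> (1/2) ^ k < t" using not_less_Least[of k "\<lambda>m. (1/2) ^ m < t"] k unfolding m_def by simp
      then have t: "t \<in> ?I k" using m k by auto
      have "f t \<le> (\<Sum>j\<in>{k}. ennreal (c j) * indicator (?I j) t)" using c(1)[of k t] t by simp
      also have "\<dots> \<le> ?h t" by (rule sum_le_suminf) auto
      finally show ?thesis using 3 by (simp add: add_increasing2)
    qed auto
  qed
  also have "\<dots> = (\<integral>\<^sup>+t. ?h t \<partial>lborel) + (\<integral>\<^sup>+t. ennreal (b t) * indicator {1..} t \<partial>lborel)"
    by (rule nn_integral_add) measurable
  also have "(\<integral>\<^sup>+t. ?h t \<partial>lborel) = (\<Sum>k. \<integral>\<^sup>+t. ennreal (c k) * indicator (?I k) t \<partial>lborel)"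
    by (rule nn_integral_suminf) measurable
  also have "\<dots> = (\<Sum>k. ennreal (c k * (1/2) ^ Suc k))"
  proof (rule suminf_cong)
    fix k
    have "(1/2) ^ k - (1/2) ^ Suc k = ((1/2) ^ Suc k :: real)" by simp
    then show "(\<integral>\<^sup>+t. ennreal (c k) * indicator (?I k) t \<partial>lborel) = ennreal (c k * (1/2) ^ Suc k)"
      by (simp add: nn_integral_cmult_indicator ennreal_mult c(2) del: power_Suc)
  qed
  also have "\<dots> \<le> ennreal X"
    unfolding suminf_eq_SUP
  proof (rule SUP_least)
    fix n
    have "(\<Sum>k<n. ennreal (c k * (1/2) ^ Suc k)) = ennreal (\<Sum>k<n. c k * (1/2) ^ Suc k)"
      using c(2) by (intro sum_ennreal) simp
    then show "(\<Sum>k<n. ennreal (c k * (1/2) ^ Suc k)) \<le> ennreal X"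
      using X[of n] by (simp add: ennreal_leI)
  qed
  also have "ennreal X + (\<integral>\<^sup>+t. ennreal (b t) * indicator {1..} t \<partial>lborel) \<le> ennreal (X + Y)"
    using Y \<open>0 \<le> X\<close> \<open>0 \<le> Y\<close> by simp
  finally show ?thesis by (simp add: add_right_mono)
qed

lemma nn_integral_powr_tail:
  assumes \<alpha>: "0 < \<alpha>" and "0 \<le> e"
  shows "(\<integral>\<^sup>+t. ennreal (e * t powr (- 1 - \<alpha>)) * indicator {1..} t \<partial>lborel) = ennreal (e / \<alpha>)"
proof -
  have "((\<lambda>t::real. - (e / \<alpha>) * t powr (- \<alpha>)) \<longlongrightarrow> - (e / \<alpha>) * 0) at_top"
    using \<alpha> by (intro tendsto_mult tendsto_const tendsto_neg_powr filterlim_ident) auto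
  then have "(\<integral>\<^sup>+t. ennreal (e * t powr (- 1 - \<alpha>)) * indicator {1..} t \<partial>lborel) =
    ennreal (- (e / \<alpha>) * 0 - (- (e / \<alpha>) * 1 powr (- \<alpha>)))"
  proof (intro nn_integral_FTC_atLeast)
    fix t :: real assume "1 \<le> t"
    then show "((\<lambda>t. - (e / \<alpha>) * t powr (- \<alpha>)) has_real_derivative e * t powr (- 1 - \<alpha>)) (at t)"
      unfolding minus_diff_commute[of 1 \<alpha>]
      using \<alpha> by (auto intro!: derivative_eq_intros)
  qed (use assms in auto)
  then show ?thesis by simp
qed

text \<open>The first summand is the constant of \<open>discrete_Hardy_geometric\<close> applied
  with \<open>D = 4 * energy\<close>; the second is the tail integral of
  \<open>t powr (- 1 - 2 / N)\<close> over the half line from 1.\<close>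

definition Hardy_const :: "nat \<Rightarrow> real" where
  "Hardy_const N = (let \<rho> = 2 powr (2 / real N - 1) in
     2 * (1 + \<rho> + 2 * \<rho>\<^sup>2 / (1 - \<rho>)) / (1 - \<rho>) * 4 + real N / 2)"

lemma Hardy_const_pos: "3 \<le> N \<Longrightarrow> 0 < Hardy_const N"
proof -
  assume N: "3 \<le> N"
  have "2 powr (2 / real N - 1) < (2::real) powr 0"
    using N by (intro powr_less_mono) (auto simp: field_simps)
  then show ?thesis using N
    by (auto simp: Hardy_const_def Let_def intro!: add_pos_pos mult_pos_pos divide_pos_pos add_pos_nonneg)
qed

text \<open>For \<open>a = - 2 / N\<close> the base on the right is \<open>\<rho>\<close>: the
  Lorentz weight at a dyadic point times the dyadic length is exactly the weight of
  \<open>level_step\<close>.\<close>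

lemma half_power_powr: "((1/2) ^ m) powr a * (1/2) ^ m = (2 powr (- a - 1)) ^ m" for a :: real
proof -
  have *: "(1/2) ^ m = 2 powr (- real m)"
    by (simp add: powr_minus powr_realpow power_one_over inverse_eq_divide)
  have "((1/2) ^ m) powr a * (1/2) ^ m = 2 powr (- real m * a + - real m)"
    unfolding * by (simp only: powr_powr powr_add)
  also have "- real m * a + - real m = (- a - 1) * real m" by (simp add: algebra_simps)
  also have "2 powr \<dots> = (2 powr (- a - 1)) ^ m"
    by (simp add: powr_powr[symmetric] powr_realpow)
  finally show ?thesis .
qed

section \<open>Integral bounds from the discrete Hardy inequalities\<close>

context weighted_sobolev_function
begin

lemma rearr_le_level:
  assumes "(1/2) ^ Suc k < t"
  shows "(rearr u t)\<^sup>2 \<le> ennreal ((level (Suc k))\<^sup>2)"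
proof -
  have "rearr u t \<le> ennreal (level (Suc k))"
    unfolding rearr_eq_level[symmetric] by (rule rearr_antimono) (use assms in simp)
  then have "(rearr u t)\<^sup>2 \<le> (ennreal (level (Suc k)))\<^sup>2" by (rule power_mono) simp
  then show ?thesis by (simp add: ennreal_power level_nonneg)
qed

text \<open>On each dyadic interval both the rearrangement and the decreasing power of
  \<open>t\<close> are bounded by their values at the left end, which gives the geometric Hardy sum.
  The hypothesis \<open>N\<close> makes \<open>\<rho>\<close> less than 1.\<close>

lemma Lorentz_bound:
  assumes N: "3 \<le> CARD('n)"
  shows "(\<integral>\<^sup>+t\<in>{0<..}. (rearr u t)\<^sup>2 * ennreal (t powr (2 / sobolev_exponent CARD('n) - 1)) \<partial>lborel)
    \<le> ennreal (Hardy_const CARD('n) * energy)"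
proof -
  define N where "N = CARD('n)"
  define \<rho> where "\<rho> = 2 powr (2 / real N - 1)"
  have "2 powr (2 / real N - 1) < (2::real) powr 0"
    using N by (intro powr_less_mono) (auto simp: field_simps N_def)
  then have \<rho>: "0 < \<rho>" "\<rho> < 1" by (auto simp: \<rho>_def)
  have ex: "2 / sobolev_exponent N - 1 = - 2 / real N"
    using N by (simp add: sobolev_exponent_def N_def field_simps)
  have Hardy: "(\<Sum>k<n. (level k)\<^sup>2 * \<rho> ^ k) \<le>
      2 * (1 + \<rho> + 2 * \<rho>\<^sup>2 / (1 - \<rho>)) / (1 - \<rho>) * (4 * energy)" for n
    using sum_level_step level_0_le energy_nonneg N
    by (intro discrete_Hardy_geometric \<rho>) (auto simp: \<rho>_def N_def)
  have "(\<integral>\<^sup>+t\<in>{0<..}. (rearr u t)\<^sup>2 * ennreal (t powr (- 2 / real N)) \<partial>lborel)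
    \<le> ennreal (2 * (1 + \<rho> + 2 * \<rho>\<^sup>2 / (1 - \<rho>)) / (1 - \<rho>) * (4 * energy) + energy / (2 / real N))"
  proof (rule nn_integral_dyadic_le)
    fix k and t :: real assume t: "(1/2) ^ Suc k < t" "t \<le> (1/2) ^ k"
    have "t powr (- 2 / real N) \<le> ((1/2) ^ Suc k) powr (- 2 / real N)"
      using t by (intro powr_mono2') auto
    then have "(rearr u t)\<^sup>2 * ennreal (t powr (- 2 / real N)) \<le>
        ennreal ((level (Suc k))\<^sup>2) * ennreal (((1/2) ^ Suc k) powr (- 2 / real N))"
      using t(1) by (intro mult_mono rearr_le_level ennreal_leI) auto
    then show "(rearr u t)\<^sup>2 * ennreal (t powr (- 2 / real N)) \<le>
        ennreal ((level (Suc k))\<^sup>2 * ((1/2) ^ Suc k) powr (- 2 / real N))"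
      by (simp add: ennreal_mult)
  next
    fix t :: real assume t: "1 < t"
    have "(rearr u t)\<^sup>2 * ennreal (t powr (- 2 / real N)) \<le> ennreal (energy / t) * ennreal (t powr (- 2 / real N))"
      using t by (intro mult_right_mono rearr_square_le) auto
    also have "\<dots> = ennreal (energy * t powr (- 1 - 2 / real N))"
      using t energy_nonneg by (simp add: ennreal_mult[symmetric] powr_diff powr_minus divide_inverse mult_ac)
    finally show "(rearr u t)\<^sup>2 * ennreal (t powr (- 2 / real N)) \<le> ennreal (energy * t powr (- 1 - 2 / real N))" .
  next
    fix n
    have "(\<Sum>k<n. (level (Suc k))\<^sup>2 * ((1/2) ^ Suc k) powr (- 2 / real N) * (1/2) ^ Suc k) =
        (\<Sum>k<n. (level (Suc k))\<^sup>2 * \<rho> ^ Suc k)"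
      unfolding mult.assoc half_power_powr by (simp add: \<rho>_def)
    also have "\<dots> \<le> (\<Sum>k<Suc n. (level k)\<^sup>2 * \<rho> ^ k)"
      by (subst sum.lessThan_Suc_shift) simp
    also have "\<dots> \<le> 2 * (1 + \<rho> + 2 * \<rho>\<^sup>2 / (1 - \<rho>)) / (1 - \<rho>) * (4 * energy)" by (rule Hardy)
    finally show "(\<Sum>k<n. (level (Suc k))\<^sup>2 * ((1/2) ^ Suc k) powr (- 2 / real N) * (1/2) ^ Suc k) \<le>
      2 * (1 + \<rho> + 2 * \<rho>\<^sup>2 / (1 - \<rho>)) / (1 - \<rho>) * (4 * energy)" .
  next
    show "(\<integral>\<^sup>+t. ennreal (energy * t powr (- 1 - 2 / real N)) * indicator {1..} t \<partial>lborel) \<le> ennreal (energy / (2 / real N))"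
      using N energy_nonneg by (subst nn_integral_powr_tail) (auto simp: N_def)
  qed (use energy_nonneg in auto)
  then show ?thesis
    unfolding N_def[symmetric] ex Hardy_const_def Let_def \<rho>_def[symmetric]
    by (simp add: algebra_simps)
qed

text \<open>In dimension 2 the ratio \<open>\<rho>\<close> is 1 and the logarithm supplies the Hardy
  weight. The constant is \<open>9 * 20 * 4 + 1\<close>: 9 compares the logarithm with the index, 20
  comes from \<open>discrete_Hardy\<close>, 4 from \<open>level_step\<close>, and 1 from the
  tail.\<close>

lemma Hansson_bound:
  assumes N: "CARD('n) = 2"
  shows "(\<integral>\<^sup>+t\<in>{0<..}. (rearr u t)\<^sup>2 / ennreal (t * (max 1 (ln (1 / t)))\<^sup>2) \<partial>lborel) \<le> ennreal (721 * energy)"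
proof -
  have "(\<integral>\<^sup>+t\<in>{0<..}. (rearr u t)\<^sup>2 / ennreal (t * (max 1 (ln (1 / t)))\<^sup>2) \<partial>lborel) \<le>
    ennreal (9 * (20 * (4 * energy)) + energy / 1)"
  proof (rule nn_integral_dyadic_le)
    fix k and t :: real assume t: "(1/2) ^ Suc k < t" "t \<le> (1/2) ^ k"
    have t0: "0 < t" using t(1) by (rule less_trans[rotated]) simp
    define M where "M = max 1 (ln (1 / t))"
    \<comment> \<open>For \<open>k\<close> at least 1, \<open>2 * k / 3\<close> is at least
      \<open>(k + 1) / 3\<close>; for \<open>k = 0\<close> the maximum with 1 suffices.\<close>
    have "real k * (2 / 3) \<le> real k * ln 2"
      using ln2_ge_two_thirds by (intro mult_left_mono) auto
    also have "\<dots> = ln (1 / (1/2) ^ k)" by (simp add: ln_div ln_realpow power_one_over)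
    also have "\<dots> \<le> ln (1 / t)" using t t0 by (intro ln_mono divide_left_mono) auto
    finally have "real (Suc k) / 3 \<le> M"
      unfolding M_def by (cases k) (auto simp: le_max_iff_disj)
    then have "(real (Suc k) / 3)\<^sup>2 \<le> M\<^sup>2" by (intro power_mono) auto
    then have le: "(1/2) ^ Suc k * (real (Suc k) / 3)\<^sup>2 \<le> t * M\<^sup>2"
      using t(1) t0 by (intro mult_mono) auto
    have pos: "0 < (1/2) ^ Suc k * (real (Suc k) / 3)\<^sup>2" by simp
    define r where "r = enn2real (rearr u t)"
    have r: "rearr u t = ennreal r" "0 \<le> r"
      using rearr_eq_real[OF t0] by (simp_all add: r_def)
    have "r\<^sup>2 \<le> (level (Suc k))\<^sup>2"
      using rearr_le_level[OF t(1)] r by (simp add: ennreal_power)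
    then have "r\<^sup>2 / (t * M\<^sup>2) \<le> (level (Suc k))\<^sup>2 / ((1/2) ^ Suc k * (real (Suc k) / 3)\<^sup>2)"
      using le pos by (intro frac_le) auto
    then have "ennreal (r\<^sup>2 / (t * M\<^sup>2)) \<le> ennreal ((level (Suc k))\<^sup>2 / ((1/2) ^ Suc k * (real (Suc k) / 3)\<^sup>2))"
      by (rule ennreal_leI)
    moreover have "(rearr u t)\<^sup>2 / ennreal (t * M\<^sup>2) = ennreal (r\<^sup>2 / (t * M\<^sup>2))"
    proof -
      have "0 < t * M\<^sup>2" using le pos by linarith
      then show ?thesis using r by (simp add: ennreal_power divide_ennreal)
    qed
    ultimately have "(rearr u t)\<^sup>2 / ennreal (t * M\<^sup>2) \<le>
        ennreal ((level (Suc k))\<^sup>2 / ((1/2) ^ Suc k * (real (Suc k) / 3)\<^sup>2))" by simp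
    then show "(rearr u t)\<^sup>2 / ennreal (t * (max 1 (ln (1 / t)))\<^sup>2) \<le>
        ennreal ((level (Suc k))\<^sup>2 / ((1/2) ^ Suc k * (real (Suc k) / 3)\<^sup>2))"
      by (simp only: M_def)
  next
    fix t :: real assume t: "1 < t"
    then have "0 < ln t" by simp
    moreover have "ln (1 / t) = - ln t" using t by (simp add: ln_div)
    ultimately have "max 1 (ln (1 / t)) = 1" by (intro max_absorb1) linarith
    then have "(rearr u t)\<^sup>2 / ennreal (t * (max 1 (ln (1 / t)))\<^sup>2) \<le> ennreal (energy / t) / ennreal t"
      using t by (simp add: divide_right_mono_ennreal rearr_square_le)
    also have "\<dots> = ennreal (energy * t powr (- 1 - 1))"
      using t energy_nonneg by (subst divide_ennreal) (auto simp: powr_diff powr_minus divide_inverse mult_ac power2_eq_square)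
    finally show "(rearr u t)\<^sup>2 / ennreal (t * (max 1 (ln (1 / t)))\<^sup>2) \<le> ennreal (energy * t powr (- 1 - 1))" .
  next
    fix n
    have "(\<Sum>k<n. (level (Suc k))\<^sup>2 / ((1/2) ^ Suc k * (real (Suc k) / 3)\<^sup>2) * (1/2) ^ Suc k) =
        (\<Sum>k<n. 9 * ((level (Suc k))\<^sup>2 / (real (Suc k))\<^sup>2))"
      by (intro sum.cong) (simp_all add: power_divide field_simps del: of_nat_Suc)
    also have "\<dots> = 9 * (\<Sum>k<n. (level (Suc k))\<^sup>2 / (real (Suc k))\<^sup>2)"
      by (rule sum_distrib_left[symmetric])
    also have "(\<Sum>k<n. (level (Suc k))\<^sup>2 / (real (Suc k))\<^sup>2) \<le> 20 * (4 * energy)"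
      using sum_level_step level_0_le energy_nonneg N
      by (intro discrete_Hardy level_nonneg level_mono) auto
    finally show "(\<Sum>k<n. (level (Suc k))\<^sup>2 / ((1/2) ^ Suc k * (real (Suc k) / 3)\<^sup>2) * (1/2) ^ Suc k)
        \<le> 9 * (20 * (4 * energy))" by simp
  next
    show "(\<integral>\<^sup>+t. ennreal (energy * t powr (- 1 - 1)) * indicator {1..} t \<partial>lborel) \<le> ennreal (energy / 1)"
      using energy_nonneg by (subst nn_integral_powr_tail) auto
  qed (use energy_nonneg in auto)
  then show ?thesis by (simp add: algebra_simps)
qed

end

subsection \<open>Passing to Borel representatives\<close>

lemma AE_mN: "(AE x in lborel. P x) \<Longrightarrow> (AE x in mN. P x)"
  unfolding mN_def
  by (subst AE_density) (auto simp: AE_completion_iff intro!: measurable_completion)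

lemma nn_integral_mN_cong_AE:
  fixes f f' :: "real^'n::finite \<Rightarrow> ennreal"
  assumes "f' \<in> borel_measurable borel" "AE x in lborel. f x = f' x"
  shows "(\<integral>\<^sup>+x. f x \<partial>mN) = (\<integral>\<^sup>+x. ennreal (weight x) * f' x \<partial>lborel)"
  using nn_integral_cong_AE[OF AE_mN[OF assms(2)]] nn_integral_mN[OF assms(1)] by simp

lemma rearr_cong_AE:
  fixes u u' :: "real^'n::finite \<Rightarrow> real"
  assumes [measurable]: "u \<in> borel_measurable lebesgue" "u' \<in> borel_measurable borel"
    and ae: "AE x in lborel. u x = u' x"
  shows "rearr u = rearr u'"
proof -
  have [measurable]: "u' \<in> borel_measurable lebesgue"
    by (auto intro!: measurable_completion)
  have *: "{x. t < \<bar>v x\<bar>} \<in> sets mN" if "v \<in> borel_measurable lebesgue" for v :: "real^'n \<Rightarrow> real" and t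
  proof -
    have "{x \<in> space lebesgue. t < \<bar>v x\<bar>} \<in> sets lebesgue" using that by measurable
    then show ?thesis by (simp add: sets_mN)
  qed
  have "emeasure mN {x. t < \<bar>u x\<bar>} = emeasure mN {x. t < \<bar>u' x\<bar>}" for t
  proof (rule emeasure_eq_AE)
    show "AE x in mN. x \<in> {x. t < \<bar>u x\<bar>} \<longleftrightarrow> x \<in> {x. t < \<bar>u' x\<bar>}"
      using AE_mN[OF ae] by eventually_elim simp
  qed (auto intro!: *)
  then show ?thesis by (simp add: rearr_def fun_eq_iff)
qed

text \<open>The rearrangement and all the integrals ignore null sets, so Borel representatives carry
  the whole problem. The square-integrability of \<open>g'\<close>, a representative of the chosen
  \<open>weak_gradient u\<close>, is inherited from the given \<open>g\<close> by
  uniqueness.\<close>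

lemma H1_mN_representative:
  fixes u :: "real^'n::finite \<Rightarrow> real"
  assumes u: "u \<in> H1_mN"
  obtains u' :: "real^'n \<Rightarrow> real" and g' :: "real^'n \<Rightarrow> real^'n"
  where "weighted_sobolev_function u' g'" "rearr u = rearr u'"
    "(\<integral>\<^sup>+x. ennreal ((norm (weak_gradient u x))\<^sup>2) \<partial>mN) = ennreal (weighted_sobolev_function.energy g')"
proof -
  obtain g where g: "has_weak_gradient u g" "g \<in> L2_mN" and "u \<in> L2_mN"
    using u by (auto simp: H1_mN_def)
  then have u2: "(\<integral>\<^sup>+x. ennreal ((norm (u x))\<^sup>2) \<partial>mN) < \<infinity>" and g2: "(\<integral>\<^sup>+x. ennreal ((norm (g x))\<^sup>2) \<partial>mN) < \<infinity>"
    by (auto simp: L2_mN_def)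
  have w: "has_weak_gradient u (weak_gradient u)"
    unfolding weak_gradient_def using someI[of "has_weak_gradient u" g, OF g(1)] .
  have um: "u \<in> borel_measurable lebesgue" and wm: "weak_gradient u \<in> borel_measurable lebesgue"
    using w by (auto simp: has_weak_gradient_def locally_integrable_def)
  obtain u' where u': "u' \<in> borel_measurable borel" "AE x in lborel. u x = u' x"
    using completion_ex_borel_measurable_real[OF um] by auto
  obtain g' where g': "g' \<in> borel_measurable borel" "AE x in lborel. weak_gradient u x = g' x"
    using AE_borel_representative[OF wm] .
  note [measurable] = u'(1) g'(1)
  have gg': "AE x in lborel. g x = g' x"
    using has_weak_gradient_unique[OF g(1) w] g'(2) by eventually_elim simp
  have mult: "ennreal (weight x) * ennreal r = ennreal (weight x * r)" if "0 \<le> r" for x :: "real^'n" and r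
    using that by (simp add: ennreal_mult)
  have wI: "(\<integral>\<^sup>+x. ennreal ((norm (weak_gradient u x))\<^sup>2) \<partial>mN) = (\<integral>\<^sup>+x. ennreal (weight x * (norm (g' x))\<^sup>2) \<partial>lborel)"
    by (subst nn_integral_mN_cong_AE[where f'="\<lambda>x. ennreal ((norm (g' x))\<^sup>2)"])
       (use g'(2) in \<open>auto simp: mult elim: eventually_mono\<close>)
  have gI: "(\<integral>\<^sup>+x. ennreal ((norm (g x))\<^sup>2) \<partial>mN) = (\<integral>\<^sup>+x. ennreal (weight x * (norm (g' x))\<^sup>2) \<partial>lborel)"
    by (subst nn_integral_mN_cong_AE[where f'="\<lambda>x. ennreal ((norm (g' x))\<^sup>2)"])
       (use gg' in \<open>auto simp: mult elim: eventually_mono\<close>)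
  have uI: "(\<integral>\<^sup>+x. ennreal ((norm (u x))\<^sup>2) \<partial>mN) = (\<integral>\<^sup>+x. ennreal (weight x * (u' x)\<^sup>2) \<partial>lborel)"
    by (subst nn_integral_mN_cong_AE[where f'="\<lambda>x. ennreal ((u' x)\<^sup>2)"])
       (use u'(2) in \<open>auto simp: mult elim: eventually_mono\<close>)
  have W: "weighted_sobolev_function u' g'"
    by unfold_locales (use has_weak_gradient_borel[OF w u' g'] g'(1) u2 g2 gI uI in auto)
  interpret weighted_sobolev_function u' g' by (rule W)
  show thesis
    by (rule that[OF W rearr_cong_AE[OF um u']]) (simp only: wI energy_eq)
qed

section \<open>The Lorentz norm as a root of the weighted integral\<close>

lemma ennpowr_mono: "0 \<le> a \<Longrightarrow> x \<le> y \<Longrightarrow> ennpowr x a \<le> ennpowr y a"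
  by (auto simp: ennpowr_def top_unique intro!: ennreal_leI powr_mono2 enn2real_mono simp: top.not_eq_extremum)

lemma ennpowr_cmult:
  assumes "0 < c"
  shows "ennpowr (ennreal c * y) a = ennreal (c powr a) * ennpowr y a"
proof (cases y)
  case (real r)
  then show ?thesis using assms
    by (simp add: ennpowr_def ennreal_mult[symmetric] powr_mult)
next
  case top
  then show ?thesis using assms by (simp add: ennpowr_def ennreal_mult_top)
qed

context weighted_sobolev_function
begin

text \<open>For positive \<open>t\<close> the rearrangement is finite, so the extended powers reduce
  to real ones and the factors of \<open>t\<close> combine to the exponent
  \<open>2 / p - 1\<close>.\<close>

lemma lorentz_norm_eq:
  "lorentz_norm p 2 u = ennpowr
    (\<integral>\<^sup>+t\<in>{0<..}. (rearr u t)\<^sup>2 * ennreal (t powr (2 / p - 1)) \<partial>lborel) (1 / 2)"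
proof -
  have "ennpowr (ennreal (t powr (1 / p)) * rearr u t) 2 / ennreal t = (rearr u t)\<^sup>2 * ennreal (t powr (2 / p - 1))"
    if t: "0 < t" for t
  proof -
    define r where "r = enn2real (rearr u t)"
    have r: "rearr u t = ennreal r" "0 \<le> r"
      using rearr_eq_real[OF t] by (simp_all add: r_def)
    have "(t powr (1 / p) * r) powr 2 / t = r\<^sup>2 * t powr (2 / p - 1)"
    \<comment> \<open>Rewriting \<open>powr 2\<close> as a square uses a positive base; at
      \<open>r = 0\<close> both sides are 0.\<close>
    proof (cases "r = 0")
      case False
      with r t have "(t powr (1 / p) * r) powr 2 = (t powr (1 / p) * r)\<^sup>2"
        by (intro powr_numeral) simp
      also have "\<dots> = r\<^sup>2 * t powr (2 / p)"
        using t by (simp add: power_mult_distrib powr_power)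
      finally show ?thesis using t by (simp add: powr_diff)
    qed simp
    then show ?thesis
      using t r by (simp add: ennpowr_def ennreal_mult[symmetric] ennreal_power divide_ennreal)
  qed
  then show ?thesis
    unfolding lorentz_norm_def by (intro arg_cong[where f="\<lambda>x. ennpowr x (1/2)"] nn_integral_cong) (auto simp: indicator_def)
qed

lemma lorentz_norm_le:
  assumes N: "3 \<le> CARD('n)"
  shows "lorentz_norm (sobolev_exponent CARD('n)) 2 u
    \<le> ennreal (Hardy_const CARD('n) powr (1 / 2)) * ennpowr (ennreal energy) (1 / 2)"
  unfolding lorentz_norm_eq ennpowr_cmult[OF Hardy_const_pos[OF N], symmetric]
  using Lorentz_bound[OF N] Hardy_const_pos[OF N] energy_nonneg
  by (intro ennpowr_mono) (auto simp: ennreal_mult)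

end

lemma ennreal_inverse_mult_le:
  assumes "X \<le> ennreal (c * e)" "0 < c" "0 \<le> e"
  shows "ennreal (1 / c) * X \<le> ennreal e"
proof -
  have "ennreal (1 / c) * X \<le> ennreal (1 / c) * ennreal (c * e)"
    using assms(1) by (rule mult_left_mono) simp
  also have "\<dots> = ennreal e" using assms by (simp add: ennreal_mult[symmetric])
  finally show ?thesis .
qed

theorem mainTheorem3:
  shows "(3 \<le> CARD('n::finite) \<longrightarrow>
      (\<exists>C>0. \<forall>u \<in> (H1_mN :: (real^'n \<Rightarrow> real) set).
        (\<integral>\<^sup>+x. ennreal ((norm (weak_gradient u x))\<^sup>2) \<partial>mN)
          \<ge> ennreal C * (\<integral>\<^sup>+t\<in>{0<..}. (rearr u t)\<^sup>2 *
                ennreal (t powr (2 / sobolev_exponent CARD('n) - 1)) \<partial>lborel)) \<and>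
      (\<exists>C>0. \<forall>u \<in> (H1_mN :: (real^'n \<Rightarrow> real) set).
        u \<in> lorentz_space (sobolev_exponent CARD('n)) 2 \<and>
        lorentz_norm (sobolev_exponent CARD('n)) 2 u \<le> ennreal C * H1_norm u))
    \<and> (CARD('n) = 2 \<longrightarrow>
      (\<exists>C>0. \<forall>u \<in> (H1_mN :: (real^'n \<Rightarrow> real) set).
        (\<integral>\<^sup>+x. ennreal ((norm (weak_gradient u x))\<^sup>2) \<partial>mN)
          \<ge> ennreal C * (\<integral>\<^sup>+t\<in>{0<..}. (rearr u t)\<^sup>2 /
                ennreal (t * (max 1 (ln (1 / t)))\<^sup>2) \<partial>lborel)))"
proof (intro conjI impI)
  assume N: "3 \<le> CARD('n)"
  let ?c = "Hardy_const CARD('n)"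
  have c: "0 < ?c" using N by (rule Hardy_const_pos)
  show "\<exists>C>0. \<forall>u \<in> (H1_mN :: (real^'n \<Rightarrow> real) set).
        (\<integral>\<^sup>+x. ennreal ((norm (weak_gradient u x))\<^sup>2) \<partial>mN)
          \<ge> ennreal C * (\<integral>\<^sup>+t\<in>{0<..}. (rearr u t)\<^sup>2 *
                ennreal (t powr (2 / sobolev_exponent CARD('n) - 1)) \<partial>lborel)"
  proof (intro exI[of _ "1 / ?c"] conjI ballI)
    fix u :: "real^'n \<Rightarrow> real" assume "u \<in> H1_mN"
    then obtain u' :: "real^'n \<Rightarrow> real" and g' :: "real^'n \<Rightarrow> real^'n" where *: "weighted_sobolev_function u' g'" "rearr u = rearr u'"
      "(\<integral>\<^sup>+x. ennreal ((norm (weak_gradient u x))\<^sup>2) \<partial>mN) = ennreal (weighted_sobolev_function.energy g')"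
      by (rule H1_mN_representative)
    interpret weighted_sobolev_function u' g' by (rule *)
    show "(\<integral>\<^sup>+x. ennreal ((norm (weak_gradient u x))\<^sup>2) \<partial>mN)
          \<ge> ennreal (1 / ?c) * (\<integral>\<^sup>+t\<in>{0<..}. (rearr u t)\<^sup>2 *
                ennreal (t powr (2 / sobolev_exponent CARD('n) - 1)) \<partial>lborel)"
      unfolding *(2,3) by (rule ennreal_inverse_mult_le[OF Lorentz_bound[OF N] c energy_nonneg])
  qed (use c in simp)
  show "\<exists>C>0. \<forall>u \<in> (H1_mN :: (real^'n \<Rightarrow> real) set).
        u \<in> lorentz_space (sobolev_exponent CARD('n)) 2 \<and>
        lorentz_norm (sobolev_exponent CARD('n)) 2 u \<le> ennreal C * H1_norm u"
  proof (intro exI[of _ "?c powr (1 / 2)"] conjI ballI)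
    fix u :: "real^'n \<Rightarrow> real" assume u: "u \<in> H1_mN"
    then obtain u' :: "real^'n \<Rightarrow> real" and g' :: "real^'n \<Rightarrow> real^'n" where *: "weighted_sobolev_function u' g'" "rearr u = rearr u'"
      "(\<integral>\<^sup>+x. ennreal ((norm (weak_gradient u x))\<^sup>2) \<partial>mN) = ennreal (weighted_sobolev_function.energy g')"
      by (rule H1_mN_representative)
    interpret weighted_sobolev_function u' g' by (rule *)
    \<comment> \<open>The Lorentz norm depends on the function only through its rearrangement, so
      \<open>u\<close> and \<open>u'\<close> share it.\<close>
    have le: "lorentz_norm (sobolev_exponent CARD('n)) 2 u
        \<le> ennreal (?c powr (1 / 2)) * ennpowr (ennreal energy) (1 / 2)"
      using lorentz_norm_le[OF N] *(2) by (simp add: lorentz_norm_def)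
    also have "\<dots> < \<infinity>"
      by (simp add: ennpowr_def ennreal_mult_less_top)
    finally show "u \<in> lorentz_space (sobolev_exponent CARD('n)) 2"
      using u by (simp add: lorentz_space_def H1_mN_def L2_mN_def)
    note le
    \<comment> \<open>The gradient part alone is dominated by the full norm: the \<open>L2\<close>
      term is added inside the root, and \<open>ennpowr\<close> is monotone.\<close>
    also have "ennreal (?c powr (1 / 2)) * ennpowr (ennreal energy) (1 / 2) \<le> ennreal (?c powr (1 / 2)) * H1_norm u"
      unfolding H1_norm_def *(3) by (intro mult_left_mono ennpowr_mono) auto
    finally show "lorentz_norm (sobolev_exponent CARD('n)) 2 u \<le> ennreal (?c powr (1 / 2)) * H1_norm u" .
  qed (use c in simp)
next
  assume N: "CARD('n) = 2"
  show "\<exists>C>0. \<forall>u \<in> (H1_mN :: (real^'n \<Rightarrow> real) set).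
        (\<integral>\<^sup>+x. ennreal ((norm (weak_gradient u x))\<^sup>2) \<partial>mN)
          \<ge> ennreal C * (\<integral>\<^sup>+t\<in>{0<..}. (rearr u t)\<^sup>2 /
                ennreal (t * (max 1 (ln (1 / t)))\<^sup>2) \<partial>lborel)"
  proof (intro exI[of _ "1 / 721"] conjI ballI)
    fix u :: "real^'n \<Rightarrow> real" assume "u \<in> H1_mN"
    then obtain u' :: "real^'n \<Rightarrow> real" and g' :: "real^'n \<Rightarrow> real^'n" where *: "weighted_sobolev_function u' g'" "rearr u = rearr u'"
      "(\<integral>\<^sup>+x. ennreal ((norm (weak_gradient u x))\<^sup>2) \<partial>mN) = ennreal (weighted_sobolev_function.energy g')"
      by (rule H1_mN_representative)
    interpret weighted_sobolev_function u' g' by (rule *)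
    show "(\<integral>\<^sup>+x. ennreal ((norm (weak_gradient u x))\<^sup>2) \<partial>mN)
          \<ge> ennreal (1 / 721) * (\<integral>\<^sup>+t\<in>{0<..}. (rearr u t)\<^sup>2 /
                ennreal (t * (max 1 (ln (1 / t)))\<^sup>2) \<partial>lborel)"
      unfolding *(2,3) by (rule ennreal_inverse_mult_le[OF Hansson_bound[OF N] _ energy_nonneg]) simp
  qed simp
qed

end
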